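(* Let $m,n$ be integers with $0 < m \leq |n|$, let $d = \gcd(m,n)$, and suppose that $G = BS(m,n) = \langle\, a, t \mid t^{-1} a^m t = a^n \,\rangle$ is not residually finite. Let $R$ be the intersection of all subgroups of finite index in $G$, let $\overline{G} = G/R$, let $\overline{A}$ be the subgroup of $\overline{G}$ generated by the images of the elements $t^k a^d t^{-k}$, $k \in \mathbb{Z}$, and let $A \leq G$ be the subgroup containing $R$ such that $A/R = \overline{A}$. Then the following inclusions hold: $$G \geq G'A \geq A \geq R, \qquad G \geq G' \geq \gamma_\omega G \geq R,$$ where the quotient $A/R$ is abelian. In particular: 1) If $n-m \geq d > 1$, then $$G/G'A \cong \mathbb{Z} \times \mathbb{Z}_d, \quad G/A \cong \mathbb{Z} * \mathbb{Z}_d, \quad G/G' \cong \mathbb{Z} \times \mathbb{Z}_{n-m}, \quad G'A/A \cong F_\infty.$$ 2) If $n-m > d = 1$, then $A$ contains $G'$ as a proper subgroup and $$G/A \cong \mathbb{Z}, \quad A/G' \cong \mathbb{Z}_{n-m}.$$ 3) If $n-m = d = 1$, then $G' = A = \gamma_\omega G$. 4) If $d$ is a power of some prime number, then $$G \geq G'A \geq A \geq \gamma_\omega G \geq R.$$ 5) If $n = m+d$ and $d$ is a power of some prime number, then $$G \geq G' \geq A \geq \gamma_\omega G \geq R.$$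
   Context: For a group $G$, the lower central series is defined by $\gamma_1 G = G$ and $\gamma_{i+1} G = [\gamma_i G, G]$ for $i \geq 1$, where $[X,Y]$ denotes the subgroup generated by all commutators $[x,y] = x^{-1}y^{-1}xy$ with $x \in X$, $y \in Y$; $G' = \gamma_2 G$ is the commutator subgroup and $\gamma_\omega G = \bigcap_{i=1}^{\infty}\gamma_i G$. A group is residually finite if for every non-identity element there is a homomorphism to a finite group not sending it to $1$. $\mathbb{Z}_k$ is the cyclic group of order $k$, $*$ denotes the free product, and $F_\infty$ is the free group of countably infinite rank. The following known fact (Moldavanskii) is recalled in the paper: when $G = BS(m,n)$ is not residually finite, $R$ is the normal closure in $G$ of the set of commutators $[t^k a^d t^{-k}, a]$, $k \in \mathbb{Z}$. *)

theory Defs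
  imports
    "HOL-Algebra.Elementary_Groups"
    "HOL-Algebra.Generated_Groups"
    "HOL-Computational_Algebra.Primes"
begin

section \<open>Free groups\<close>

text \<open>
  A letter \<open>(x, True)\<close> stands for the generator \<open>x\<close> and \<open>(x, False)\<close> for its inverse.
  The free group on \<open>X\<close> consists of the words over \<open>X\<close> modulo the equivalence relation
  generated by inserting and deleting cancelling pairs of letters.
\<close>

type_synonym 'x word = "('x \<times> bool) list"

definition words :: "'x set \<Rightarrow> 'x word set" where
  "words X = lists (X \<times> UNIV)"

inductive_set free_rel :: "'x set \<Rightarrow> ('x word \<times> 'x word) set" for X :: "'x set" where
  free_refl: "w \<in> words X \<Longrightarrow> (w, w) \<in> free_rel X"
| free_sym: "(v, w) \<in> free_rel X \<Longrightarrow> (w, v) \<in> free_rel X"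
| free_trans: "(u, v) \<in> free_rel X \<Longrightarrow> (v, w) \<in> free_rel X \<Longrightarrow> (u, w) \<in> free_rel X"
| free_cancel: "u \<in> words X \<Longrightarrow> v \<in> words X \<Longrightarrow> x \<in> X \<Longrightarrow>
    (u @ [(x, b), (x, \<not> b)] @ v, u @ v) \<in> free_rel X"

definition free_group :: "'x set \<Rightarrow> 'x word set monoid" where
  "free_group X = \<lparr>
     carrier = words X // free_rel X,
     monoid.mult = (\<lambda>U V. \<Union>u\<in>U. \<Union>v\<in>V. free_rel X `` {u @ v}),
     one = free_rel X `` {[]} \<rparr>"

definition free_gen :: "'x set \<Rightarrow> 'x \<Rightarrow> 'x word set" where
  "free_gen X x = free_rel X `` {[(x, True)]}"

lemma free_rel_words: "(u, v) \<in> free_rel X \<Longrightarrow> u \<in> words X \<and> v \<in> words X"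
  by (induction rule: free_rel.induct) (auto simp: words_def)

lemma equiv_free_rel: "equiv (words X) (free_rel X)"
  by (rule equivI)
    (auto simp: refl_on_def intro!: symI transI
      intro: free_refl free_sym free_trans dest: free_rel_words)

lemma free_rel_append_right:
  "(u, v) \<in> free_rel X \<Longrightarrow> w \<in> words X \<Longrightarrow> (u @ w, v @ w) \<in> free_rel X"
proof (induction rule: free_rel.induct)
  case (free_cancel u v x b)
  then show ?case
    using free_rel.free_cancel[of u X "v @ w" x b] by (simp add: words_def)
qed (auto simp: words_def intro: free_rel.intros)

lemma free_rel_append_left:
  "(u, v) \<in> free_rel X \<Longrightarrow> w \<in> words X \<Longrightarrow> (w @ u, w @ v) \<in> free_rel X"
proof (induction rule: free_rel.induct)
  case (free_cancel u v x b)
  then show ?case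
    using free_rel.free_cancel[of "w @ u" X v x b] by (simp add: words_def)
qed (auto simp: words_def intro: free_rel.intros)

lemma free_rel_append:
  assumes "(u, u') \<in> free_rel X" "(v, v') \<in> free_rel X"
  shows "(u @ v, u' @ v') \<in> free_rel X"
  using assms free_rel_words free_rel_append_left free_rel_append_right free_trans by meson

lemma free_group_mult:
  assumes "u \<in> words X" "v \<in> words X"
  shows "free_rel X `` {u} \<otimes>\<^bsub>free_group X\<^esub> free_rel X `` {v} = free_rel X `` {u @ v}"
proof -
  have "(\<lambda>u v. free_rel X `` {u @ v}) respects2 free_rel X"
    by (rule congruent2I')
      (meson equiv_class_eq equiv_free_rel free_rel_append)
  then show ?thesis
    unfolding free_group_def using assms
    by (simp add: UN_equiv_class2[OF equiv_free_rel equiv_free_rel])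
qed

definition inv_word :: "'x word \<Rightarrow> 'x word" where
  "inv_word w = rev (map (\<lambda>(x, b). (x, \<not> b)) w)"

lemma inv_word_in_words: "w \<in> words X \<Longrightarrow> inv_word w \<in> words X"
  by (auto simp: words_def inv_word_def lists_eq_set)

lemma inv_word_cancel: "w \<in> words X \<Longrightarrow> (inv_word w @ w, []) \<in> free_rel X"
proof (induction w)
  case Nil
  then show ?case by (simp add: inv_word_def words_def free_refl)
next
  case (Cons l w)
  obtain x b where l: "l = (x, b)" by force
  have w: "w \<in> words X" "x \<in> X" using Cons.prems l by (auto simp: words_def)
  have "(inv_word w @ [(x, \<not> b), (x, \<not> \<not> b)] @ w, inv_word w @ w) \<in> free_rel X"
    by (intro free_cancel inv_word_in_words w)
  then show ?case
    using Cons.IH[OF w(1)] by (auto simp: inv_word_def l intro: free_trans)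
qed

lemma group_free_group: "group (free_group X)"
proof (rule groupI)
  have cls: "\<exists>w\<in>words X. U = free_rel X `` {w}" if "U \<in> carrier (free_group X)" for U
    using that by (auto simp: free_group_def elim: quotientE)
  have mem: "free_rel X `` {w} \<in> carrier (free_group X)" if "w \<in> words X" for w
    using that by (simp add: free_group_def quotientI)
  have app: "u @ v \<in> words X" if "u \<in> words X" "v \<in> words X" for u v
    using that by (simp add: words_def)
  have one: "\<one>\<^bsub>free_group X\<^esub> = free_rel X `` {[]}" by (simp add: free_group_def)
  have nil: "[] \<in> words X" by (simp add: words_def)
  show "U \<otimes>\<^bsub>free_group X\<^esub> V \<in> carrier (free_group X)"
    if UV: "U \<in> carrier (free_group X)" "V \<in> carrier (free_group X)" for U V
    using cls[OF UV(1)] cls[OF UV(2)] by (auto simp: free_group_mult mem app)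
  show "\<one>\<^bsub>free_group X\<^esub> \<in> carrier (free_group X)" by (simp add: one mem nil)
  show "U \<otimes>\<^bsub>free_group X\<^esub> V \<otimes>\<^bsub>free_group X\<^esub> W = U \<otimes>\<^bsub>free_group X\<^esub> (V \<otimes>\<^bsub>free_group X\<^esub> W)"
    if UVW: "U \<in> carrier (free_group X)" "V \<in> carrier (free_group X)" "W \<in> carrier (free_group X)"
    for U V W
    using cls[OF UVW(1)] cls[OF UVW(2)] cls[OF UVW(3)] by (auto simp: free_group_mult app)
  show "\<one>\<^bsub>free_group X\<^esub> \<otimes>\<^bsub>free_group X\<^esub> U = U" if U: "U \<in> carrier (free_group X)" for U
    using cls[OF U] by (auto simp: one free_group_mult nil)
  show "\<exists>V\<in>carrier (free_group X). V \<otimes>\<^bsub>free_group X\<^esub> U = \<one>\<^bsub>free_group X\<^esub>"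
    if U: "U \<in> carrier (free_group X)" for U
  proof -
    obtain w where w: "w \<in> words X" "U = free_rel X `` {w}" using cls[OF U] by blast
    have "free_rel X `` {inv_word w} \<otimes>\<^bsub>free_group X\<^esub> U = \<one>\<^bsub>free_group X\<^esub>"
      using w inv_word_cancel[OF w(1)]
      by (simp add: one free_group_mult inv_word_in_words equiv_class_eq[OF equiv_free_rel])
    then show ?thesis using mem[OF inv_word_in_words[OF w(1)]] by blast
  qed
qed

section \<open>Presentations\<close>

definition normal_closure :: "('a, 'b) monoid_scheme \<Rightarrow> 'a set \<Rightarrow> 'a set" where
  "normal_closure G S = generate G {g \<otimes>\<^bsub>G\<^esub> s \<otimes>\<^bsub>G\<^esub> inv\<^bsub>G\<^esub> g | g s. g \<in> carrier G \<and> s \<in> S}"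

lemma (in group) normal_closure_normal:
  assumes "S \<subseteq> carrier G"
  shows "normal_closure G S \<lhd> G"
  unfolding normal_closure_def
proof (rule normal_generateI)
  show "{g \<otimes> s \<otimes> inv g | g s. g \<in> carrier G \<and> s \<in> S} \<subseteq> carrier G" using assms by auto
next
  fix h g
  assume "h \<in> {g \<otimes> s \<otimes> inv g | g s. g \<in> carrier G \<and> s \<in> S}" and g: "g \<in> carrier G"
  then obtain k s where k: "k \<in> carrier G" "s \<in> S" "h = k \<otimes> s \<otimes> inv k" by auto
  then have "g \<otimes> h \<otimes> inv g = (g \<otimes> k) \<otimes> s \<otimes> inv (g \<otimes> k)"
    using g assms by (auto simp: m_assoc inv_mult_group subsetD)
  then show "g \<otimes> h \<otimes> inv g \<in> {g \<otimes> s \<otimes> inv g | g s. g \<in> carrier G \<and> s \<in> S}"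
    using g k by blast
qed

text \<open>Relators are given as elements of the free group \<open>free_group X\<close>.\<close>

definition presented_group :: "'x set \<Rightarrow> 'x word set set \<Rightarrow> 'x word set set monoid" where
  "presented_group X S = free_group X Mod normal_closure (free_group X) S"

definition presented_gen :: "'x set \<Rightarrow> 'x word set set \<Rightarrow> 'x \<Rightarrow> 'x word set set" where
  "presented_gen X S x =
     normal_closure (free_group X) S #>\<^bsub>free_group X\<^esub> free_gen X x"

lemma group_presented_group:
  "S \<subseteq> carrier (free_group X) \<Longrightarrow> group (presented_group X S)"
  unfolding presented_group_def
  by (intro normal.factorgroup_is_group group.normal_closure_normal group_free_group)

lemma free_gen_closed: "x \<in> X \<Longrightarrow> free_gen X x \<in> carrier (free_group X)"
  by (auto simp: free_gen_def free_group_def words_def intro!: quotientI)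

section \<open>Baumslag--Solitar groups and free products\<close>

datatype bs_letter = Letter_a | Letter_t

definition bs_relator :: "int \<Rightarrow> int \<Rightarrow> bs_letter word set" where
  "bs_relator m n =
     (let F = free_group UNIV; a = free_gen UNIV Letter_a; t = free_gen UNIV Letter_t
      in inv\<^bsub>F\<^esub> t \<otimes>\<^bsub>F\<^esub> a [^]\<^bsub>F\<^esub> m \<otimes>\<^bsub>F\<^esub> t \<otimes>\<^bsub>F\<^esub> inv\<^bsub>F\<^esub> (a [^]\<^bsub>F\<^esub> n))"

definition BS :: "int \<Rightarrow> int \<Rightarrow> bs_letter word set set monoid" where
  "BS m n = presented_group UNIV {bs_relator m n}"

definition bs_a :: "int \<Rightarrow> int \<Rightarrow> bs_letter word set set" where
  "bs_a m n = presented_gen UNIV {bs_relator m n} Letter_a"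

definition bs_t :: "int \<Rightarrow> int \<Rightarrow> bs_letter word set set" where
  "bs_t m n = presented_gen UNIV {bs_relator m n} Letter_t"

lemma group_BS: "group (BS m n)"
proof -
  interpret F: group "free_group (UNIV :: bs_letter set)" by (rule group_free_group)
  show ?thesis
    unfolding BS_def
    by (rule group_presented_group) (simp add: bs_relator_def Let_def free_gen_closed)
qed

text \<open>
  The free product \<open>G * H\<close>: generators are the elements of \<open>G\<close> and of \<open>H\<close> (disjointly),
  relators are \<open>x \<cdot> y \<cdot> (x y)\<inverse>\<close> for \<open>x, y\<close> both in \<open>G\<close> or both in \<open>H\<close>.
\<close>

definition free_product_relators ::
    "('a, 'c) monoid_scheme \<Rightarrow> ('b, 'd) monoid_scheme \<Rightarrow> ('a + 'b) word set set" where
  "free_product_relators G H =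
     (let X = carrier G <+> carrier H; F = free_group X in
       {free_gen X (Inl x) \<otimes>\<^bsub>F\<^esub> free_gen X (Inl y) \<otimes>\<^bsub>F\<^esub> inv\<^bsub>F\<^esub> free_gen X (Inl (x \<otimes>\<^bsub>G\<^esub> y)) | x y.
          x \<in> carrier G \<and> y \<in> carrier G} \<union>
       {free_gen X (Inr x) \<otimes>\<^bsub>F\<^esub> free_gen X (Inr y) \<otimes>\<^bsub>F\<^esub> inv\<^bsub>F\<^esub> free_gen X (Inr (x \<otimes>\<^bsub>H\<^esub> y)) | x y.
          x \<in> carrier H \<and> y \<in> carrier H})"

definition free_product ::
    "('a, 'c) monoid_scheme \<Rightarrow> ('b, 'd) monoid_scheme \<Rightarrow> ('a + 'b) word set set monoid" where
  "free_product G H = presented_group (carrier G <+> carrier H) (free_product_relators G H)"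

section \<open>Residual finiteness, lower central series, chains of subgroups\<close>

text \<open>
  Every finite group is isomorphic to one whose elements are natural numbers, so
  quantifying over \<open>nat monoid\<close> covers all finite groups.
\<close>

definition residually_finite :: "('a, 'b) monoid_scheme \<Rightarrow> bool" where
  "residually_finite G \<longleftrightarrow>
     (\<forall>g\<in>carrier G. g \<noteq> \<one>\<^bsub>G\<^esub> \<longrightarrow>
        (\<exists>(K :: nat monoid) h. group K \<and> finite (carrier K) \<and> h \<in> hom G K \<and> h g \<noteq> \<one>\<^bsub>K\<^esub>))"

definition finite_residual :: "('a, 'b) monoid_scheme \<Rightarrow> 'a set" where
  "finite_residual G = \<Inter> {H. subgroup H G \<and> finite (rcosets\<^bsub>G\<^esub> H)}"

definition commutator :: "('a, 'b) monoid_scheme \<Rightarrow> 'a \<Rightarrow> 'a \<Rightarrow> 'a" where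
  "commutator G x y = inv\<^bsub>G\<^esub> x \<otimes>\<^bsub>G\<^esub> inv\<^bsub>G\<^esub> y \<otimes>\<^bsub>G\<^esub> x \<otimes>\<^bsub>G\<^esub> y"

definition commutator_subgroup :: "('a, 'b) monoid_scheme \<Rightarrow> 'a set \<Rightarrow> 'a set \<Rightarrow> 'a set" where
  "commutator_subgroup G X Y = generate G {commutator G x y | x y. x \<in> X \<and> y \<in> Y}"

text \<open>The series is indexed from 1; the value at 0 is irrelevant.\<close>

fun lower_central :: "('a, 'b) monoid_scheme \<Rightarrow> nat \<Rightarrow> 'a set" where
  "lower_central G 0 = carrier G"
| "lower_central G (Suc 0) = carrier G"
| "lower_central G (Suc (Suc i)) = commutator_subgroup G (lower_central G (Suc i)) (carrier G)"

definition lower_central_omega :: "('a, 'b) monoid_scheme \<Rightarrow> 'a set" where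
  "lower_central_omega G = (\<Inter>i\<in>{1..}. lower_central G i)"

text \<open>\<open>subgroup_chain G [H\<^sub>1, \<dots>, H\<^sub>k]\<close> means \<open>G \<ge> H\<^sub>1 \<ge> \<dots> \<ge> H\<^sub>k\<close> as subgroups.\<close>

definition subgroup_chain :: "('a, 'b) monoid_scheme \<Rightarrow> 'a set list \<Rightarrow> bool" where
  "subgroup_chain G Hs \<longleftrightarrow> (\<forall>H\<in>set Hs. subgroup H G) \<and> sorted_wrt (\<supseteq>) Hs"

text \<open>
  Correspondence theorem: a subgroup of \<open>G Mod N\<close> is \<open>A Mod N\<close> for exactly one subgroup
  \<open>A\<close> of \<open>G\<close> containing \<open>N\<close>.
\<close>

lemma ex1_subgroup_of_quotient:
  assumes N: "N \<lhd> G" and Q: "subgroup Q (G Mod N)"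
  shows "\<exists>!A. subgroup A G \<and> N \<subseteq> A \<and> carrier (G\<lparr>carrier := A\<rparr> Mod N) = Q"
proof -
  interpret N: normal N G by (rule N)
  have car: "carrier (G\<lparr>carrier := A\<rparr> Mod N) = (\<lambda>x. N #>\<^bsub>G\<^esub> x) ` A" for A
    by (auto simp: carrier_FactGroup r_coset_def)
  define A where "A = {g \<in> carrier G. N #>\<^bsub>G\<^esub> g \<in> Q}"
  have "group_hom G (G Mod N) (\<lambda>x. N #>\<^bsub>G\<^esub> x)"
    by (simp add: group_hom_def group_hom_axioms_def N.is_group N.factorgroup_is_group
        N.r_coset_hom_Mod)
  note h = group_hom.hom_mult[OF this] group_hom.hom_inv[OF this] group_hom.hom_one[OF this]
  have A: "subgroup A G"
  proof (rule subgroup.intro)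
    show "A \<subseteq> carrier G" by (simp add: A_def)
    show "\<one>\<^bsub>G\<^esub> \<in> A" using h(3) subgroup.one_closed[OF Q] N.one_closed by (simp add: A_def)
    show "x \<otimes>\<^bsub>G\<^esub> y \<in> A" if "x \<in> A" "y \<in> A" for x y
      using that h(1) subgroup.m_closed[OF Q] by (simp add: A_def del: mult_FactGroup)
    show "inv\<^bsub>G\<^esub> x \<in> A" if "x \<in> A" for x
      using that h(2) subgroup.m_inv_closed[OF Q] by (simp add: A_def)
  qed
  have NA: "N \<subseteq> A"
  proof
    fix x assume x: "x \<in> N"
    then have "N #>\<^bsub>G\<^esub> x = N" by (simp add: N.rcos_const)
    then show "x \<in> A" using subgroup.one_closed[OF Q] x by (simp add: A_def)
  qed
  have AQ: "(\<lambda>x. N #>\<^bsub>G\<^esub> x) ` A = Q"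
    using subgroup.subset[OF Q] unfolding A_def carrier_FactGroup by blast
  have uniq: "B = A" if B: "subgroup B G" "N \<subseteq> B" "(\<lambda>x. N #>\<^bsub>G\<^esub> x) ` B = Q" for B
  proof
    show "B \<subseteq> A" using B(3) subgroup.subset[OF B(1)] unfolding A_def by blast
    show "A \<subseteq> B"
    proof
      fix g assume g: "g \<in> A"
      then have "N #>\<^bsub>G\<^esub> g \<in> (\<lambda>x. N #>\<^bsub>G\<^esub> x) ` B" by (simp add: B(3) A_def)
      then obtain b where b: "b \<in> B" "N #>\<^bsub>G\<^esub> g = N #>\<^bsub>G\<^esub> b" by blast
      have "g \<in> N #>\<^bsub>G\<^esub> b"
        using g N.rcos_self[OF _ N.is_subgroup] by (simp add: A_def flip: b(2))
      then obtain x where "x \<in> N" "g = x \<otimes>\<^bsub>G\<^esub> b" unfolding r_coset_def by blast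
      then show "g \<in> B" using subgroup.m_closed[OF B(1)] B(2) b(1) by blast
    qed
  qed
  show ?thesis
    unfolding car by (intro ex1I[of _ A] conjI A NA AQ) (elim conjE, rule uniq)
qed

end

theory Submission
  imports Defs
    "HOL-Algebra.Multiplicative_Group"
    "HOL-Combinatorics.Permutations"
    "HOL-Library.Countable_Set"
begin

text \<open>
  In a finite quotient of \<open>G = BS(m, n)\<close> the images of \<open>a\<^sup>m\<close> and \<open>a\<^sup>n\<close> are conjugate and
  therefore generate the same cyclic group as \<open>a\<^sup>d\<close>, so that \<open>t\<close> normalises \<open>\<langle>a\<^sup>d\<rangle>\<close>; hence the elements
  \<open>t\<^sup>k a\<^sup>d t\<^sup>-\<^sup>k\<close> commute with each other and with \<open>a\<close> modulo \<open>R\<close>.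
  The quotient of \<open>G\<close> by the normal closure \<open>N\<close> of \<open>a\<^sup>d\<close> is \<open>\<int> * \<int>\<^sub>d\<close>. It is residually
  finite, because a reduced word traces an injective path that extends to a finite permutation
  representation; so \<open>R \<le> N\<close> and \<open>A = N\<close>. If \<open>d\<close> is a power of the prime \<open>p\<close>, it is moreover residually
  nilpotent: let \<open>t\<close> and \<open>a\<close> act by \<open>1 + X\<close> and \<open>1 + Y\<close> over the field with \<open>p\<close> elements, where the
  nilpotent shifts \<open>X\<close> and \<open>Y\<close> are read off a reduced word, as in Magnus' embedding.
  For \<open>R \<le> \<gamma>\<^sub>i\<close>, the element \<open>a\<close> has finite order modulo \<open>\<gamma>\<^sub>i\<close> if \<open>m \<noteq> n\<close>, so some power of \<open>t\<close> is
  central modulo \<open>\<gamma>\<^sub>i\<close> and can be used to separate elements in finite quotients.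
  The commutator subgroup of \<open>\<int> * \<int>\<^sub>d\<close> is free on Schreier generators, which is seen from an
  action of \<open>G\<close> on \<open>F \<times> \<int> \<times> \<int>\<^sub>d\<close> with \<open>F\<close> free.
\<close>

text \<open>A choice of images \<alpha> and \<tau> with \<alpha>^d = 1 always extends to G: both
  sides of the relation become \<tau>, because d divides m and n, and the extension kills the normal
  closure N of a^d. Facts about Z * Z_d are therefore read off from representations of G built for
  the purpose, and uniqueness of normal forms is never proved: a word is brought into some reduced
  form, and a representation made from this very word shows that it is non-trivial. Two reduced
  forms are needed, with single letters t and t^-1 for the finite paths and with whole powers of t
  for the unipotent maps.

  A is given by generators modulo R only, so A <= N cannot be had before R <= N. This makes the
  residual finiteness of G / N the pivot for all claims about A.

  The inclusion in \<gamma>_i has another obstacle: for i >= 2 the element t has infinite order in G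
  / \<gamma>_i, so a finite quotient leaves a power of t undetermined. The exponent sum of t, a
  homomorphism to Z, removes it.\<close>

lemma group_hom_iff: "group_hom G K h \<longleftrightarrow> group G \<and> group K \<and> h \<in> hom G K"
  by (simp add: group_hom_def group_hom_axioms_def)

text \<open>\<open>generate\<close> multiplies two arbitrary elements, whereas later arguments
  prepend one generator at a time. The property "P x implies P (g x) for all x" is stable under
  products in g and mediates between the two.\<close>

lemma (in group) generate_left_induct [consumes 1, case_names subset one incl inv]:
  assumes "g \<in> generate G S" "S \<subseteq> carrier G" "P \<one>"
    and incl: "\<And>s x. s \<in> S \<Longrightarrow> x \<in> carrier G \<Longrightarrow> P x \<Longrightarrow> P (s \<otimes> x)"
    and inv: "\<And>s x. s \<in> S \<Longrightarrow> x \<in> carrier G \<Longrightarrow> P x \<Longrightarrow> P (inv s \<otimes> x)"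
  shows "P g"
proof -
  have "\<forall>x\<in>carrier G. P x \<longrightarrow> P (g \<otimes> x)"
    using assms(1)
  proof induction
    case (eng h1 h2)
    have "h1 \<in> carrier G" "h2 \<in> carrier G"
      using eng.hyps assms(2) generate_in_carrier by blast+
    then show ?case
      using eng.IH by (simp add: m_assoc)
  qed (use assms(2) incl inv in auto)
  moreover have "g \<in> carrier G"
    using assms(1,2) generate_in_carrier by blast
  ultimately show ?thesis
    using assms(3) by (metis one_closed r_one)
qed

lemma hom_eq_on_generate:
  assumes "group G" "group K" "h \<in> hom G K" "h' \<in> hom G K" "S \<subseteq> carrier G"
    and "\<And>s. s \<in> S \<Longrightarrow> h s = h' s" and "g \<in> generate G S"
  shows "h g = h' g"
proof -
  interpret h: group_hom G K h
    using assms by (simp add: group_hom_iff)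
  interpret h': group_hom G K h'
    using assms by (simp add: group_hom_iff)
  show ?thesis
    using assms(7)
  proof induction
    case (inv s)
    then show ?case
      using assms(5,6) h.hom_inv h'.hom_inv by (metis subsetD)
  next
    case (eng x y)
    then show ?case
      using h.G.generate_in_carrier[OF assms(5)] by simp
  qed (use assms(6) in auto)
qed

section \<open>Universal properties\<close>

definition word_eval :: "('a, 'b) monoid_scheme \<Rightarrow> ('x \<Rightarrow> 'a) \<Rightarrow> 'x word \<Rightarrow> 'a" where
  "word_eval K f w =
     foldr (\<lambda>(x, b) y. (if b then f x else inv\<^bsub>K\<^esub> (f x)) \<otimes>\<^bsub>K\<^esub> y) w \<one>\<^bsub>K\<^esub>"

lemma words_simps [simp]:
  "[] \<in> words X"
  "(l # w) \<in> words X \<longleftrightarrow> fst l \<in> X \<and> w \<in> words X"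
  "(u @ v) \<in> words X \<longleftrightarrow> u \<in> words X \<and> v \<in> words X"
  by (cases l; auto simp: words_def)+

context group
begin

lemma word_eval_simps [simp]:
  "word_eval G f [] = \<one>"
  "word_eval G f ((x, b) # w) = (if b then f x else inv (f x)) \<otimes> word_eval G f w"
  by (simp_all add: word_eval_def)

lemma word_eval_closed:
  assumes "f \<in> X \<rightarrow> carrier G" "w \<in> words X"
  shows "word_eval G f w \<in> carrier G"
  using assms(2) by (induction w) (use assms(1) in \<open>auto simp: Pi_iff\<close>)

lemma word_eval_append:
  assumes "f \<in> X \<rightarrow> carrier G" "u \<in> words X" "v \<in> words X"
  shows "word_eval G f (u @ v) = word_eval G f u \<otimes> word_eval G f v"
  using assms(2)
proof (induction u)
  case (Cons l u)
  obtain x b where l: "l = (x, b)" by force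
  then show ?case
    using Cons assms word_eval_closed[OF assms(1)] by (auto simp: m_assoc Pi_iff)
qed (use assms word_eval_closed[OF assms(1)] in auto)

lemma word_eval_free_rel:
  assumes "f \<in> X \<rightarrow> carrier G" "(u, v) \<in> free_rel X"
  shows "word_eval G f u = word_eval G f v"
  using assms(2)
proof induction
  case (free_cancel u v x b)
  have "word_eval G f ([(x, b), (x, \<not> b)] @ v) = word_eval G f v"
    using free_cancel assms(1) word_eval_closed[OF assms(1), of v]
    by (auto simp: Pi_iff m_assoc[symmetric])
  then show ?case
    using free_cancel word_eval_append[OF assms(1)] by (metis words_simps fst_conv)
qed auto

lemma free_group_universal:
  assumes "f \<in> X \<rightarrow> carrier G"
  obtains h where "h \<in> hom (free_group X) G" "\<And>x. x \<in> X \<Longrightarrow> h (free_gen X x) = f x"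
proof
  define h where "h U = word_eval G f (SOME w. w \<in> U)" for U
  have h: "h (free_rel X `` {w}) = word_eval G f w" if "w \<in> words X" for w
  proof -
    have "w \<in> free_rel X `` {w}"
      using that by (simp add: free_refl)
    then have "(SOME w'. w' \<in> free_rel X `` {w}) \<in> free_rel X `` {w}"
      by (rule someI)
    then show ?thesis
      unfolding h_def using word_eval_free_rel[OF assms] by (metis Image_singleton_iff)
  qed
  have cls: "\<exists>w\<in>words X. U = free_rel X `` {w}" if "U \<in> carrier (free_group X)" for U
    using that by (auto simp: free_group_def elim: quotientE)
  show "h \<in> hom (free_group X) G"
  proof (rule homI)
    fix U V assume "U \<in> carrier (free_group X)" "V \<in> carrier (free_group X)"
    then show "h (U \<otimes>\<^bsub>free_group X\<^esub> V) = h U \<otimes> h V"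
      using cls h word_eval_append[OF assms] by (metis free_group_mult words_simps(3))
  qed (use cls h word_eval_closed[OF assms] in metis)
  show "h (free_gen X x) = f x" if "x \<in> X" for x
    unfolding free_gen_def using that assms by (subst h) (auto simp: Pi_iff)
qed

end

section \<open>Generators of free and presented groups, homomorphisms out of them\<close>

lemma carrier_free_group: "carrier (free_group X) = generate (free_group X) (free_gen X ` X)"
proof
  interpret F: group "free_group X" by (rule group_free_group)
  have sub: "free_gen X ` X \<subseteq> carrier (free_group X)"
    by (auto intro: free_gen_closed)
  show "generate (free_group X) (free_gen X ` X) \<subseteq> carrier (free_group X)"
    using F.generate_incl[OF sub] .
  have letter: "free_rel X `` {[(x, b)]} \<in> generate (free_group X) (free_gen X ` X)" if "x \<in> X" for x b
  proof (cases b)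
    case True
    then show ?thesis
      using that by (auto simp: free_gen_def intro!: generate.incl)
  next
    case False
    have "([(x, False), (x, True)], []) \<in> free_rel X"
      using free_cancel[of "[]" X "[]" x False] that by simp
    then have "free_rel X `` {[(x, False), (x, True)]} = free_rel X `` {[]}"
      by (rule equiv_class_eq[OF equiv_free_rel])
    then have "free_rel X `` {[(x, False)]} \<otimes>\<^bsub>free_group X\<^esub> free_gen X x = \<one>\<^bsub>free_group X\<^esub>"
      using that unfolding free_gen_def by (subst free_group_mult) (auto simp: free_group_def)
    moreover have "free_rel X `` {[(x, False)]} \<in> carrier (free_group X)"
      using that by (auto simp: free_group_def intro!: quotientI)
    ultimately have "free_rel X `` {[(x, False)]} = inv\<^bsub>free_group X\<^esub> (free_gen X x)"
      using that free_gen_closed[of x X] by (simp add: F.inv_equality)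
    then show ?thesis
      using that False by (auto intro: generate.inv)
  qed
  have "free_rel X `` {w} \<in> generate (free_group X) (free_gen X ` X)" if "w \<in> words X" for w
    using that
  proof (induction w)
    case Nil
    then show ?case
      using generate.one[of "free_group X"] by (simp add: free_group_def)
  next
    case (Cons l w)
    then have "free_rel X `` {l # w} = free_rel X `` {[l]} \<otimes>\<^bsub>free_group X\<^esub> free_rel X `` {w}"
      by (subst free_group_mult) auto
    then show ?case
      using Cons letter[of "fst l" "snd l"] by (auto intro: generate.eng)
  qed
  then show "carrier (free_group X) \<subseteq> generate (free_group X) (free_gen X ` X)"
    by (auto simp: free_group_def elim: quotientE)
qed

lemma (in group) normal_closure_incl: "S \<subseteq> carrier G \<Longrightarrow> S \<subseteq> normal_closure G S"
proof
  fix s assume s: "S \<subseteq> carrier G" "s \<in> S"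
  then have "s = \<one> \<otimes> s \<otimes> inv \<one>"
    by (auto simp: subsetD)
  then have "\<exists>g s'. s = g \<otimes> s' \<otimes> inv g \<and> g \<in> carrier G \<and> s' \<in> S"
    using s(2) one_closed by blast
  then show "s \<in> normal_closure G S"
    unfolding normal_closure_def by (blast intro: generate.incl)
qed

lemma (in group) normal_closure_minimal:
  assumes "N \<lhd> G" "S \<subseteq> N"
  shows "normal_closure G S \<subseteq> N"
  unfolding normal_closure_def
proof (rule generate_subgroup_incl)
  show "subgroup N G"
    using assms normal_imp_subgroup by blast
  show "{g \<otimes> s \<otimes> inv g |g s. g \<in> carrier G \<and> s \<in> S} \<subseteq> N"
    using assms normal.inv_op_closed2[OF assms(1)] by blast
qed

text \<open>Relators are elements of the free group, not words, so they have no value under f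
  directly. The premise \<open>rel\<close> therefore speaks of an arbitrary homomorphism extending
  f, and checking it only needs the homomorphism laws.\<close>

lemma (in group) presented_group_universal:
  assumes S: "S \<subseteq> carrier (free_group X)" and f: "f \<in> X \<rightarrow> carrier G"
    and rel: "\<And>h s. h \<in> hom (free_group X) G \<Longrightarrow> (\<And>x. x \<in> X \<Longrightarrow> h (free_gen X x) = f x) \<Longrightarrow>
      s \<in> S \<Longrightarrow> h s = \<one>"
  obtains h where "h \<in> hom (presented_group X S) G"
    "\<And>x. x \<in> X \<Longrightarrow> h (presented_gen X S x) = f x"
proof -
  obtain h where h: "h \<in> hom (free_group X) G" "\<And>x. x \<in> X \<Longrightarrow> h (free_gen X x) = f x"
    using free_group_universal[OF f] by blast
  interpret h: group_hom "free_group X" G h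
    using h group_free_group is_group by (simp add: group_hom_iff)
  have N: "normal_closure (free_group X) S \<lhd> free_group X"
    using h.G.normal_closure_normal[OF S] .
  have "S \<subseteq> kernel (free_group X) G h"
    using S rel[OF h] by (auto simp: kernel_def)
  then have "normal_closure (free_group X) S \<subseteq> kernel (free_group X) G h"
    by (rule h.G.normal_closure_minimal[OF h.normal_kernel])
  then obtain g where "g \<in> hom (presented_group X S) G"
      "\<And>x. x \<in> carrier (free_group X) \<Longrightarrow>
        g (normal_closure (free_group X) S #>\<^bsub>free_group X\<^esub> x) = h x"
    using h.FactGroup_universal_kernel[OF N] unfolding presented_group_def by metis
  then show thesis
    using that h(2) free_gen_closed unfolding presented_gen_def by metis
qed

lemma presented_hom:
  assumes S: "S \<subseteq> carrier (free_group X)"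
  shows "(\<lambda>x. normal_closure (free_group X) S #>\<^bsub>free_group X\<^esub> x)
    \<in> hom (free_group X) (presented_group X S)"
proof -
  interpret F: group "free_group X" by (rule group_free_group)
  interpret N: normal "normal_closure (free_group X) S" "free_group X"
    by (rule F.normal_closure_normal[OF S])
  show ?thesis
    unfolding presented_group_def by (rule N.r_coset_hom_Mod)
qed

lemma presented_gen_closed:
  assumes S: "S \<subseteq> carrier (free_group X)" and "x \<in> X"
  shows "presented_gen X S x \<in> carrier (presented_group X S)"
  using hom_in_carrier[OF presented_hom[OF S] free_gen_closed[OF assms(2)]]
  by (simp add: presented_gen_def)

lemma carrier_presented_group:
  assumes S: "S \<subseteq> carrier (free_group X)"
  shows "carrier (presented_group X S) = generate (presented_group X S) (presented_gen X S ` X)"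
proof -
  let ?q = "\<lambda>x. normal_closure (free_group X) S #>\<^bsub>free_group X\<^esub> x"
  interpret q: group_hom "free_group X" "presented_group X S" ?q
    using group_free_group group_presented_group[OF S] presented_hom[OF S]
    by (simp add: group_hom_iff)
  have "carrier (presented_group X S) = ?q ` carrier (free_group X)"
    by (simp add: presented_group_def carrier_FactGroup)
  also have "\<dots> = generate (presented_group X S) (?q ` free_gen X ` X)"
    by (subst carrier_free_group, rule q.generate_img[symmetric]) (auto intro: free_gen_closed)
  finally show ?thesis
    by (simp add: presented_gen_def image_image)
qed

lemma presented_relator:
  assumes S: "S \<subseteq> carrier (free_group X)" and "s \<in> S"
  shows "normal_closure (free_group X) S #>\<^bsub>free_group X\<^esub> s = \<one>\<^bsub>presented_group X S\<^esub>"
proof -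
  interpret F: group "free_group X" by (rule group_free_group)
  interpret N: normal "normal_closure (free_group X) S" "free_group X"
    by (rule F.normal_closure_normal[OF S])
  show ?thesis
    using F.normal_closure_incl[OF S] assms(2) N.rcos_const by (simp add: presented_group_def subsetD)
qed

section \<open>Baumslag--Solitar groups\<close>

lemma bs_relator_closed: "bs_relator m n \<in> carrier (free_group UNIV)"
proof -
  interpret F: group "free_group (UNIV :: bs_letter set)" by (rule group_free_group)
  show ?thesis
    by (simp add: bs_relator_def Let_def free_gen_closed)
qed

lemma hom_bs_relator:
  assumes "group K" "h \<in> hom (free_group UNIV) K"
    and "h (free_gen UNIV Letter_a) = a" "h (free_gen UNIV Letter_t) = t"
  shows "h (bs_relator m n) =
    inv\<^bsub>K\<^esub> t \<otimes>\<^bsub>K\<^esub> a [^]\<^bsub>K\<^esub> m \<otimes>\<^bsub>K\<^esub> t \<otimes>\<^bsub>K\<^esub> inv\<^bsub>K\<^esub> (a [^]\<^bsub>K\<^esub> n)"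
proof -
  interpret h: group_hom "free_group UNIV" K h
    using assms group_free_group by (simp add: group_hom_iff)
  show ?thesis
    unfolding bs_relator_def Let_def
    by (simp add: free_gen_closed h.hom_int_pow assms(3,4))
qed

text \<open>The relation is stated without inverses, so that for permutations it is an equation
  between two compositions.\<close>

lemma (in group) BS_universal:
  assumes "a \<in> carrier G" "t \<in> carrier G" and rel: "a [^] m \<otimes> t = t \<otimes> a [^] n"
  obtains h where "h \<in> hom (BS m n) G" "h (bs_a m n) = a" "h (bs_t m n) = t"
proof -
  define f where "f l = (case l of Letter_a \<Rightarrow> a | Letter_t \<Rightarrow> t)" for l
  have "h (bs_relator m n) = \<one>"
    if "h \<in> hom (free_group UNIV) G" "\<And>x. x \<in> UNIV \<Longrightarrow> h (free_gen UNIV x) = f x" for h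
    using hom_bs_relator[OF is_group that(1)] that(2) rel assms(1,2)
    by (simp add: f_def m_assoc)
  moreover have "f \<in> UNIV \<rightarrow> carrier G"
    using assms by (auto simp: f_def split: bs_letter.splits)
  ultimately obtain h where "h \<in> hom (BS m n) G"
      "\<And>x. h (presented_gen UNIV {bs_relator m n} x) = f x"
    using presented_group_universal[of "{bs_relator m n}" UNIV f] bs_relator_closed
    unfolding BS_def by auto
  then show thesis
    using that by (simp add: bs_a_def bs_t_def f_def)
qed

lemma BS_generators_closed [simp]:
  "bs_a m n \<in> carrier (BS m n)" "bs_t m n \<in> carrier (BS m n)"
  using presented_gen_closed[of "{bs_relator m n}" UNIV] bs_relator_closed[of m n]
  by (auto simp: BS_def bs_a_def bs_t_def)

lemma carrier_BS: "carrier (BS m n) = generate (BS m n) {bs_a m n, bs_t m n}"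
proof -
  have "(UNIV :: bs_letter set) = {Letter_a, Letter_t}"
    using bs_letter.exhaust by auto
  then show ?thesis
    using carrier_presented_group[of "{bs_relator m n}" UNIV] bs_relator_closed[of m n]
    unfolding BS_def bs_a_def bs_t_def by (metis empty_subsetI image_empty image_insert insert_subset)
qed

lemma BS_relation:
  "bs_a m n [^]\<^bsub>BS m n\<^esub> m \<otimes>\<^bsub>BS m n\<^esub> bs_t m n
    = bs_t m n \<otimes>\<^bsub>BS m n\<^esub> bs_a m n [^]\<^bsub>BS m n\<^esub> n"
proof -
  interpret G: group "BS m n" by (rule group_BS)
  have S: "{bs_relator m n} \<subseteq> carrier (free_group UNIV)"
    using bs_relator_closed by simp
  have "inv\<^bsub>BS m n\<^esub> bs_t m n \<otimes>\<^bsub>BS m n\<^esub> bs_a m n [^]\<^bsub>BS m n\<^esub> m \<otimes>\<^bsub>BS m n\<^esub> bs_t m n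
      \<otimes>\<^bsub>BS m n\<^esub> inv\<^bsub>BS m n\<^esub> (bs_a m n [^]\<^bsub>BS m n\<^esub> n) = \<one>\<^bsub>BS m n\<^esub>"
    using hom_bs_relator[OF group_BS, of _ m n] presented_hom[OF S] presented_relator[OF S]
    unfolding BS_def bs_a_def bs_t_def presented_gen_def by (metis insertI1)
  then have "inv\<^bsub>BS m n\<^esub> bs_t m n \<otimes>\<^bsub>BS m n\<^esub> (bs_a m n [^]\<^bsub>BS m n\<^esub> m \<otimes>\<^bsub>BS m n\<^esub> bs_t m n)
      = bs_a m n [^]\<^bsub>BS m n\<^esub> n"
    using G.inv_equality[of "inv\<^bsub>BS m n\<^esub> bs_t m n \<otimes>\<^bsub>BS m n\<^esub> (bs_a m n [^]\<^bsub>BS m n\<^esub> m \<otimes>\<^bsub>BS m n\<^esub> bs_t m n)"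
        "inv\<^bsub>BS m n\<^esub> (bs_a m n [^]\<^bsub>BS m n\<^esub> n)"] by (simp add: G.m_assoc)
  then show ?thesis
    using G.inv_solve_left[of "bs_a m n [^]\<^bsub>BS m n\<^esub> n" "bs_t m n"
        "bs_a m n [^]\<^bsub>BS m n\<^esub> m \<otimes>\<^bsub>BS m n\<^esub> bs_t m n"] by simp
qed

section \<open>Groups of permutations\<close>

definition perm_group :: "'a set \<Rightarrow> ('a \<Rightarrow> 'a) monoid" where
  "perm_group S = \<lparr>carrier = {p. p permutes S}, monoid.mult = (\<circ>), one = id\<rparr>"

lemma perm_group_simps [simp]:
  "carrier (perm_group S) = {p. p permutes S}"
  "p \<otimes>\<^bsub>perm_group S\<^esub> q = p \<circ> q"
  "\<one>\<^bsub>perm_group S\<^esub> = id"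
  by (simp_all add: perm_group_def)

lemma group_perm_group [simp]: "group (perm_group S)"
proof (rule groupI)
  show "\<exists>q\<in>carrier (perm_group S). q \<otimes>\<^bsub>perm_group S\<^esub> p = \<one>\<^bsub>perm_group S\<^esub>"
    if "p \<in> carrier (perm_group S)" for p
    using that permutes_inv[of p S] permutes_inv_o[of p S]
    by (intro bexI[where x = "inv_into UNIV p"]) auto
qed (auto intro: permutes_compose permutes_id)

lemma perm_group_inv: "p permutes S \<Longrightarrow> inv\<^bsub>perm_group S\<^esub> p = inv_into UNIV p"
  using group.inv_equality[OF group_perm_group[of S], of "inv_into UNIV p" p]
  by (simp add: permutes_inv permutes_inv_o)

lemma perm_group_nat_pow: "p [^]\<^bsub>perm_group S\<^esub> (k :: nat) = p ^^ k"
  by (induction k) (simp_all add: funpow_Suc_right del: funpow.simps(2))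

lemma permutes_witness:
  assumes "\<And>x. x \<in> S \<Longrightarrow> f x \<in> S" "\<And>x. x \<in> S \<Longrightarrow> g x \<in> S"
    "\<And>x. x \<in> S \<Longrightarrow> f (g x) = x" "\<And>x. x \<in> S \<Longrightarrow> g (f x) = x" "\<And>x. x \<notin> S \<Longrightarrow> f x = x"
  shows "f permutes S"
proof (rule bij_imp_permutes)
  show "bij_betw f S S"
    using assms by (intro bij_betw_byWitness[of _ g]) auto
qed (use assms in auto)

section \<open>The finite residual\<close>

context group
begin

lemma finite_residual_subset: "finite_residual G \<subseteq> carrier G"
proof -
  have "rcosets (carrier G) = {carrier G}"
    by (auto simp: RCOSETS_def coset_join2 subgroup_self)
  then show ?thesis
    unfolding finite_residual_def using subgroup_self by auto
qed

lemma finite_residual_hom: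
  assumes "g \<in> finite_residual G" "group K" "finite (carrier K)" "h \<in> hom G K"
  shows "h g = \<one>\<^bsub>K\<^esub>"
proof -
  interpret h: group_hom G K h
    using assms is_group by (simp add: group_hom_iff)
  have "(\<lambda>X. the_elem (h ` X)) ` carrier (G Mod kernel G K h) \<subseteq> carrier K"
    using h.FactGroup_the_elem_mem by blast
  then have "finite (rcosets (kernel G K h))"
    using inj_on_finite[OF h.FactGroup_inj_on] assms(3) by (auto simp: FactGroup_def)
  then have "g \<in> kernel G K h"
    using assms(1) h.subgroup_kernel unfolding finite_residual_def by blast
  then show ?thesis
    by (simp add: kernel_def)
qed

text \<open>A subgroup of finite index is the stabiliser of a point of the finite set of its cosets.\<close>

lemma finite_residualI:
  assumes g: "g \<in> carrier G"
    and hom: "\<And>(K :: ('a set \<Rightarrow> 'a set) monoid) h. group K \<Longrightarrow> finite (carrier K) \<Longrightarrow>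
      h \<in> hom G K \<Longrightarrow> h g = \<one>\<^bsub>K\<^esub>"
  shows "g \<in> finite_residual G"
proof -
  have "g \<in> H" if H: "subgroup H G" and fin: "finite (rcosets H)" for H
  proof -
    \<comment> \<open>Right cosets are moved by right multiplication; the inverse makes this a
      homomorphism for composition of functions. Off the cosets the map is the identity, as
      \<open>permutes\<close> demands.\<close>
    define \<rho> where "\<rho> x C = (if C \<in> rcosets H then C #> inv x else C)" for x C
    have sub: "C \<subseteq> carrier G" if "C \<in> rcosets H" for C
      using that subgroup.rcosets_carrier[OF H is_group] by blast
    have act: "C #> x \<in> rcosets H" if C: "C \<in> rcosets H" and x: "x \<in> carrier G" for C x
    proof -
      obtain y where y: "y \<in> carrier G" "C = H #> y"
        using C by (auto simp: RCOSETS_def)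
      then have "C #> x = H #> (y \<otimes> x)"
        using coset_mult_assoc subgroup.subset[OF H] x by blast
      then show ?thesis
        using y x by (auto simp: RCOSETS_def)
    qed
    have "\<rho> x permutes (rcosets H)" if "x \<in> carrier G" for x
      by (rule permutes_witness[where g = "\<lambda>C. C #> x"])
        (use that act sub in \<open>auto simp: \<rho>_def coset_mult_assoc\<close>)
    moreover have "\<rho> (x \<otimes> y) = \<rho> x \<circ> \<rho> y" if "x \<in> carrier G" "y \<in> carrier G" for x y
      using that act sub by (auto simp: \<rho>_def fun_eq_iff coset_mult_assoc inv_mult_group)
    ultimately have "\<rho> \<in> hom G (perm_group (rcosets H))"
      by (auto simp: hom_def)
    then have "\<rho> g = id"
      using hom[OF group_perm_group _ \<open>\<rho> \<in> _\<close>] fin finite_permutations by auto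
    moreover have "H \<in> rcosets H"
      using subgroup.subgroup_in_rcosets[OF H is_group] .
    ultimately have "H #> inv g = H"
      by (simp add: \<rho>_def fun_eq_iff split: if_splits)
    then have "inv g \<in> H"
      by (intro coset_join1[OF _ inv_closed[OF g] H] subgroup.subset[OF H])
    then show ?thesis
      using subgroup.m_inv_closed[OF H] g by fastforce
  qed
  then show ?thesis
    unfolding finite_residual_def by blast
qed

lemma finite_residual_normal: "finite_residual G \<lhd> G"
proof (rule normal_invI)
  show "subgroup (finite_residual G) G"
  proof (rule subgroup.intro)
    show "x \<otimes> y \<in> finite_residual G" if "x \<in> finite_residual G" "y \<in> finite_residual G" for x y
      using that unfolding finite_residual_def by (auto intro: subgroup.m_closed)
    show "inv x \<in> finite_residual G" if "x \<in> finite_residual G" for x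
      using that unfolding finite_residual_def by (auto intro: subgroup.m_inv_closed)
  qed (use finite_residual_subset in \<open>auto simp: finite_residual_def subgroup.one_closed\<close>)
next
  fix x g
  assume x: "x \<in> carrier G" and g: "g \<in> finite_residual G"
  have gc: "g \<in> carrier G"
    using g finite_residual_subset by blast
  show "x \<otimes> g \<otimes> inv x \<in> finite_residual G"
  proof (rule finite_residualI)
    fix K :: "('a set \<Rightarrow> 'a set) monoid" and h
    assume K: "group K" "finite (carrier K)" "h \<in> hom G K"
    interpret h: group_hom G K h
      using K is_group by (simp add: group_hom_iff)
    show "h (x \<otimes> g \<otimes> inv x) = \<one>\<^bsub>K\<^esub>"
      using finite_residual_hom[OF g K] x gc by simp
  qed (use x gc in auto)
qed

lemma finite_residual_integer_hom:
  assumes "g \<in> finite_residual G" "h \<in> hom G integer_group"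
  shows "h g = 0"
proof -
  \<comment> \<open>A modulus larger than the absolute value of \<open>h g\<close>: divisibility by
    it forces \<open>h g\<close> to be 0.\<close>
  define k where "k = nat (\<bar>h g\<bar> + 1)"
  have "(\<lambda>x. h x mod int k) \<in> hom G (integer_mod_group k)"
    using assms(2) pos_mod_bound[of "int k"] pos_mod_sign[of "int k"]
    by (auto simp: hom_def carrier_integer_mod_group k_def mod_add_eq)
  moreover have "finite (carrier (integer_mod_group k))"
    by (auto simp: carrier_integer_mod_group k_def)
  ultimately have "h g mod int k = 0"
    using finite_residual_hom[OF assms(1) group_integer_mod_group] by fastforce
  then have "int k dvd h g"
    by auto
  then show ?thesis
    using dvd_imp_le_int[of "h g" "int k"] by (auto simp: k_def)
qed

section \<open>The lower central series\<close>

lemma commutator_closed [simp]: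
  "x \<in> carrier G \<Longrightarrow> y \<in> carrier G \<Longrightarrow> commutator G x y \<in> carrier G"
  by (simp add: commutator_def)

lemma commutator_conj:
  assumes "x \<in> carrier G" "y \<in> carrier G" "g \<in> carrier G"
  shows "g \<otimes> commutator G x y \<otimes> inv g
    = commutator G (g \<otimes> x \<otimes> inv g) (g \<otimes> y \<otimes> inv g)"
proof -
  have "inv g \<otimes> (g \<otimes> z) = z" if "z \<in> carrier G" for z
    using assms(3) that by (simp add: m_assoc[symmetric])
  then show ?thesis
    using assms by (simp add: commutator_def inv_mult_group m_assoc)
qed

lemma mult_commutator:
  "x \<in> carrier G \<Longrightarrow> y \<in> carrier G \<Longrightarrow> y \<otimes> x \<otimes> commutator G x y = x \<otimes> y"
  using inv_solve_left[of "commutator G x y" "y \<otimes> x" "x \<otimes> y"]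
  by (simp add: commutator_def inv_mult_group m_assoc)

lemma commutator_eq_one_iff:
  "x \<in> carrier G \<Longrightarrow> y \<in> carrier G \<Longrightarrow> commutator G x y = \<one> \<longleftrightarrow> x \<otimes> y = y \<otimes> x"
  using mult_commutator[of x y]
  by (metis commutator_closed m_closed r_one l_cancel_one one_closed)

lemma commutator_subgroup_normal:
  assumes N: "N \<lhd> G"
  shows "commutator_subgroup G N (carrier G) \<lhd> G"
  unfolding commutator_subgroup_def
proof (rule normal_generateI)
  have sub: "N \<subseteq> carrier G"
    using subgroup.subset[OF normal_imp_subgroup[OF N]] .
  then show "{commutator G x y |x y. x \<in> N \<and> y \<in> carrier G} \<subseteq> carrier G"
    by auto
  fix c g
  assume "c \<in> {commutator G x y |x y. x \<in> N \<and> y \<in> carrier G}" and g: "g \<in> carrier G"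
  then obtain x y where c: "c = commutator G x y" "x \<in> N" "y \<in> carrier G"
    by blast
  then have "g \<otimes> c \<otimes> inv g = commutator G (g \<otimes> x \<otimes> inv g) (g \<otimes> y \<otimes> inv g)"
    using commutator_conj g sub by blast
  then show "g \<otimes> c \<otimes> inv g \<in> {commutator G x y |x y. x \<in> N \<and> y \<in> carrier G}"
    using c g normal.inv_op_closed2[OF N] by fastforce
qed

lemma lower_central_Suc:
  "1 \<le> i \<Longrightarrow> lower_central G (Suc i) = commutator_subgroup G (lower_central G i) (carrier G)"
  by (cases i) auto

lemma lower_central_normal: "lower_central G i \<lhd> G"
proof (induction i)
  case (Suc i)
  then show ?case
    using commutator_subgroup_normal[OF Suc] lower_central_Suc[of i] normal_self
    by (cases i) auto
qed (simp add: normal_self)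

lemma lower_central_subgroup: "subgroup (lower_central G i) G"
  using lower_central_normal normal_imp_subgroup by blast

lemma lower_central_subset: "lower_central G i \<subseteq> carrier G"
  using lower_central_subgroup subgroup.subset by blast

lemma commutator_in_lower_central:
  "1 \<le> i \<Longrightarrow> x \<in> lower_central G i \<Longrightarrow> y \<in> carrier G \<Longrightarrow>
    commutator G x y \<in> lower_central G (Suc i)"
  by (auto simp: lower_central_Suc commutator_subgroup_def intro!: generate.incl)

text \<open>Used to bound the series from above by a filtration pulled back from unipotent maps,
  whose commutators are computed by degree.\<close>

lemma lower_central_subset_filtration:
  assumes "\<And>i. 1 \<le> i \<Longrightarrow> subgroup (D i) G" "carrier G \<subseteq> D 1"
    and "\<And>i x y. 1 \<le> i \<Longrightarrow> x \<in> D i \<Longrightarrow> y \<in> carrier G \<Longrightarrow> commutator G x y \<in> D (Suc i)"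
    and "1 \<le> i"
  shows "lower_central G i \<subseteq> D i"
  using assms(4)
proof (induction i rule: dec_induct)
  case (step i)
  show ?case
    unfolding lower_central_Suc[OF step(1)] commutator_subgroup_def
  proof (rule generate_subgroup_incl)
    show "{commutator G x y |x y. x \<in> lower_central G i \<and> y \<in> carrier G} \<subseteq> D (Suc i)"
      using step assms(3) by blast
  qed (use assms(1) in auto)
qed (use assms(2) in simp)

lemma lower_central_decreasing:
  assumes "1 \<le> i" "i \<le> j"
  shows "lower_central G j \<subseteq> lower_central G i"
  using assms(2)
proof (induction j rule: dec_induct)
  case (step j)
  have "commutator G x y \<in> lower_central G j" if "x \<in> lower_central G j" "y \<in> carrier G" for x y
  proof -
    have x: "x \<in> carrier G"
      using that lower_central_subset by blast
    have "inv y \<otimes> x \<otimes> y \<in> lower_central G j"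
      using normal.inv_op_closed1[OF lower_central_normal] that by blast
    then have "inv x \<otimes> (inv y \<otimes> x \<otimes> y) \<in> lower_central G j"
      using that lower_central_subgroup by (blast intro: subgroup.m_closed subgroup.m_inv_closed)
    then show ?thesis
      using x that by (simp add: commutator_def m_assoc)
  qed
  then have "lower_central G (Suc j) \<subseteq> lower_central G j"
    using step assms(1) lower_central_subgroup unfolding lower_central_Suc[OF le_trans[OF assms(1) step(1)]]
      commutator_subgroup_def by (intro generate_subgroup_incl) auto
  then show ?case
    using step by blast
qed simp

lemma lower_central_omega_subset: "1 \<le> i \<Longrightarrow> lower_central_omega G \<subseteq> lower_central G i"
  unfolding lower_central_omega_def by auto

lemma subgroup_lower_central_omega: "subgroup (lower_central_omega G) G"
  unfolding lower_central_omega_def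
  by (rule subgroups_Inter) (auto intro: lower_central_subgroup)

end

context group_hom
begin

lemma hom_commutator:
  "x \<in> carrier G \<Longrightarrow> y \<in> carrier G \<Longrightarrow> h (commutator G x y) = commutator H (h x) (h y)"
  by (simp add: commutator_def)

lemma lower_central_image_surj:
  assumes surj: "h ` carrier G = carrier H" and "1 \<le> i"
  shows "h ` lower_central G i = lower_central H i"
  using assms(2)
proof (induction i rule: dec_induct)
  case (step i)
  let ?C = "{commutator G x y |x y. x \<in> lower_central G i \<and> y \<in> carrier G}"
  have sub: "?C \<subseteq> carrier G"
    using G.lower_central_subset[of i] by auto
  have "h ` ?C = {commutator H x y |x y. x \<in> lower_central H i \<and> y \<in> carrier H}"
    (is "_ = ?D")
  proof
    show "h ` ?C \<subseteq> ?D"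
      using G.lower_central_subset[of i] step.IH hom_commutator surj by fastforce
    show "?D \<subseteq> h ` ?C"
    proof
      fix c assume "c \<in> ?D"
      then obtain x y where c: "c = commutator H x y" "x \<in> lower_central H i" "y \<in> carrier H"
        by blast
      then obtain x' y' where "x = h x'" "x' \<in> lower_central G i" "y = h y'" "y' \<in> carrier G"
        using step.IH surj by (metis imageE)
      then show "c \<in> h ` ?C"
        using c hom_commutator G.lower_central_subset[of i] by (intro image_eqI[of _ _ "commutator G x' y'"]) auto
    qed
  qed
  then show ?case
    using generate_img[OF sub]
    unfolding G.lower_central_Suc[OF step(1)] H.lower_central_Suc[OF step(1)] commutator_subgroup_def
    by simp
qed (use surj in simp)

lemma lower_central_2_kernel:
  assumes "comm_group H"
  shows "lower_central G 2 \<subseteq> kernel G H h"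
proof -
  interpret C: comm_group H by fact
  have "commutator G x y \<in> kernel G H h" if "x \<in> carrier G" "y \<in> carrier G" for x y
    using that H.commutator_eq_one_iff[of "h x" "h y"]
    by (simp add: kernel_def hom_commutator C.m_comm)
  then show ?thesis
    using subgroup_kernel unfolding numeral_2_eq_2
    by (simp add: commutator_subgroup_def) (intro G.generate_subgroup_incl, auto)
qed

lemma finite_image_of_quotient:
  assumes surj: "h ` carrier G = carrier H" and N: "N \<lhd> G" "N \<subseteq> kernel G H h"
    and fin: "finite (carrier (G Mod N))"
  shows "finite (carrier H)"
proof -
  obtain g where g: "\<And>x. x \<in> carrier G \<Longrightarrow> g (N #>\<^bsub>G\<^esub> x) = h x"
    using FactGroup_universal_kernel[OF N] by metis
  have "carrier H = g ` carrier (G Mod N)"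
    using g surj by (auto simp: carrier_FactGroup image_image)
  then show ?thesis
    using fin by simp
qed

end

section \<open>Finiteness of nilpotent torsion groups\<close>

context group
begin

lemma nat_pow_comm_elem:
  assumes "x \<in> carrier G" "y \<in> carrier G" "y \<otimes> x = x \<otimes> y"
  shows "y \<otimes> x [^] (k :: nat) = x [^] k \<otimes> y"
proof (induction k)
  case (Suc k)
  have "y \<otimes> x [^] Suc k = (y \<otimes> x [^] k) \<otimes> x"
    using assms by (simp add: m_assoc)
  also have "\<dots> = x [^] k \<otimes> (y \<otimes> x)"
    using assms Suc by (simp add: m_assoc)
  also have "\<dots> = x [^] Suc k \<otimes> y"
    using assms by (simp add: m_assoc)
  finally show ?case .
qed (use assms in simp)

text \<open>Inserting a generator d with d^e = 1 yields only products d^c x with c < e and x from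
  the group generated so far, so finiteness survives each insertion.\<close>

lemma finite_generate_commuting:
  assumes "finite D" "D \<subseteq> carrier G"
    and "\<And>x y. x \<in> D \<Longrightarrow> y \<in> D \<Longrightarrow> x \<otimes> y = y \<otimes> x"
    and "\<And>x. x \<in> D \<Longrightarrow> \<exists>e>0. x [^] (e :: nat) = \<one>"
  shows "finite (generate G D)"
  using assms
proof (induction D)
  case empty
  then show ?case
    by (simp add: generate_empty)
next
  case (insert d D)
  obtain e where e: "e > 0" "d [^] (e :: nat) = \<one>"
    using insert.prems(3) by blast
  have d: "d \<in> carrier G" and D: "D \<subseteq> carrier G"
    using insert.prems(1) by auto
  define T where "T = {d [^] c \<otimes> x | (c :: nat) x. x \<in> generate G D}"
  have "g \<in> T" if "g \<in> generate G (insert d D)" for g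
    using that
  proof (induction rule: generate_left_induct)
    case one
    have "\<one> = d [^] (0 :: nat) \<otimes> \<one>"
      by simp
    then show ?case
      unfolding T_def using generate.one by blast
  next
    have step: "s \<otimes> g \<in> T" if gT: "g \<in> T" and sD: "s \<in> generate G D \<or> s = d" and comm: "s \<otimes> d = d \<otimes> s" for s g
    proof -
      obtain c x where g: "g = d [^] (c :: nat) \<otimes> x" "x \<in> generate G D"
        using gT unfolding T_def by blast
      have x: "x \<in> carrier G"
        using g generate_in_carrier[OF D] by blast
      show ?thesis
        using sD
      proof
        assume s: "s \<in> generate G D"
        then have "s \<in> carrier G"
          using generate_in_carrier[OF D] by blast
        then have "s \<otimes> g = d [^] c \<otimes> (s \<otimes> x)"
          using g x d nat_pow_comm_elem[of d s c] comm by (simp add: m_assoc[symmetric])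
        then show ?thesis
          unfolding T_def using generate.eng[OF s g(2)] by blast
      next
        assume "s = d"
        then have "s \<otimes> g = d [^] Suc c \<otimes> x"
          using g x d nat_pow_Suc2[of d c] by (simp add: m_assoc)
        then show ?thesis
          unfolding T_def using g(2) by blast
      qed
    qed
    show "s \<otimes> g \<in> T" if "s \<in> insert d D" "g \<in> carrier G" "g \<in> T" for s g
      using that insert.prems(2) by (intro step) (auto intro: generate.incl)
    have "(d [^] k) \<otimes> g \<in> T" if "g \<in> carrier G" "g \<in> T" for g and k :: nat
      using that(2)
    proof (induction k)
      case (Suc k)
      then have "d \<otimes> (d [^] k \<otimes> g) \<in> T"
        using step[of "d [^] k \<otimes> g" d] by simp
      then show ?case
        unfolding nat_pow_Suc2[OF d] using d that(1) by (simp add: m_assoc)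
    qed (use that in simp)
    \<comment> \<open>Exponents in \<open>T\<close> are natural numbers, so the inverse of d has to
      be expressed as a non-negative power.\<close>
    moreover have "inv d = d [^] (e - 1)"
      using e d by (intro inv_equality) (auto simp flip: nat_pow_Suc)
    ultimately show "inv s \<otimes> g \<in> T" if "s \<in> insert d D" "g \<in> carrier G" "g \<in> T" for s g
    proof (cases "s = d")
      case False
      then have s: "s \<in> D" "s \<in> carrier G"
        using that D by auto
      then have "s \<otimes> d = d \<otimes> s"
        using insert.prems(2) by blast
      then have "inv s \<otimes> d = d \<otimes> inv s"
        using s d by (metis inv_closed inv_solve_left inv_solve_right m_assoc m_closed)
      then show ?thesis
        using s that by (intro step) (auto intro: generate.inv)
    qed (use that in auto)
  qed (use insert.prems(1) in auto)
  moreover have "T \<subseteq> (\<lambda>(c, x). d [^] c \<otimes> x) ` ({..<e} \<times> generate G D)"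
  proof
    fix g assume "g \<in> T"
    then obtain c x where g: "g = d [^] (c :: nat) \<otimes> x" "x \<in> generate G D"
      unfolding T_def by blast
    have "d [^] c = (d [^] e) [^] (c div e) \<otimes> d [^] (c mod e)"
      using d by (simp only: nat_pow_pow nat_pow_mult mult_div_mod_eq)
    then have "g = d [^] (c mod e) \<otimes> x"
      using g d e by simp
    then show "g \<in> (\<lambda>(c, x). d [^] c \<otimes> x) ` ({..<e} \<times> generate G D)"
      using g e by (intro image_eqI[of _ _ "(c mod e, x)"]) auto
  qed
  moreover have "finite (generate G D)"
    using insert by auto
  ultimately show ?case
    by (meson finite_SigmaI finite_imageI finite_lessThan finite_subset subsetI)
qed

lemma finite_of_finite_quotient:
  assumes "subgroup C G" "finite C" "finite (rcosets C)"
  shows "finite (carrier G)"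
proof -
  have "C \<in> rcosets C"
    using subgroup.subgroup_in_rcosets[OF assms(1) is_group] .
  \<comment> \<open>\<open>lagrange\<close> also holds for infinite groups, infinite sets having
    cardinality 0. A positive product thus makes the order positive and the carrier finite.\<close>
  then have "0 < card (rcosets C) * card C"
    using assms subgroup.one_closed[OF assms(1)] by (auto simp: card_gt_0_iff)
  then show ?thesis
    using lagrange[OF assms(1)] order_gt_0_iff_finite by simp
qed

lemma ex_pow_in_finite_index:
  assumes N: "N \<lhd> G" and fin: "finite (carrier (G Mod N))" and x: "x \<in> carrier G"
  shows "\<exists>e>0. x [^] (e :: nat) \<in> N"
proof -
  interpret N: normal N G by fact
  interpret Q: group "G Mod N" by (rule N.factorgroup_is_group)
  define e where "e = order (G Mod N)"
  have "e > 0"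
    using fin Q.order_gt_0_iff_finite by (simp add: e_def)
  have "N #> x \<in> carrier (G Mod N)"
    using x by (auto simp: carrier_FactGroup)
  then have "N #> x [^] e = N"
    using Q.pow_order_eq_1[of "N #> x"] N.FactGroup_pow[OF x] by (simp add: e_def)
  then have "x [^] e \<in> N"
    using rcos_self[OF nat_pow_closed[OF x] N.is_subgroup] by metis
  then show ?thesis
    using \<open>e > 0\<close> by blast
qed

text \<open>A commutator depends only on the classes of its arguments modulo the centre, so there are
  finitely many of them, and \<open>[x, g]\<^sup>e = [x\<^sup>e, g]\<close> makes them torsion.\<close>

lemma finite_of_central_commutators:
  assumes C: "subgroup C G" and central: "\<And>c g. c \<in> C \<Longrightarrow> g \<in> carrier G \<Longrightarrow> c \<otimes> g = g \<otimes> c"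
    and fin: "finite (rcosets C)" and gen: "C = generate G D"
    and D: "D \<subseteq> {commutator G x g | x g. x \<in> carrier G \<and> g \<in> carrier G}"
  shows "finite (carrier G)"
proof -
  have sub: "C \<subseteq> carrier G"
    using subgroup.subset[OF C] .
  have DC: "D \<subseteq> C"
    using gen by (auto intro: generate.incl)
  have "C \<lhd> G"
  proof (rule normal_invI[OF C])
    fix x c assume "x \<in> carrier G" "c \<in> C"
    then show "x \<otimes> c \<otimes> inv x \<in> C"
      using central[of c x] sub by (auto simp: m_assoc simp flip: central)
  qed
  have dep: "commutator G (c \<otimes> x) (c' \<otimes> g) = commutator G x g"
    if "c \<in> C" "c' \<in> C" "x \<in> carrier G" "g \<in> carrier G" for c c' x g
  proof -
    have cc: "c \<in> carrier G" "c' \<in> carrier G"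
      using that sub by auto
    have "(c \<otimes> x) \<otimes> (c' \<otimes> g) = (c \<otimes> c') \<otimes> (x \<otimes> g)"
      using that cc central[of c' x] by (metis m_assoc m_closed)
    moreover have "(c' \<otimes> g) \<otimes> (c \<otimes> x) = (c \<otimes> c') \<otimes> (g \<otimes> x)"
      using that cc central[of c g] central[of c c'] by (metis m_assoc m_closed)
    ultimately have "(c \<otimes> c') \<otimes> (g \<otimes> x) \<otimes> commutator G (c \<otimes> x) (c' \<otimes> g) = (c \<otimes> c') \<otimes> (x \<otimes> g)"
      using mult_commutator[of "c \<otimes> x" "c' \<otimes> g"] that cc by simp
    then have "g \<otimes> x \<otimes> commutator G (c \<otimes> x) (c' \<otimes> g) = x \<otimes> g"
      using that cc by (simp add: m_assoc)
    then show ?thesis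
      using mult_commutator[OF that(3,4)] that cc
        Units_l_cancel[of "g \<otimes> x" "commutator G (c \<otimes> x) (c' \<otimes> g)" "commutator G x g"]
      by (simp add: Units_eq)
  qed
  have rep: "\<exists>r. \<forall>X\<in>rcosets C. r X \<in> carrier G \<and> X = C #> r X"
    by (rule bchoice) (auto simp: RCOSETS_def)
  then obtain r where r: "\<And>X. X \<in> rcosets C \<Longrightarrow> r X \<in> carrier G"
      "\<And>X. X \<in> rcosets C \<Longrightarrow> X = C #> r X"
    by blast
  have "D \<subseteq> (\<lambda>(X, Y). commutator G (r X) (r Y)) ` ((rcosets C) \<times> (rcosets C))"
  proof
    fix z assume "z \<in> D"
    then obtain x g where z: "z = commutator G x g" "x \<in> carrier G" "g \<in> carrier G"
      using D by blast
    have X: "C #> x \<in> rcosets C" "C #> g \<in> rcosets C"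
      using z sub rcosetsI by auto
    have "x \<in> C #> r (C #> x)" "g \<in> C #> r (C #> g)"
      using r(2)[OF X(1)] r(2)[OF X(2)] rcos_self[OF z(2) C] rcos_self[OF z(3) C] by auto
    then obtain c c' where "c \<in> C" "x = c \<otimes> r (C #> x)" "c' \<in> C" "g = c' \<otimes> r (C #> g)"
      unfolding r_coset_def by blast
    then have "z = commutator G (r (C #> x)) (r (C #> g))"
      using dep r(1)[OF X(1)] r(1)[OF X(2)] z(1) by metis
    then show "z \<in> (\<lambda>(X, Y). commutator G (r X) (r Y)) ` ((rcosets C) \<times> (rcosets C))"
      using X by (intro image_eqI[of _ _ "(C #> x, C #> g)"]) auto
  qed
  then have finD: "finite D"
    using fin by (meson finite_SigmaI finite_imageI finite_subset)
  have "\<exists>e>0. z [^] (e :: nat) = \<one>" if zD: "z \<in> D" for z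
  proof -
    obtain x g where z: "z = commutator G x g" "x \<in> carrier G" "g \<in> carrier G"
      using zD D by blast
    obtain e :: nat where e: "e > 0" "x [^] e \<in> C"
      using ex_pow_in_finite_index[OF \<open>C \<lhd> G\<close> _ z(2)] fin by (auto simp: FactGroup_def)
    have zc: "z \<in> C" "z \<in> carrier G"
      using zD DC sub by auto
    \<comment> \<open>The e-th power of this conjugate is x^e z^e, since z is central, and also the
      conjugate of the central element x^e, that is x^e itself. Hence z^e = 1.\<close>
    have conj: "inv g \<otimes> x \<otimes> g = x \<otimes> z"
      using z by (simp add: commutator_def m_assoc)  (simp flip: m_assoc)
    have pow_conj: "(inv g \<otimes> x \<otimes> g) [^] k = inv g \<otimes> x [^] k \<otimes> g" for k :: nat
    proof (induction k)
      case (Suc k)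
      have "g \<otimes> (inv g \<otimes> y) = y" if "y \<in> carrier G" for y
        using z that by (simp add: m_assoc[symmetric])
      then show ?case
        using Suc z by (simp add: m_assoc)
    qed (use z in simp)
    have "x [^] e \<otimes> z [^] e = (x \<otimes> z) [^] e"
      using pow_mult_distrib[of x z e] central[OF zc(1) z(2)] z(2) zc by simp
    also have "\<dots> = inv g \<otimes> x [^] e \<otimes> g"
      using pow_conj[of e] conj by simp
    also have "\<dots> = x [^] e"
      using central[OF e(2) z(3)] z by (simp add: m_assoc) (simp flip: m_assoc)
    finally have "z [^] e = \<one>"
      using z zc by simp
    then show ?thesis
      using e(1) by blast
  qed
  moreover have "x \<otimes> y = y \<otimes> x" if "x \<in> D" "y \<in> D" for x y
    using central[of x y] that DC sub by blast
  ultimately have "finite C"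
    unfolding gen using finD DC sub by (intro finite_generate_commuting) auto
  then show ?thesis
    using finite_of_finite_quotient[OF C] fin by blast
qed

text \<open>Induction on i through the central extension of G / \<gamma>_i by \<gamma>_i /
  \<gamma>_(i+1). For i >= 2 the kernel is generated by commutators and
  \<open>finite_of_central_commutators\<close> applies. For i = 1 the kernel is all of G /
  \<gamma>_2, which is abelian and generated by two torsion elements.\<close>

lemma finite_lower_central_quotient:
  assumes gen: "carrier G = generate G {a, t}" and at: "a \<in> carrier G" "t \<in> carrier G"
    and "a [^] (r :: nat) = \<one>" "r > 0" "t [^] (s :: nat) = \<one>" "s > 0" and "1 \<le> i"
  shows "finite (carrier (G Mod lower_central G i))"
proof -
  have proj: "group_hom G (G Mod lower_central G i) (\<lambda>x. lower_central G i #> x)" for i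
    using normal.r_coset_hom_Mod[OF lower_central_normal] is_group
      normal.factorgroup_is_group[OF lower_central_normal]
    by (simp add: group_hom_iff)
  have surj: "(\<lambda>x. lower_central G i #> x) ` carrier G = carrier (G Mod lower_central G i)" for i
    by (simp add: carrier_FactGroup)
  have trivial: "lower_central (G Mod lower_central G i) i = {\<one>\<^bsub>G Mod lower_central G i\<^esub>}" if "1 \<le> i" for i
  proof -
    have "(\<lambda>x. lower_central G i #> x) ` lower_central G i = {lower_central G i}"
    proof -
      have "lower_central G i #> x = lower_central G i" if "x \<in> lower_central G i" for x
        using coset_join2[OF subsetD[OF lower_central_subset] lower_central_subgroup] that by blast
      moreover have "lower_central G i \<noteq> {}"
        using subgroup.one_closed[OF lower_central_subgroup] by blast
      ultimately show ?thesis
        by auto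
    qed
    then show ?thesis
      using group_hom.lower_central_image_surj[OF proj surj that] by simp
  qed
  show ?thesis
    using \<open>1 \<le> i\<close>
  proof (induction i rule: dec_induct)
    case base
    have "carrier (G Mod lower_central G 1) = {carrier G}"
      by (auto simp: carrier_FactGroup coset_join2 subgroup_self)
    then show ?case
      by simp
  next
    case (step i)
    let ?P = "G Mod lower_central G (Suc i)"
    let ?q = "\<lambda>x. lower_central G (Suc i) #> x"
    interpret q: group_hom G ?P ?q by (rule proj)
    let ?C = "lower_central ?P i"
    have central: "c \<otimes>\<^bsub>?P\<^esub> g = g \<otimes>\<^bsub>?P\<^esub> c" if "c \<in> ?C" "g \<in> carrier ?P" for c g
    proof -
      have "commutator ?P c g \<in> lower_central ?P (Suc i)"
        using q.H.commutator_in_lower_central[OF step(1) that] .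
      then have "commutator ?P c g = \<one>\<^bsub>?P\<^esub>"
        unfolding trivial[OF le_SucI[OF step(1)]] by (rule singletonD)
      then show ?thesis
        using q.H.commutator_eq_one_iff[OF subsetD[OF q.H.lower_central_subset that(1)] that(2)] by blast
    qed
    show ?case
    proof (cases "i = 1")
      case True
      have "?q ` {a, t} \<subseteq> carrier ?P"
        using at by auto
      moreover have torsion: "(?q x) [^]\<^bsub>?P\<^esub> (k :: nat) = \<one>\<^bsub>?P\<^esub>" if "x \<in> carrier G" "x [^] k = \<one>" for x k
        using that q.hom_nat_pow[of x k] q.hom_one by metis
      ultimately have "finite (generate ?P (?q ` {a, t}))"
      proof (intro q.H.finite_generate_commuting)
        show "x \<otimes>\<^bsub>?P\<^esub> y = y \<otimes>\<^bsub>?P\<^esub> x" if "x \<in> ?q ` {a, t}" "y \<in> ?q ` {a, t}" for x y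
        proof (rule central)
          have "carrier ?P = ?C"
            using True by simp
          then show "x \<in> ?C" "y \<in> carrier ?P"
            using that \<open>?q ` {a, t} \<subseteq> carrier ?P\<close> by blast+
        qed
        show "\<exists>e>0. x [^]\<^bsub>?P\<^esub> (e :: nat) = \<one>\<^bsub>?P\<^esub>" if "x \<in> ?q ` {a, t}" for x
          using that assms torsion by blast
      qed auto
      moreover have "generate ?P (?q ` {a, t}) = carrier ?P"
        using q.generate_img[of "{a, t}"] at gen surj[of "Suc i"] by simp
      ultimately show ?thesis
        by simp
    next
      case False
      then obtain j where j: "i = Suc j" "1 \<le> j"
        using step(1) by (cases i) auto
      interpret C: normal ?C ?P
        by (rule q.H.lower_central_normal)
      have hom: "group_hom G (?P Mod ?C) (\<lambda>x. ?C #>\<^bsub>?P\<^esub> ?q x)"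
        using Group.hom_compose[OF q.homh C.r_coset_hom_Mod] is_group C.factorgroup_is_group
        by (simp add: group_hom_iff comp_def)
      have "finite (carrier (?P Mod ?C))"
      proof (rule group_hom.finite_image_of_quotient[OF hom _ lower_central_normal _ step.IH])
        show "(\<lambda>x. ?C #>\<^bsub>?P\<^esub> ?q x) ` carrier G = carrier (?P Mod ?C)"
          unfolding carrier_FactGroup[of ?P] surj[of "Suc i", symmetric] image_image by (rule refl)
        show "lower_central G i \<subseteq> kernel G (?P Mod ?C) (\<lambda>x. ?C #>\<^bsub>?P\<^esub> ?q x)"
        proof
          fix x assume x: "x \<in> lower_central G i"
          then have "?q x \<in> ?C"
            using q.lower_central_image_surj[OF surj step(1)] by blast
          then have "?C #>\<^bsub>?P\<^esub> ?q x = ?C"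
            using C.rcos_const q.H.is_group by blast
          then show "x \<in> kernel G (?P Mod ?C) (\<lambda>x. ?C #>\<^bsub>?P\<^esub> ?q x)"
            using x lower_central_subset by (auto simp: kernel_def)
        qed
      qed
      then have fin: "finite (rcosets\<^bsub>?P\<^esub> ?C)"
        by (simp add: FactGroup_def)
      show ?thesis
      proof (rule q.H.finite_of_central_commutators[OF q.H.lower_central_subgroup central fin])
        show "?C = generate ?P {commutator ?P x y |x y. x \<in> lower_central ?P j \<and> y \<in> carrier ?P}"
          using q.H.lower_central_Suc[OF j(2)] j(1) by (simp add: commutator_subgroup_def)
        show "{commutator ?P x y |x y. x \<in> lower_central ?P j \<and> y \<in> carrier ?P}
          \<subseteq> {commutator ?P x g | x g. x \<in> carrier ?P \<and> g \<in> carrier ?P}"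
          using q.H.lower_central_subset by blast
      qed
    qed
  qed
qed

end

section \<open>The finite residual of a Baumslag--Solitar group\<close>

lemma (in group) conj_int_pow_closed:
  assumes t: "t \<in> carrier G" and P: "P \<subseteq> carrier G"
    and "\<And>x. x \<in> P \<Longrightarrow> t \<otimes> x \<otimes> inv t \<in> P" "\<And>x. x \<in> P \<Longrightarrow> inv t \<otimes> x \<otimes> t \<in> P"
    and x: "x \<in> P"
  shows "t [^] (k :: int) \<otimes> x \<otimes> t [^] (- k) \<in> P"
proof (induction k rule: int_induct[of _ 0])
  case base
  then show ?case
    using x P by auto
next
  case (step1 i)
  have "t [^] (i + 1) = t \<otimes> t [^] i" "t [^] (- (i + 1)) = t [^] (- i) \<otimes> inv t"
    using t int_pow_mult[OF t, of 1 i] int_pow_mult[OF t, of "- i" "- 1"]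
    by (simp_all add: add.commute int_pow_neg)
  then have "t [^] (i + 1) \<otimes> x \<otimes> t [^] (- (i + 1)) = t \<otimes> (t [^] i \<otimes> x \<otimes> t [^] (- i)) \<otimes> inv t"
    using t x P by (auto simp: m_assoc)
  then show ?case
    using step1 assms(3) by simp
next
  case (step2 i)
  have "t [^] (i - 1) = inv t \<otimes> t [^] i" "t [^] (- (i - 1)) = t [^] (- i) \<otimes> t"
    using t int_pow_mult[OF t, of "-1" i] int_pow_mult[OF t, of "- i" "1"]
    by (simp_all add: add.commute int_pow_neg)
  then have "t [^] (i - 1) \<otimes> x \<otimes> t [^] (- (i - 1)) = inv t \<otimes> (t [^] i \<otimes> x \<otimes> t [^] (- i)) \<otimes> t"
    using t x P by (auto simp: m_assoc)
  then show ?case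
    using step2 assms(4) by simp
qed

lemma (in group) int_pow_conj:
  assumes t: "t \<in> carrier G" and x: "x \<in> carrier G"
  shows "(t \<otimes> x \<otimes> inv t) [^] (k :: int) = t \<otimes> x [^] k \<otimes> inv t"
proof -
  have "inv t \<otimes> (t \<otimes> z) = z" if "z \<in> carrier G" for z
    using t that by (simp flip: m_assoc)
  then have "(\<lambda>x. t \<otimes> x \<otimes> inv t) \<in> hom G G"
    using t by (auto simp: hom_def m_assoc)
  then interpret c: group_hom G G "\<lambda>x. t \<otimes> x \<otimes> inv t"
    by (simp add: group_hom_iff)
  show ?thesis
    using c.hom_int_pow[OF x] by simp
qed

text \<open>In a finite group \<open>a\<^sup>m\<close> and \<open>a\<^sup>n\<close> are conjugate, hence of equal order, so
  both generate the same subgroup as \<open>a\<^sup>d\<close>.\<close>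

lemma (in group) finite_conj_pow_gcd:
  fixes m n :: int
  assumes fin: "finite (carrier G)" and a: "a \<in> carrier G" and t: "t \<in> carrier G"
    and rel: "a [^] m \<otimes> t = t \<otimes> a [^] n"
  shows "\<exists>j :: int. t [^] (k :: int) \<otimes> a [^] gcd m n \<otimes> t [^] (- k) = a [^] (gcd m n * j)"
proof -
  define d where "d = gcd m n"
  define N where "N = int (ord a)"
  define P where "P = {a [^] (d * j) | j :: int. True}"
  have N: "N > 0"
    using ord_ge_1[OF fin a] by (simp add: N_def)
  have pow_mod: "a [^] x = a [^] y" if "N dvd y - x" for x y
    using that int_pow_eq[OF a] by (simp add: N_def)
  have "a [^] m = t \<otimes> a [^] n \<otimes> inv t"
    using rel a t by (simp flip: rel add: m_assoc)
  then have conj_n: "t \<otimes> a [^] (n * j) \<otimes> inv t = a [^] (m * j)" for j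
    using int_pow_conj[OF t int_pow_closed[OF a, of n], of j] int_pow_pow[OF a] by metis
  have conj_m: "inv t \<otimes> a [^] (m * j) \<otimes> t = a [^] (n * j)" for j
  proof -
    have "inv t \<otimes> (t \<otimes> z) = z" if "z \<in> carrier G" for z
      using t that by (simp flip: m_assoc)
    then show ?thesis
      unfolding conj_n[symmetric] using a t by (simp add: m_assoc)
  qed
  have triv: "N dvd m * j \<longleftrightarrow> N dvd n * j" for j
  proof -
    have "a [^] (m * j) = \<one> \<longleftrightarrow> a [^] (n * j) = \<one>"
      using conj_n[of j] conj_m[of j] t by auto
    then show ?thesis
      using int_pow_eq_id[OF a] by (simp add: N_def)
  qed
  \<comment> \<open>With e = gcd N x, the number N / e annihilates x modulo N, hence also y, so e
    divides y and therefore d. Bezout makes e a multiple of x modulo N, so every power of a^d is a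
    power of a^x.\<close>
  have exps: "\<exists>u. \<forall>j. a [^] (d * j) = a [^] (x * (u * j))"
    if xy: "\<And>j. N dvd x * j \<Longrightarrow> N dvd y * j" and d: "d = gcd x y" for x y
  proof -
    define e where "e = gcd N x"
    have "e dvd N" "e dvd x"
      by (simp_all add: e_def)
    then obtain N' x' where N': "N = e * N'" and x': "x = e * x'"
      by (elim dvdE)
    have "N dvd x * N'"
      by (simp add: N' x')
    then have "N dvd y * N'"
      by (rule xy)
    then have "e dvd y"
      using N N' by (cases "N' = 0") auto
    then have "e dvd d"
      using x' d by simp
    then obtain d' where d': "d = e * d'" ..
    obtain u v where "u * N + v * x = e"
      using bezout_int[of N x] by (auto simp: e_def)
    then have "x * (v * d' * j) - d * j = N * (- u * d' * j)" for j
      unfolding d' by (simp add: algebra_simps flip: \<open>u * N + v * x = e\<close>)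
    then have "\<forall>j. a [^] (d * j) = a [^] (x * (v * d' * j))"
      using pow_mod by (metis dvd_triv_left)
    then show ?thesis
      by blast
  qed
  \<comment> \<open>An exponent d j is rewritten as a multiple of n before conjugation by t, which
    turns n into m, and as a multiple of m before the inverse conjugation. Either way the result is
    again a multiple of d.\<close>
  obtain u where u: "a [^] (d * j) = a [^] (m * (u * j))" for j
    using exps[of m n] triv d_def by auto
  obtain v where v: "a [^] (d * j) = a [^] (n * (v * j))" for j
    using exps[of n m] triv d_def by (auto simp: gcd.commute)
  have "d dvd m" "d dvd n"
    by (simp_all add: d_def)
  then obtain m' n' where m': "m = d * m'" and n': "n = d * n'"
    by (elim dvdE)
  have "t [^] k \<otimes> a [^] d \<otimes> t [^] (- k) \<in> P"
  proof (rule conj_int_pow_closed[OF t])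
    show "t \<otimes> x \<otimes> inv t \<in> P" if xP: "x \<in> P" for x
    proof -
      obtain j where "x = a [^] (d * j)"
        using xP by (auto simp: P_def)
      then have "t \<otimes> x \<otimes> inv t = a [^] (d * (m' * (v * j)))"
        using v[of j] conj_n[of "v * j"] by (simp add: m' mult.assoc)
      then show ?thesis
        unfolding P_def by blast
    qed
    show "inv t \<otimes> x \<otimes> t \<in> P" if xP: "x \<in> P" for x
    proof -
      obtain j where "x = a [^] (d * j)"
        using xP by (auto simp: P_def)
      then have "inv t \<otimes> x \<otimes> t = a [^] (d * (n' * (u * j)))"
        using u[of j] conj_m[of "u * j"] by (simp add: n' mult.assoc)
      then show ?thesis
        unfolding P_def by blast
    qed
    have "a [^] d = a [^] (d * 1)"
      by simp
    then show "a [^] d \<in> P"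
      unfolding P_def by blast
  qed (use a in \<open>auto simp: P_def\<close>)
  then show ?thesis
    by (auto simp: P_def d_def)
qed

section \<open>The group BS(m, n), the conjugates of a^d and their normal closure\<close>

locale baumslag_solitar = group G
  for G :: "bs_letter word set set monoid" (structure) +
  fixes m n d :: int and a t :: "bs_letter word set set"
  assumes G_def: "G = BS m n" and a_def: "a = bs_a m n" and t_def: "t = bs_t m n"
    and m_pos: "0 < m" and d_def: "d = gcd m n"
begin

lemma a_closed [simp]: "a \<in> carrier G" and t_closed [simp]: "t \<in> carrier G"
  by (simp_all add: G_def a_def t_def)

lemma relation: "a [^] m \<otimes> t = t \<otimes> a [^] n"
  using BS_relation by (simp add: G_def a_def t_def)

lemma carrier_eq: "carrier G = generate G {a, t}"
  using carrier_BS by (simp add: G_def a_def t_def)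

lemma universal:
  assumes "group K" "\<alpha> \<in> carrier K" "\<tau> \<in> carrier K"
    and "\<alpha> [^]\<^bsub>K\<^esub> m \<otimes>\<^bsub>K\<^esub> \<tau> = \<tau> \<otimes>\<^bsub>K\<^esub> \<alpha> [^]\<^bsub>K\<^esub> n"
  obtains h where "h \<in> hom G K" "h a = \<alpha>" "h t = \<tau>"
  using group.BS_universal[OF assms] unfolding G_def a_def t_def by blast

lemma d_pos: "0 < d" and d_dvd_m: "d dvd m" and d_dvd_n: "d dvd n"
  using m_pos by (simp_all add: d_def)

lemma induct [consumes 1, case_names one a inv_a t inv_t]:
  assumes "g \<in> carrier G" "P \<one>"
    "\<And>x. x \<in> carrier G \<Longrightarrow> P x \<Longrightarrow> P (a \<otimes> x)" "\<And>x. x \<in> carrier G \<Longrightarrow> P x \<Longrightarrow> P (inv a \<otimes> x)"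
    "\<And>x. x \<in> carrier G \<Longrightarrow> P x \<Longrightarrow> P (t \<otimes> x)" "\<And>x. x \<in> carrier G \<Longrightarrow> P x \<Longrightarrow> P (inv t \<otimes> x)"
  shows "P g"
  using assms(1) unfolding carrier_eq
  by (induction rule: generate_left_induct) (use assms(2-) in auto)

lemma hom_relation:
  assumes "group K" "h \<in> hom G K"
  shows "h a [^]\<^bsub>K\<^esub> m \<otimes>\<^bsub>K\<^esub> h t = h t \<otimes>\<^bsub>K\<^esub> h a [^]\<^bsub>K\<^esub> n"
proof -
  interpret h: group_hom G K h
    using assms is_group by (simp add: group_hom_iff)
  show ?thesis
    using relation h.hom_mult[of "a [^] m" t] h.hom_mult[of t "a [^] n"] by (simp add: h.hom_int_pow)
qed

text \<open>The group that \<open>A\<close> turns out to be. As a normal closure it comes with a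
  universal property, which the definition of \<open>A\<close> through G / R does not offer.\<close>

definition N :: "bs_letter word set set set" where
  "N = normal_closure G {a [^] d}"

definition conj_a :: "int \<Rightarrow> bs_letter word set set" where
  "conj_a k = t [^] k \<otimes> a [^] d \<otimes> t [^] (- k)"

abbreviation R :: "bs_letter word set set set" where
  "R \<equiv> finite_residual G"

lemma conj_a_closed [simp]: "conj_a k \<in> carrier G"
  by (simp add: conj_a_def)

lemma conj_a_0: "conj_a 0 = a [^] d"
  by (simp add: conj_a_def)

lemma N_normal: "N \<lhd> G"
  unfolding N_def by (rule normal_closure_normal) simp

lemma N_subgroup: "subgroup N G"
  using N_normal normal_imp_subgroup by blast

lemma N_subset: "N \<subseteq> carrier G"
  using N_subgroup subgroup.subset by blast

lemma a_pow_d_in_N: "a [^] d \<in> N"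
  unfolding N_def using normal_closure_incl[of "{a [^] d}"] by auto

lemma a_pow_in_N: "d dvd k \<Longrightarrow> a [^] k \<in> N"
  using subgroup_int_pow_closed[OF N_subgroup a_pow_d_in_N] by (auto simp: int_pow_pow elim!: dvdE)

lemma conj_a_in_N: "conj_a k \<in> N"
  using normal.inv_op_closed2[OF N_normal, of "t [^] k" "a [^] d"] a_pow_d_in_N
  by (simp add: conj_a_def int_pow_neg)

lemma N_kernel:
  assumes "group K" "h \<in> hom G K" "h a [^]\<^bsub>K\<^esub> d = \<one>\<^bsub>K\<^esub>" "g \<in> N"
  shows "h g = \<one>\<^bsub>K\<^esub>"
proof -
  interpret h: group_hom G K h
    using assms is_group by (simp add: group_hom_iff)
  have "N \<subseteq> kernel G K h"
    unfolding N_def using assms(3)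
    by (intro normal_closure_minimal h.normal_kernel) (simp add: kernel_def h.hom_int_pow)
  then show ?thesis
    using assms(4) by (auto simp: kernel_def)
qed

lemma finite_hom_conj_a:
  assumes "group K" "finite (carrier K)" "h \<in> hom G K"
  obtains j :: int where "h (conj_a k) = h a [^]\<^bsub>K\<^esub> j"
proof -
  interpret h: group_hom G K h
    using assms is_group by (simp add: group_hom_iff)
  have "h (conj_a k) = h t [^]\<^bsub>K\<^esub> k \<otimes>\<^bsub>K\<^esub> h a [^]\<^bsub>K\<^esub> d \<otimes>\<^bsub>K\<^esub> h t [^]\<^bsub>K\<^esub> (- k)"
    by (simp add: conj_a_def h.hom_int_pow)
  then show thesis
    using h.H.finite_conj_pow_gcd[OF assms(2) _ _ hom_relation[OF assms(1,3)], of k] that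
    by (auto simp: d_def)
qed

text \<open>In a finite image \<open>conj_a k\<close> becomes a power of the image of a and is fixed
  by conjugation with it; the element here measures the defect in G. The inverse of a is included
  because normality of \<open>A\<close> is proved letter by letter.\<close>

lemma conj_conj_a_in_R:
  assumes "g = a \<or> g = inv a"
  shows "inv (conj_a k) \<otimes> (g \<otimes> conj_a k \<otimes> inv g) \<in> R"
proof (rule finite_residualI)
  have g: "g \<in> carrier G"
    using assms by auto
  then show "inv (conj_a k) \<otimes> (g \<otimes> conj_a k \<otimes> inv g) \<in> carrier G"
    by simp
  fix K :: "(bs_letter word set set set \<Rightarrow> bs_letter word set set set) monoid" and h
  assume K: "group K" "finite (carrier K)" "h \<in> hom G K"
  interpret h: group_hom G K h
    using K is_group by (simp add: group_hom_iff)
  obtain j :: int where j: "h (conj_a k) = h a [^]\<^bsub>K\<^esub> j"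
    using finite_hom_conj_a[OF K] by blast
  obtain i :: int where i: "h g = h a [^]\<^bsub>K\<^esub> i"
    using assms h.H.int_pow_1[of "h a"] h.H.int_pow_neg[of "h a" 1] by (metis a_closed h.hom_closed h.hom_inv)
  have "h g \<otimes>\<^bsub>K\<^esub> h (conj_a k) = h (conj_a k) \<otimes>\<^bsub>K\<^esub> h g"
    unfolding i j using h.H.int_pow_mult[of "h a"] by (simp add: add.commute flip: h.H.int_pow_mult)
  then show "h (inv (conj_a k) \<otimes> (g \<otimes> conj_a k \<otimes> inv g)) = \<one>\<^bsub>K\<^esub>"
    using g by (simp add: h.H.m_assoc)
qed

end

section \<open>The subgroup A: normality, coincidence with N, commutativity modulo R\<close>

locale baumslag_solitar_quotient = baumslag_solitar +
  fixes A :: "bs_letter word set set set"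
  assumes A_subgroup: "subgroup A G" and R_subset_A: "R \<subseteq> A"
    and A_quotient: "carrier (G\<lparr>carrier := A\<rparr> Mod R) = generate (G Mod R) {R #> conj_a k | k. True}"
begin

interpretation R: normal R G
  by (rule finite_residual_normal)

interpretation Q: group "G Mod R"
  by (rule R.factorgroup_is_group)

lemma A_subset: "A \<subseteq> carrier G"
  using A_subgroup subgroup.subset by blast

lemma carrier_A_Mod: "carrier (G\<lparr>carrier := A\<rparr> Mod R) = (\<lambda>y. R #> y) ` A"
  by (auto simp: carrier_FactGroup r_coset_def)

lemma mem_of_coset_eq:
  assumes "subgroup S G" "R \<subseteq> S" "y \<in> S" "g \<in> carrier G" "R #> g = R #> y"
  shows "g \<in> S"
proof -
  have "g \<in> R #> y"
    using rcos_self[OF assms(4) R.is_subgroup] assms(5) by simp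
  then obtain r where "r \<in> R" "g = r \<otimes> y"
    by (auto simp: r_coset_def)
  then show ?thesis
    using assms subgroup.m_closed[OF assms(1)] by blast
qed

lemma conj_a_in_A: "conj_a k \<in> A"
proof -
  have "R #> conj_a k \<in> (\<lambda>y. R #> y) ` A"
    unfolding carrier_A_Mod[symmetric] A_quotient by (auto intro: generate.incl)
  then show ?thesis
    using mem_of_coset_eq[OF A_subgroup R_subset_A _ conj_a_closed] by blast
qed

text \<open>Transports the generation statement from G / R back to G; every upper bound for
  \<open>A\<close> is obtained from it.\<close>

lemma A_least:
  assumes S: "subgroup S G" "R \<subseteq> S" "\<And>k. conj_a k \<in> S"
  shows "A \<subseteq> S"
proof
  fix g assume g: "g \<in> A"
  have "group_hom G (G Mod R) (\<lambda>y. R #> y)"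
    using R.r_coset_hom_Mod by (simp add: group_hom_iff Q.is_group)
  then have "subgroup ((\<lambda>y. R #> y) ` S) (G Mod R)"
    using group_hom.subgroup_img_is_subgroup S(1) by blast
  then have "generate (G Mod R) {R #> conj_a k | k. True} \<subseteq> (\<lambda>y. R #> y) ` S"
    using S(3) by (intro Q.generate_subgroup_incl) auto
  then have "R #> g \<in> (\<lambda>y. R #> y) ` S"
    using g unfolding A_quotient[symmetric] carrier_A_Mod by blast
  then show "g \<in> S"
    using mem_of_coset_eq[OF S(1,2)] g A_subset by blast
qed

lemma A_conj:
  assumes g: "g \<in> carrier G" and x: "\<And>k. g \<otimes> conj_a k \<otimes> inv g \<in> A" and y: "y \<in> A"
  shows "g \<otimes> y \<otimes> inv g \<in> A"
proof -
  have cancel: "inv g \<otimes> (g \<otimes> z) = z" if "z \<in> carrier G" for z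
    using g that by (simp flip: m_assoc)
  have "subgroup {y \<in> carrier G. g \<otimes> y \<otimes> inv g \<in> A} G"
  proof (rule subgroup.intro)
    show "y \<otimes> z \<in> {y \<in> carrier G. g \<otimes> y \<otimes> inv g \<in> A}"
      if "y \<in> {y \<in> carrier G. g \<otimes> y \<otimes> inv g \<in> A}" "z \<in> {y \<in> carrier G. g \<otimes> y \<otimes> inv g \<in> A}" for y z
      using subgroup.m_closed[OF A_subgroup, of "g \<otimes> y \<otimes> inv g" "g \<otimes> z \<otimes> inv g"] that g
      by (auto simp: m_assoc cancel)
    show "inv y \<in> {y \<in> carrier G. g \<otimes> y \<otimes> inv g \<in> A}"
      if "y \<in> {y \<in> carrier G. g \<otimes> y \<otimes> inv g \<in> A}" for y
      using subgroup.m_inv_closed[OF A_subgroup, of "g \<otimes> y \<otimes> inv g"] that g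
      by (auto simp: m_assoc inv_mult_group)
  qed (use g subgroup.one_closed[OF A_subgroup] in auto)
  moreover have "R \<subseteq> {y \<in> carrier G. g \<otimes> y \<otimes> inv g \<in> A}"
    using R.inv_op_closed2[OF g] R_subset_A R.subset by blast
  ultimately show ?thesis
    using A_least[of "{y \<in> carrier G. g \<otimes> y \<otimes> inv g \<in> A}"] x y by auto
qed

text \<open>Conjugation by t or its inverse shifts the index of \<open>conj_a\<close>, and
  conjugation by a or its inverse fixes each \<open>conj_a k\<close> up to a factor in
  \<open>R\<close>, which lies in \<open>A\<close>. Induction over the letters of g does the
  rest.\<close>

lemma A_normal: "A \<lhd> G"
proof (rule normal_invI[OF A_subgroup])
  have x_a: "g \<otimes> conj_a k \<otimes> inv g \<in> A" if "g = a \<or> g = inv a" for g k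
  proof -
    have "conj_a k \<otimes> (inv (conj_a k) \<otimes> (g \<otimes> conj_a k \<otimes> inv g)) \<in> A"
      using conj_conj_a_in_R[OF that] R_subset_A conj_a_in_A subgroup.m_closed[OF A_subgroup] by blast
    moreover have "g \<in> carrier G"
      using that by auto
    ultimately show ?thesis
      by (simp flip: m_assoc)
  qed
  have x_t: "t \<otimes> conj_a k \<otimes> inv t \<in> A" "inv t \<otimes> conj_a k \<otimes> inv (inv t) \<in> A" for k
  proof -
    have "t [^] (k + 1) = t \<otimes> t [^] k" "t [^] (- (k + 1)) = t [^] (- k) \<otimes> inv t"
      "t [^] (k - 1) = inv t \<otimes> t [^] k" "t [^] (- (k - 1)) = t [^] (- k) \<otimes> t"
      using int_pow_mult[of t 1 k] int_pow_mult[of t "- k" "- 1"]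
        int_pow_mult[of t "-1" k] int_pow_mult[of t "- k" "1"]
      by (simp_all add: add.commute int_pow_neg)
    then have "t \<otimes> conj_a k \<otimes> inv t = conj_a (k + 1)" "inv t \<otimes> conj_a k \<otimes> inv (inv t) = conj_a (k - 1)"
      by (simp_all add: conj_a_def m_assoc)
    then show "t \<otimes> conj_a k \<otimes> inv t \<in> A" "inv t \<otimes> conj_a k \<otimes> inv (inv t) \<in> A"
      using conj_a_in_A by simp_all
  qed
  fix g y assume "g \<in> carrier G" "y \<in> A"
  then show "g \<otimes> y \<otimes> inv g \<in> A"
  proof (induction g arbitrary: y rule: induct)
    case one
    then show ?case
      using A_subset by auto
  next
    case (a g)
    then show ?case
      using A_conj[OF a_closed x_a a.IH] subsetD[OF A_subset] by (simp add: m_assoc inv_mult_group)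
  next
    case (inv_a g)
    then show ?case
      using A_conj[OF inv_closed[OF a_closed] x_a inv_a.IH] subsetD[OF A_subset] by (simp add: m_assoc inv_mult_group)
  next
    case (t g)
    then show ?case
      using A_conj[OF t_closed x_t(1) t.IH] subsetD[OF A_subset] by (simp add: m_assoc inv_mult_group)
  next
    case (inv_t g)
    then show ?case
      using A_conj[OF inv_closed[OF t_closed] x_t(2) inv_t.IH] subsetD[OF A_subset] by (simp add: m_assoc inv_mult_group)
  qed
qed

lemma A_eq_N:
  assumes "R \<subseteq> N"
  shows "A = N"
proof
  show "A \<subseteq> N"
    using A_least[OF N_subgroup assms conj_a_in_N] .
  show "N \<subseteq> A"
    unfolding N_def using normal_closure_minimal[OF A_normal] conj_a_in_A[of 0] by (simp add: conj_a_0)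
qed

lemma R_normal_A: "R \<lhd> G\<lparr>carrier := A\<rparr>"
  by (rule normal_restrict_supergroup[OF A_subgroup finite_residual_normal R_subset_A])

text \<open>In a finite image, the elements mapped to powers of the image of a form a subgroup
  containing \<open>R\<close> and every \<open>conj_a k\<close>, hence \<open>A\<close>. So
  \<open>A\<close> has commutative image.\<close>

lemma commutator_A_in_R:
  assumes y: "y \<in> A" and z: "z \<in> A"
  shows "commutator G y z \<in> R"
proof (rule finite_residualI)
  show "commutator G y z \<in> carrier G"
    using y z A_subset by (intro commutator_closed) auto
  fix K :: "(bs_letter word set set set \<Rightarrow> bs_letter word set set set) monoid" and h
  assume K: "group K" "finite (carrier K)" "h \<in> hom G K"
  interpret h: group_hom G K h
    using K is_group by (simp add: group_hom_iff)
  define S where "S = {g \<in> carrier G. \<exists>j :: int. h g = h a [^]\<^bsub>K\<^esub> j}"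
  have "subgroup S G"
  proof (rule subgroup.intro)
    show "g \<otimes> g' \<in> S" if "g \<in> S" "g' \<in> S" for g g'
      using that by (auto simp: S_def simp flip: h.H.int_pow_mult)
    show "inv g \<in> S" if "g \<in> S" for g
      using that by (auto simp: S_def simp flip: h.H.int_pow_neg)
    have "h \<one> = h a [^]\<^bsub>K\<^esub> (0 :: int)"
      by simp
    then show "\<one> \<in> S"
      unfolding S_def by blast
  qed (auto simp: S_def)
  moreover have "R \<subseteq> S"
  proof
    fix r assume r: "r \<in> R"
    then have "h r = h a [^]\<^bsub>K\<^esub> (0 :: int)"
      using finite_residual_hom[OF r K] by simp
    then show "r \<in> S"
      using r finite_residual_subset unfolding S_def by blast
  qed
  moreover have "conj_a k \<in> S" for k
    using finite_hom_conj_a[OF K, of k] unfolding S_def by (metis (mono_tags, lifting) mem_Collect_eq conj_a_closed)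
  ultimately have "A \<subseteq> S"
    by (rule A_least)
  then have "y \<in> S" "z \<in> S"
    using y z by auto
  then obtain i j :: int where "h y = h a [^]\<^bsub>K\<^esub> i" "h z = h a [^]\<^bsub>K\<^esub> j"
    by (auto simp: S_def)
  then have "h y \<otimes>\<^bsub>K\<^esub> h z = h z \<otimes>\<^bsub>K\<^esub> h y"
    by (simp add: add.commute flip: h.H.int_pow_mult)
  then show "h (commutator G y z) = \<one>\<^bsub>K\<^esub>"
    using y z A_subset h.H.commutator_eq_one_iff[of "h y" "h z"] by (simp add: h.hom_commutator subsetD)
qed

lemma A_Mod_R_comm: "comm_group (G\<lparr>carrier := A\<rparr> Mod R)"
proof (rule group.group_comm_groupI)
  show "group (G\<lparr>carrier := A\<rparr> Mod R)"
    by (rule normal.factorgroup_is_group[OF R_normal_A])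
  fix X Y
  assume "X \<in> carrier (G\<lparr>carrier := A\<rparr> Mod R)" "Y \<in> carrier (G\<lparr>carrier := A\<rparr> Mod R)"
  then obtain y z where yz: "y \<in> A" "X = R #> y" "z \<in> A" "Y = R #> z"
    unfolding carrier_A_Mod by blast
  then have c: "y \<in> carrier G" "z \<in> carrier G"
    using A_subset by auto
  have "R #> (y \<otimes> z) = (R #> (z \<otimes> y)) <#> (R #> commutator G y z)"
    using c R.rcos_sum[of "z \<otimes> y" "commutator G y z"] by (simp add: mult_commutator)
  also have "R #> commutator G y z = R #> \<one>"
    using commutator_A_in_R[OF yz(1,3)] R.rcos_const R.subset by auto
  also have "(R #> (z \<otimes> y)) <#> (R #> \<one>) = R #> (z \<otimes> y)"
    using c R.rcos_sum[of "z \<otimes> y" \<one>] by simp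
  finally show "X \<otimes>\<^bsub>G\<lparr>carrier := A\<rparr> Mod R\<^esub> Y = Y \<otimes>\<^bsub>G\<lparr>carrier := A\<rparr> Mod R\<^esub> X"
    using yz c by (simp add: R.rcos_sum)
qed

end

section \<open>Residual finiteness of the quotient by the normal closure of \<open>a\<^sup>d\<close>\<close>

text \<open>The list \<open>[(l\<^sub>k, e\<^sub>k), \<dots>, (l\<^sub>1, e\<^sub>1)]\<close> with base \<open>l\<^sub>0\<close> stands for the
  element \<open>a^l\<^sub>k t^e\<^sub>k \<cdots> a^l\<^sub>1 t^e\<^sub>1 a^l\<^sub>0\<close>.\<close>

fun syllable_prod ::
    "('a, 'b) monoid_scheme \<Rightarrow> 'a \<Rightarrow> 'a \<Rightarrow> int \<Rightarrow> (int \<times> int) list \<Rightarrow> 'a" where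
  "syllable_prod K a t l0 [] = a [^]\<^bsub>K\<^esub> l0"
| "syllable_prod K a t l0 ((l, e) # ws) =
     a [^]\<^bsub>K\<^esub> l \<otimes>\<^bsub>K\<^esub> (t [^]\<^bsub>K\<^esub> e \<otimes>\<^bsub>K\<^esub> syllable_prod K a t l0 ws)"

text \<open>Exponents are 1 or -1 so that each syllable climbs exactly one level of the path. A zero
  exponent of a between two syllables makes their letters t adjacent, and then they must not
  cancel.\<close>

fun unit_reduced :: "int \<Rightarrow> (int \<times> int) list \<Rightarrow> bool" where
  "unit_reduced d [] \<longleftrightarrow> True"
| "unit_reduced d [(l, e)] \<longleftrightarrow> l \<in> {0..<d} \<and> e \<in> {1, -1}"
| "unit_reduced d ((l, e) # (l', e') # ws) \<longleftrightarrow>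
     l \<in> {0..<d} \<and> e \<in> {1, -1} \<and> (l' = 0 \<longrightarrow> e = e') \<and> unit_reduced d ((l', e') # ws)"

lemma unit_reduced_tl: "unit_reduced d (w # ws) \<Longrightarrow> unit_reduced d ws"
  by (cases "(d, w # ws)" rule: unit_reduced.cases) auto

lemma unit_reduced_hd: "unit_reduced d ((l, e) # ws) \<Longrightarrow> l \<in> {0..<d} \<and> e \<in> {1, -1}"
  by (cases "(d, (l, e) # ws)" rule: unit_reduced.cases) auto

lemma unit_reduced_change_hd:
  "unit_reduced d ((l, e) # ws) \<Longrightarrow> l' \<in> {0..<d} \<Longrightarrow> unit_reduced d ((l', e) # ws)"
  by (cases "(d, (l, e) # ws)" rule: unit_reduced.cases) auto

context group
begin

lemma syllable_prod_closed [simp]: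
  "a \<in> carrier G \<Longrightarrow> t \<in> carrier G \<Longrightarrow> syllable_prod G a t l ws \<in> carrier G"
  by (induction ws) auto

lemma int_pow_mod:
  assumes "a \<in> carrier G" "a [^] (d :: int) = \<one>"
  shows "a [^] (k mod d) = a [^] k"
proof -
  have "a [^] (d * (k div d) + k mod d) = (a [^] d) [^] (k div d) \<otimes> a [^] (k mod d)"
    using assms(1) by (simp only: int_pow_pow int_pow_mult)
  then show ?thesis
    using assms by simp
qed

lemma syllable_prod_mult_a:
  assumes "a \<in> carrier G" "t \<in> carrier G" "a [^] (d :: int) = \<one>"
  shows "a [^] (j :: int) \<otimes> syllable_prod G a t l0 ((l, e) # ws)
      = syllable_prod G a t l0 (((l + j) mod d, e) # ws)"
    and "a [^] j \<otimes> syllable_prod G a t l0 [] = syllable_prod G a t ((l0 + j) mod d) []"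
proof -
  have "a [^] j \<otimes> (a [^] l \<otimes> y) = a [^] ((l + j) mod d) \<otimes> y" if "y \<in> carrier G" for y l
    using assms that by (simp add: int_pow_mod int_pow_mult add.commute[of l] m_assoc)
  then show "a [^] j \<otimes> syllable_prod G a t l0 ((l, e) # ws)
      = syllable_prod G a t l0 (((l + j) mod d, e) # ws)"
    using assms by simp
  show "a [^] j \<otimes> syllable_prod G a t l0 [] = syllable_prod G a t ((l0 + j) mod d) []"
    using assms by (simp add: int_pow_mod add.commute[of l0] flip: int_pow_mult)
qed

text \<open>The predicate \<open>red\<close> is left abstract since two kinds of reduced words
  occur. By \<open>push\<close>, a further t or t^-1 either starts a new syllable or merges with a
  leading power of t; if that power cancels, the remaining word is still reduced.\<close>

lemma ex_reduced_syllable_prod: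
  assumes a: "a \<in> carrier G" and t: "t \<in> carrier G" and d: "a [^] (d :: int) = \<one>" "0 < d"
    and g: "g \<in> generate G {a, t}" and nil: "red []"
    and change: "\<And>l l' k ws. red ((l, k) # ws) \<Longrightarrow> l' \<in> {0..<d} \<Longrightarrow> red ((l', k) # ws)"
    and push: "\<And>j ws. j \<in> {1, -1} \<Longrightarrow> red ws \<Longrightarrow> red ((0, j) # ws) \<or>
      (\<exists>k ws'. ws = (0, k) # ws' \<and> red (if j + k = 0 then ws' else (0, j + k) # ws'))"
  shows "\<exists>l0 ws. l0 \<in> {0..<d} \<and> red ws \<and> g = syllable_prod G a t l0 ws"
proof -
  define P where
    "P g \<longleftrightarrow> (\<exists>l0 ws. l0 \<in> {0..<d} \<and> red ws \<and> g = syllable_prod G a t l0 ws)" for g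
  have mult_a: "P (a [^] j \<otimes> g)" if "P g" for j :: int and g
  proof -
    obtain l0 ws where g: "l0 \<in> {0..<d}" "red ws" "g = syllable_prod G a t l0 ws"
      using \<open>P g\<close> unfolding P_def by blast
    show ?thesis
    proof (cases ws)
      case Nil
      then show ?thesis
        unfolding P_def g(3) Nil syllable_prod_mult_a(2)[OF a t d(1)]
        using d nil by (intro exI[of _ "(l0 + j) mod d"] exI[of _ "[]"]) auto
    next
      case (Cons w ws')
      obtain l e where w: "w = (l, e)" by force
      have "red (((l + j) mod d, e) # ws')"
        using change g(2) d unfolding Cons w by fastforce
      then show ?thesis
        unfolding P_def g(3) Cons w syllable_prod_mult_a(1)[OF a t d(1)] using g(1) by blast
    qed
  qed
  have mult_t: "P (t [^] j \<otimes> g)" if "P g" and j: "j \<in> {1, -1}" for j :: int and g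
  proof -
    obtain l0 ws where g: "l0 \<in> {0..<d}" "red ws" "g = syllable_prod G a t l0 ws"
      using \<open>P g\<close> unfolding P_def by blast
    show ?thesis
      using push[OF j g(2)]
    proof (elim disjE exE conjE)
      assume "red ((0, j) # ws)"
      moreover have "t [^] j \<otimes> g = syllable_prod G a t l0 ((0, j) # ws)"
        using a t g(3) by simp
      ultimately show ?thesis
        unfolding P_def using g(1) by blast
    next
      fix k ws' assume ws: "ws = (0, k) # ws'" "red (if j + k = 0 then ws' else (0, j + k) # ws')"
      have "t [^] j \<otimes> g = t [^] (j + k) \<otimes> syllable_prod G a t l0 ws'"
        using a t by (simp add: g(3) ws(1) int_pow_mult m_assoc)
      also have "\<dots> = syllable_prod G a t l0 (if j + k = 0 then ws' else (0, j + k) # ws')"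
        using a t by simp
      finally show ?thesis
        unfolding P_def using g(1) ws(2) by blast
    qed
  qed
  have "P g"
    using g
  proof (induction rule: generate_left_induct)
    case one
    have "\<one> = syllable_prod G a t 0 []"
      by simp
    then show ?case
      unfolding P_def using d(2) nil by (intro exI[of _ 0] exI[of _ "[]"]) auto
  next
    case (incl s x)
    then show ?case
      using mult_a[OF incl(3), of 1] mult_t[OF incl(3), of 1] a t by auto
  next
    case (inv s x)
    then show ?case
      using mult_a[OF inv(3), of "-1"] mult_t[OF inv(3), of "-1"] a t by (auto simp: int_pow_neg)
  qed (use a t in auto)
  then show ?thesis
    unfolding P_def .
qed

end

lemma unit_reduced_push:
  assumes "j \<in> {1, -1}" "unit_reduced d ws" "0 < d"
  shows "unit_reduced d ((0, j) # ws) \<or>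
    (\<exists>k ws'. ws = (0, k) # ws' \<and> unit_reduced d (if j + k = 0 then ws' else (0, j + k) # ws'))"
proof (cases ws)
  case (Cons w ws')
  obtain l e where w: "w = (l, e)" by force
  then show ?thesis
    using assms unit_reduced_hd[of d l e ws'] unit_reduced_tl[of d "(l, e)" ws'] by (auto simp: Cons)
qed (use assms in auto)

lemma hom_syllable_prod:
  assumes "group G" "group K" "h \<in> hom G K" "a \<in> carrier G" "t \<in> carrier G"
  shows "h (syllable_prod G a t l0 ws) = syllable_prod K (h a) (h t) l0 ws"
proof -
  interpret h: group_hom G K h
    using assms by (simp add: group_hom_iff)
  show ?thesis
    by (induction ws) (use assms(4,5) in \<open>auto simp: h.hom_int_pow\<close>)
qed

text \<open>Domain and range of a partial injection of a finite set have complements of equal size,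
  and any bijection between these completes it.\<close>

lemma extend_partial_injection:
  assumes "finite \<Omega>" "r \<subseteq> \<Omega> \<times> \<Omega>"
    and inj: "\<And>p q p' q'. (p, q) \<in> r \<Longrightarrow> (p', q') \<in> r \<Longrightarrow> p = p' \<longleftrightarrow> q = q'"
  shows "\<exists>f. f permutes \<Omega> \<and> (\<forall>p q. (p, q) \<in> r \<longrightarrow> f p = q)"
proof -
  define f where "f p = (THE q. (p, q) \<in> r)" for p
  have f: "f p = q" if "(p, q) \<in> r" for p q
    unfolding f_def using that inj by blast
  have sub: "Domain r \<subseteq> \<Omega>" "Range r \<subseteq> \<Omega>"
    using assms(2) by auto
  have bij: "bij_betw f (Domain r) (Range r)"
    unfolding bij_betw_def inj_on_def using f inj by force
  have "card (\<Omega> - Domain r) = card (\<Omega> - Range r)"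
    using bij_betw_same_card[OF bij] sub assms(1) by (simp add: card_Diff_subset finite_subset)
  then obtain g where g: "bij_betw g (\<Omega> - Domain r) (\<Omega> - Range r)"
    using finite_same_card_bij[of "\<Omega> - Domain r" "\<Omega> - Range r"] assms(1) by auto
  define F where "F p = (if p \<in> \<Omega> then if p \<in> Domain r then f p else g p else p)" for p
  have "bij_betw F (Domain r \<union> (\<Omega> - Domain r)) (Range r \<union> (\<Omega> - Range r))"
  proof (rule bij_betw_combine)
    show "bij_betw F (Domain r) (Range r)"
      using bij sub by (subst bij_betw_cong[of _ _ f]) (auto simp: F_def)
    show "bij_betw F (\<Omega> - Domain r) (\<Omega> - Range r)"
      using g by (subst bij_betw_cong[of _ _ g]) (auto simp: F_def)
  qed auto
  then have "bij_betw F \<Omega> \<Omega>"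
    using sub by (simp add: Un_absorb1)
  then have "F permutes \<Omega>"
    by (rule bij_imp_permutes) (simp add: F_def)
  moreover have "F p = q" if "(p, q) \<in> r" for p q
  proof -
    have "p \<in> Domain r" "p \<in> \<Omega>"
      using that sub by auto
    then show ?thesis
      using f[OF that] by (simp add: F_def)
  qed
  ultimately show ?thesis
    by blast
qed

text \<open>The edges that \<open>t\<close> must respect for the word to move \<open>(0, 0)\<close> along a path through the
  levels \<open>0, 1, \<dots>\<close>, one level for each letter \<open>t\<close> or \<open>t\<inverse>\<close>; on each level \<open>a\<close> acts as a
  cycle of length \<open>d\<close>.\<close>

fun path_position :: "int \<Rightarrow> (int \<times> int) list \<Rightarrow> nat \<times> int" where
  "path_position l0 [] = (0, l0)"
| "path_position l0 ((l, e) # ws) = (Suc (length ws), l)"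

fun path_edges :: "int \<Rightarrow> (int \<times> int) list \<Rightarrow> ((nat \<times> int) \<times> (nat \<times> int)) set" where
  "path_edges l0 [] = {}"
| "path_edges l0 ((l, e) # ws) =
     insert (if e = 1 then (path_position l0 ws, (Suc (length ws), 0))
             else ((Suc (length ws), 0), path_position l0 ws)) (path_edges l0 ws)"

lemma path_edges_in:
  assumes "l0 \<in> {0..<d}" "unit_reduced d ws"
  shows "path_edges l0 ws \<subseteq> ({..length ws} \<times> {0..<d}) \<times> ({..length ws} \<times> {0..<d})
    \<and> path_position l0 ws \<in> {..length ws} \<times> {0..<d}"
  using assms(2)
proof (induction ws)
  case (Cons w ws)
  obtain l e where w: "w = (l, e)" by force
  show ?case
    using Cons.IH[OF unit_reduced_tl[OF Cons.prems]] unit_reduced_hd[of d l e ws] Cons.prems assms(1)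
    by (fastforce simp: w)
qed (use assms(1) in auto)

lemma path_edges_top:
  assumes "l0 \<in> {0..<d}" "unit_reduced d ((l, e) # ws)" "(p, q) \<in> path_edges l0 ((l, e) # ws)"
  shows "(fst p = Suc (length ws) \<longrightarrow> e = -1 \<and> snd p = 0) \<and> (fst q = Suc (length ws) \<longrightarrow> e = 1 \<and> snd q = 0)"
  using assms path_edges_in[OF assms(1) unit_reduced_tl[OF assms(2)]] unit_reduced_hd[OF assms(2)]
  by (fastforce split: if_splits)

text \<open>A new edge has one end on a fresh level. Its other end (k, l') lies on the former top
  level, where the only vertex met by an edge is (k, 0), as a target if e' = 1 and as a source if e'
  = -1. A clash would need l' = 0 and e = -e', which reducedness excludes.\<close>

lemma path_edges_inj:
  assumes l0: "l0 \<in> {0..<d}" and "unit_reduced d ws"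
    and "(p, q) \<in> path_edges l0 ws" "(p', q') \<in> path_edges l0 ws"
  shows "p = p' \<longleftrightarrow> q = q'"
  using assms(2-4)
proof (induction ws arbitrary: p q p' q')
  case step: (Cons w ws)
  obtain l e where w: "w = (l, e)" by force
  let ?new = "if e = 1 then (path_position l0 ws, (Suc (length ws), 0))
             else ((Suc (length ws), 0), path_position l0 ws)"
  note red = unit_reduced_tl[OF step.prems(1)]
  have old: "p1 = p2 \<longleftrightarrow> q1 = q2" if "(p1, q1) \<in> path_edges l0 ws" "(p2, q2) \<in> path_edges l0 ws" for p1 q1 p2 q2
    using step.IH[OF red] that by blast
  have fresh: "p1 \<noteq> fst ?new \<and> q1 \<noteq> snd ?new"
    if edge: "(p1, q1) \<in> path_edges l0 ws" for p1 q1
  proof (cases ws)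
    case Nil
    then show ?thesis
      using edge by simp
  next
    case (Cons w' ws')
    obtain l' e' where w': "w' = (l', e')" by force
    have "l' = 0 \<longrightarrow> e = e'" "e = 1 \<or> e = -1"
      using step.prems(1) unfolding w Cons w' by auto
    moreover have "fst p1 \<le> length ws" "fst q1 \<le> length ws"
      using path_edges_in[OF l0 red] edge by (auto simp: mem_Times_iff)
    ultimately show ?thesis
      using path_edges_top[OF l0 _ edge[unfolded Cons w']] red unfolding Cons w' by auto
  qed
  show ?case
  proof -
    obtain np nq where new: "?new = (np, nq)"
      by (metis surj_pair)
    have "(p, q) = (np, nq) \<or> (p, q) \<in> path_edges l0 ws"
      "(p', q') = (np, nq) \<or> (p', q') \<in> path_edges l0 ws"
      using step.prems(2,3) unfolding w path_edges.simps new by blast+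
    moreover have "p1 \<noteq> np \<and> q1 \<noteq> nq" if "(p1, q1) \<in> path_edges l0 ws" for p1 q1
      using fresh[OF that] unfolding new by simp
    ultimately show ?thesis
      using old by blast
  qed
qed simp

lemma path_of_syllable_prod:
  assumes l0: "l0 \<in> {0..<d}" and "unit_reduced d ws"
    and K: "group K" "\<alpha> \<in> carrier K" "\<tau> \<in> carrier K" "\<rho> \<in> hom K (perm_group \<Omega>)"
    and a: "\<And>i l. i \<le> L \<Longrightarrow> l \<in> {0..<d} \<Longrightarrow> \<rho> (\<alpha> [^]\<^bsub>K\<^esub> l) (i, 0) = (i, l)"
    and t: "\<And>p q. (p, q) \<in> path_edges l0 ws \<Longrightarrow> \<rho> \<tau> p = q"
    and "length ws \<le> L"
  shows "\<rho> (syllable_prod K \<alpha> \<tau> l0 ws) (0, 0) = path_position l0 ws"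
proof -
  interpret \<rho>: group_hom K "perm_group \<Omega>" \<rho>
    using K by (simp add: group_hom_iff)
  show ?thesis
    using assms(2) t \<open>length ws \<le> L\<close>
  proof (induction ws)
    case Nil
    then show ?case
      using a[of 0 l0] l0 by simp
  next
    case (Cons w ws)
    obtain l e where w: "w = (l, e)" by force
    have le: "l \<in> {0..<d}" "e = 1 \<or> e = -1"
      using unit_reduced_hd Cons.prems(1) unfolding w by auto
    have IH: "\<rho> (syllable_prod K \<alpha> \<tau> l0 ws) (0, 0) = path_position l0 ws"
      using Cons.IH[OF unit_reduced_tl[OF Cons.prems(1)]] Cons.prems(2,3) by (simp add: w)
    have "\<rho> (\<tau> [^]\<^bsub>K\<^esub> e) (path_position l0 ws) = (Suc (length ws), 0)"
      using le(2)
    proof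
      assume "e = 1"
      then show ?thesis
        using Cons.prems(2)[of "path_position l0 ws"] K by (simp add: w)
    next
      assume e: "e = -1"
      have perm: "\<rho> \<tau> permutes \<Omega>"
        using \<rho>.hom_closed[OF K(3)] by simp
      have "\<rho> (\<tau> [^]\<^bsub>K\<^esub> e) = inv_into UNIV (\<rho> \<tau>)"
        using K e perm by (simp add: \<rho>.G.int_pow_neg perm_group_inv)
      moreover have "\<rho> \<tau> (Suc (length ws), 0) = path_position l0 ws"
        using Cons.prems(2)[of "(Suc (length ws), 0)"] e by (simp add: w)
      ultimately show ?thesis
        using permutes_inv_eq[OF perm] by simp
    qed
    moreover have "\<rho> (\<alpha> [^]\<^bsub>K\<^esub> l) (Suc (length ws), 0) = (Suc (length ws), l)"
      using a le(1) Cons.prems(3) by simp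
    ultimately show ?case
      using IH K by (simp add: w \<rho>.hom_mult[unfolded perm_group_simps])
  qed
qed

lemma rotation_permutes:
  "(\<lambda>(i, y). if (i, y) \<in> {..L :: nat} \<times> {0..<d :: int} then (i, (y + 1) mod d) else (i, y))
    permutes ({..L} \<times> {0..<d})"
  by (rule permutes_witness[where g = "\<lambda>(i, y). (i, (y - 1) mod d)"])
    (auto simp: mod_add_left_eq mod_diff_left_eq split: if_splits)

lemma funpow_rotation:
  assumes "i \<le> L" "y \<in> {0..<d}"
  shows "((\<lambda>(i, y). if (i, y) \<in> {..L :: nat} \<times> {0..<d :: int} then (i, (y + 1) mod d) else (i, y)) ^^ k) (i, y)
    = (i, (y + int k) mod d)"
proof (induction k)
  case (Suc k)
  have "0 < d"
    using assms(2) by auto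
  then show ?case
    using Suc assms(1) by (simp add: mod_add_right_eq mod_add_left_eq add.commute add.left_commute)
qed (use assms in simp)

context baumslag_solitar
begin

lemma group_Mod_N: "group (G Mod N)"
  using normal.factorgroup_is_group[OF N_normal] .

lemma hom_Mod_N: "(\<lambda>y. N #> y) \<in> hom G (G Mod N)"
  using normal.r_coset_hom_Mod[OF N_normal] .

sublocale Mod_N: group_hom G "G Mod N" "\<lambda>y. N #> y"
  using group_Mod_N hom_Mod_N is_group by (simp add: group_hom_iff)

lemma Mod_N_eq_one_iff: "g \<in> carrier G \<Longrightarrow> N #> g = N \<longleftrightarrow> g \<in> N"
  using coset_join1[OF _ _ N_subgroup] coset_join2[OF _ N_subgroup] by blast

lemma Mod_N_a_pow_d: "(N #> a) [^]\<^bsub>G Mod N\<^esub> d = \<one>\<^bsub>G Mod N\<^esub>"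
  using a_pow_d_in_N Mod_N_eq_one_iff[of "a [^] d"] Mod_N.hom_int_pow[of a d] by simp

lemma carrier_Mod_N: "carrier (G Mod N) = generate (G Mod N) {N #> a, N #> t}"
proof -
  have "carrier (G Mod N) = (\<lambda>y. N #> y) ` carrier G"
    by (rule carrier_FactGroup)
  then show ?thesis
    using Mod_N.generate_img[of "{a, t}"] by (simp flip: carrier_eq)
qed

text \<open>If \<open>g\<close> is not in \<open>N\<close>, the finite path of its reduced word modulo \<open>N\<close> gives a finite
  permutation representation that moves the start of the path.\<close>

lemma R_subset_N: "R \<subseteq> N"
proof
  fix g assume g: "g \<in> R"
  then have gc: "g \<in> carrier G"
    using finite_residual_subset by blast
  have "N #> g \<in> generate (G Mod N) {N #> a, N #> t}"
    using Mod_N.hom_closed[OF gc] carrier_Mod_N by blast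
  then have "\<exists>l0 ws. l0 \<in> {0..<d} \<and> unit_reduced d ws \<and>
      N #> g = syllable_prod (G Mod N) (N #> a) (N #> t) l0 ws"
    by (rule Mod_N.H.ex_reduced_syllable_prod[OF Mod_N.hom_closed[OF a_closed]
          Mod_N.hom_closed[OF t_closed] Mod_N_a_pow_d d_pos])
      (simp, erule (1) unit_reduced_change_hd, erule (1) unit_reduced_push[OF _ _ d_pos])
  then obtain l0 ws where ws: "l0 \<in> {0..<d}" "unit_reduced d ws"
      "N #> g = syllable_prod (G Mod N) (N #> a) (N #> t) l0 ws"
    by blast
  define L where "L = length ws"
  define \<Omega> where "\<Omega> = {..L} \<times> {0..<d}"
  define \<alpha> where "\<alpha> = (\<lambda>(i, y). if (i, y) \<in> {..L} \<times> {0..<d} then (i, (y + 1) mod d) else (i, y))"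
  have \<alpha>: "\<alpha> permutes \<Omega>"
    unfolding \<alpha>_def \<Omega>_def by (rule rotation_permutes)
  have \<alpha>_pow: "(\<alpha> [^]\<^bsub>perm_group \<Omega>\<^esub> l) (i, y) = (i, (y + l) mod d)"
    if "i \<le> L" "y \<in> {0..<d}" "0 \<le> l" for i y l
    using funpow_rotation[OF that(1,2), of "nat l"] that(3)
    by (simp add: perm_group_nat_pow \<alpha>_def int_pow_def2)
  interpret P: group "perm_group \<Omega>"
    by simp
  have \<alpha>_d: "\<alpha> [^]\<^bsub>perm_group \<Omega>\<^esub> d = id"
  proof
    fix p :: "nat \<times> int"
    have "(\<alpha> [^]\<^bsub>perm_group \<Omega>\<^esub> d) permutes \<Omega>"
      using P.int_pow_closed[of \<alpha> d] \<alpha> by simp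
    then show "(\<alpha> [^]\<^bsub>perm_group \<Omega>\<^esub> d) p = id p"
      using \<alpha>_pow[of "fst p" "snd p" d] d_pos permutes_not_in[of _ \<Omega> p] by (cases p) (auto simp: \<Omega>_def)
  qed
  obtain \<tau> where \<tau>: "\<tau> permutes \<Omega>" "\<And>p q. (p, q) \<in> path_edges l0 ws \<Longrightarrow> \<tau> p = q"
  proof -
    have "\<exists>f. f permutes \<Omega> \<and> (\<forall>p q. (p, q) \<in> path_edges l0 ws \<longrightarrow> f p = q)"
    proof (rule extend_partial_injection)
      show "path_edges l0 ws \<subseteq> \<Omega> \<times> \<Omega>"
        using path_edges_in[OF ws(1,2)] unfolding \<Omega>_def L_def by blast
    qed (use path_edges_inj[OF ws(1,2)] in \<open>simp_all add: \<Omega>_def\<close>)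
    then show thesis
      using that by blast
  qed
  have "\<alpha> [^]\<^bsub>perm_group \<Omega>\<^esub> k = \<one>\<^bsub>perm_group \<Omega>\<^esub>" if "d dvd k" for k
    using that \<alpha>_d \<alpha> P.int_pow_one[unfolded perm_group_simps]
    by (auto elim!: dvdE simp flip: P.int_pow_pow)
  then have "\<alpha> [^]\<^bsub>perm_group \<Omega>\<^esub> m \<otimes>\<^bsub>perm_group \<Omega>\<^esub> \<tau>
      = \<tau> \<otimes>\<^bsub>perm_group \<Omega>\<^esub> \<alpha> [^]\<^bsub>perm_group \<Omega>\<^esub> n"
    using d_dvd_m d_dvd_n \<alpha> \<tau>(1) by simp
  then obtain \<rho> where \<rho>: "\<rho> \<in> hom G (perm_group \<Omega>)" "\<rho> a = \<alpha>" "\<rho> t = \<tau>"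
    using universal[OF P.is_group, of \<alpha> \<tau>] \<alpha> \<tau>(1) by auto
  interpret \<rho>: group_hom G "perm_group \<Omega>" \<rho>
    using \<rho> is_group P.is_group by (simp add: group_hom_iff)
  let ?w = "syllable_prod G a t l0 ws"
  have "N #> g = N #> ?w"
    using ws(3) hom_syllable_prod[OF is_group group_Mod_N hom_Mod_N] by simp
  then obtain c where c: "c \<in> N" "g = c \<otimes> ?w"
    using rcos_self[OF gc N_subgroup] by (auto simp: r_coset_def)
  have "\<rho> c = id"
    using N_kernel[OF P.is_group \<rho>(1) _ c(1)] \<alpha>_d by (simp add: \<rho>(2))
  moreover have "\<rho> g = id"
    using finite_residual_hom[OF g P.is_group _ \<rho>(1)] by (simp add: \<Omega>_def finite_permutations)
  ultimately have "\<rho> ?w = id"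
    using c N_subset \<rho>.hom_mult[of c ?w] by auto
  moreover have "\<rho> ?w (0, 0) = path_position l0 ws"
  proof (rule path_of_syllable_prod[OF ws(1,2) is_group a_closed t_closed \<rho>(1)])
    show "\<rho> (a [^] l) (i, 0) = (i, l)" if "i \<le> L" "l \<in> {0..<d}" for i l
      using \<alpha>_pow[of i 0 l] that d_pos by (simp add: \<rho>.hom_int_pow \<rho>(2))
  qed (use \<tau>(2) \<rho>(3) in \<open>auto simp: L_def\<close>)
  \<comment> \<open>A non-empty word ends on the level \<open>length ws\<close>, which is positive,
    and the empty one at (0, l0). So the path returns to its start only if the word is
    trivial.\<close>
  ultimately have "path_position l0 ws = (0, 0)"
    by simp
  then have "ws = [] \<and> l0 = 0"
    by (cases "(l0, ws)" rule: path_position.cases) auto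
  then have "N #> g = N"
    using ws(3) by simp
  then show "g \<in> N"
    using Mod_N_eq_one_iff[OF gc] by blast
qed

end

section \<open>The finite residual lies in every term of the lower central series\<close>

context group
begin

lemma commutes_generate:
  assumes "z \<in> carrier G" "S \<subseteq> carrier G" "\<And>s. s \<in> S \<Longrightarrow> z \<otimes> s = s \<otimes> z" "g \<in> generate G S"
  shows "z \<otimes> g = g \<otimes> z"
proof -
  have inv: "z \<otimes> inv y = inv y \<otimes> z" if "y \<in> carrier G" "z \<otimes> y = y \<otimes> z" for y
  proof -
    have "inv y \<otimes> (z \<otimes> y) \<otimes> inv y = inv y \<otimes> (y \<otimes> z) \<otimes> inv y"
      by (simp only: that(2))
    moreover have "inv y \<otimes> (z \<otimes> y) \<otimes> inv y = inv y \<otimes> z"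
      using that(1) assms(1) by (simp add: m_assoc)
    moreover have "inv y \<otimes> (y \<otimes> z) \<otimes> inv y = z \<otimes> inv y"
      using that(1) assms(1) by (simp flip: m_assoc)
    ultimately show ?thesis
      by simp
  qed
  have "subgroup {y \<in> carrier G. z \<otimes> y = y \<otimes> z} G"
    by (rule subgroup.intro) (use assms(1) inv in \<open>auto simp: m_assoc\<close>, metis m_assoc)
  then have "generate G S \<subseteq> {y \<in> carrier G. z \<otimes> y = y \<otimes> z}"
    using assms by (intro generate_subgroup_incl) auto
  then show ?thesis
    using assms(4) by blast
qed

text \<open>With c = [a, t] commuting with a and t one has a^j t = t a^j c^j and a t^j = t^j a c^j.
  The first identity at j = s gives c^s = 1, and then the second gives the claim.\<close>

lemma commutator_pow_eq_one:
  fixes s :: nat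
  assumes a: "a \<in> carrier G" and t: "t \<in> carrier G" and "a [^] s = \<one>"
    and ca: "commutator G a t \<otimes> a = a \<otimes> commutator G a t"
    and ct: "commutator G a t \<otimes> t = t \<otimes> commutator G a t"
  shows "commutator G a (t [^] s) = \<one>"
proof -
  define c where "c = commutator G a t"
  have c: "c \<in> carrier G"
    using a t by (simp add: c_def)
  have at: "a \<otimes> t = t \<otimes> (a \<otimes> c)"
    using mult_commutator[OF a t] a t c by (simp add: c_def m_assoc)
  have "a [^] j \<otimes> t = t \<otimes> (a [^] j \<otimes> c [^] j)" for j :: nat
  proof (induction j)
    case (Suc j)
    have "a [^] Suc j \<otimes> t = a [^] j \<otimes> t \<otimes> (a \<otimes> c)"
      using a t c at by (simp add: m_assoc)
    also have "\<dots> = t \<otimes> (a [^] j \<otimes> (c [^] j \<otimes> a) \<otimes> c)"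
      using Suc a t c by (simp add: m_assoc)
    also have "c [^] j \<otimes> a = a \<otimes> c [^] j"
      using nat_pow_comm_elem[OF c a] ca by (simp add: c_def)
    finally show ?case
      using a t c by (simp add: m_assoc)
  qed (use a t c in simp)
  from this[of s] have cs: "c [^] s = \<one>"
    using assms(3) t c by simp
  have "a \<otimes> t [^] j = t [^] j \<otimes> (a \<otimes> c [^] j)" for j :: nat
  proof (induction j)
    case (Suc j)
    have "a \<otimes> t [^] Suc j = t [^] j \<otimes> (a \<otimes> (c [^] j \<otimes> t))"
      using Suc a t c by (simp flip: m_assoc)
    also have "c [^] j \<otimes> t = t \<otimes> c [^] j"
      using nat_pow_comm_elem[OF c t] ct by (simp add: c_def)
    also have "t [^] j \<otimes> (a \<otimes> (t \<otimes> c [^] j)) = t [^] j \<otimes> ((a \<otimes> t) \<otimes> c [^] j)"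
      using a t c by (simp add: m_assoc)
    also have "\<dots> = t [^] Suc j \<otimes> (a \<otimes> (c \<otimes> c [^] j))"
      using a t c at by (simp add: m_assoc)
    also have "c \<otimes> c [^] j = c [^] Suc j"
      using nat_pow_Suc2[OF c] by simp
    finally show ?case .
  qed (use a t c in simp)
  from this[of s] show ?thesis
    using cs a t by (simp add: commutator_eq_one_iff)
qed

end

lemma (in group_hom) carrier_generate_image:
  assumes "h ` carrier G = carrier H" "carrier G = generate G S" "S \<subseteq> carrier G"
  shows "carrier H = generate H (h ` S)"
  using generate_img[OF assms(3)] assms(1,2) by simp

lemma (in normal) group_hom_Mod: "group_hom G (G Mod H) (\<lambda>y. H #> y)"
  using r_coset_hom_Mod factorgroup_is_group is_group by (simp add: group_hom_iff)

lemma (in normal) Mod_eq_one_iff: "g \<in> carrier G \<Longrightarrow> H #> g = H \<longleftrightarrow> g \<in> H"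
  using coset_join1[OF _ _ is_subgroup] rcos_const[OF is_group] by blast

lemma (in normal) Mod_eqD:
  assumes "g \<in> carrier G" "y \<in> carrier G" "H #> g = H #> y"
  obtains c where "c \<in> H" "g = c \<otimes> y"
  using rcos_self[OF assms(1) is_subgroup] assms(3) by (auto simp: r_coset_def)

context baumslag_solitar
begin

lemma relation_pow: "a [^] (m * j) \<otimes> t = t \<otimes> a [^] (n * j)"
proof -
  have "a [^] m = t \<otimes> a [^] n \<otimes> inv t"
    by (simp flip: relation add: m_assoc)
  then have "a [^] (m * j) = t \<otimes> a [^] (n * j) \<otimes> inv t"
    using int_pow_conj[OF t_closed int_pow_closed[OF a_closed], of n j] int_pow_pow[OF a_closed] by metis
  then show ?thesis
    by (simp add: m_assoc)
qed

lemma commutator_pow_m: "commutator G (a [^] (m * j)) t = a [^] ((n - m) * j)"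
proof -
  have "commutator G (a [^] (m * j)) t = a [^] (- (m * j)) \<otimes> inv t \<otimes> (a [^] (m * j) \<otimes> t)"
    by (simp add: commutator_def int_pow_neg m_assoc)
  also have "\<dots> = a [^] (- (m * j)) \<otimes> a [^] (n * j)"
    unfolding relation_pow by (simp add: m_assoc) (simp flip: m_assoc)
  also have "\<dots> = a [^] ((n - m) * j)"
    by (simp add: left_diff_distrib flip: int_pow_mult)
  finally show ?thesis .
qed

text \<open>The m-th power of the element stays in \<gamma>_(k+1), and its commutator with t is
  a^((n - m)^(k+1)) by \<open>commutator_pow_m\<close>, one term further down.\<close>

lemma a_pow_in_lower_central: "a [^] ((n - m) ^ k) \<in> lower_central G (Suc k)"
proof (induction k)
  case (Suc k)
  have "a [^] (m * (n - m) ^ k) \<in> lower_central G (Suc k)"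
    using subgroup_int_pow_closed[OF lower_central_subgroup Suc, of m] by (simp add: int_pow_pow mult.commute)
  then have "commutator G (a [^] (m * (n - m) ^ k)) t \<in> lower_central G (Suc (Suc k))"
    by (intro commutator_in_lower_central) auto
  then show ?case
    unfolding commutator_pow_m by simp
qed simp

lemma ex_a_pow_in_lower_central:
  assumes "n \<noteq> m" "1 \<le> i"
  shows "\<exists>s>0. a [^] (s :: nat) \<in> lower_central G i"
proof -
  obtain k where i: "i = Suc k"
    using assms(2) by (cases i) auto
  define z where "z = (n - m) ^ k"
  have "a [^] z \<in> lower_central G i" "a [^] (- z) \<in> lower_central G i"
    using a_pow_in_lower_central[of k] subgroup.m_inv_closed[OF lower_central_subgroup]
    by (simp_all add: z_def i int_pow_neg)
  moreover have "z \<noteq> 0"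
    using assms(1) by (simp add: z_def)
  ultimately have "a [^] nat \<bar>z\<bar> \<in> lower_central G i" "nat \<bar>z\<bar> > 0"
    by (auto simp: int_pow_int[symmetric] abs_if)
  then show ?thesis
    by blast
qed

text \<open>If [a, t^M] lies in \<gamma>_i, it is central modulo \<gamma>_(i+1), where a has some
  finite order s. Hence [a, t^(M s)] vanishes there by \<open>commutator_pow_eq_one\<close>.\<close>

lemma ex_t_pow_central:
  assumes "n \<noteq> m" "1 \<le> i"
  shows "\<exists>M>0. commutator G a (t [^] (M :: nat)) \<in> lower_central G i"
  using assms(2)
proof (induction i rule: dec_induct)
  case base
  show ?case
    by (intro exI[of _ 1]) simp
next
  case (step i)
  then obtain M where M: "M > 0" "commutator G a (t [^] (M :: nat)) \<in> lower_central G i"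
    by blast
  obtain s where s: "s > 0" "a [^] (s :: nat) \<in> lower_central G (Suc i)"
    using ex_a_pow_in_lower_central[OF assms(1), of "Suc i"] by auto
  interpret L: normal "lower_central G (Suc i)" G
    by (rule lower_central_normal)
  let ?P = "G Mod lower_central G (Suc i)"
  let ?q = "\<lambda>y. lower_central G (Suc i) #> y"
  interpret q: group_hom G ?P ?q
    by (rule L.group_hom_Mod)
  have comm: "?q (commutator G a (t [^] M)) \<otimes>\<^bsub>?P\<^esub> ?q y = ?q y \<otimes>\<^bsub>?P\<^esub> ?q (commutator G a (t [^] M))"
    if y: "y \<in> carrier G" for y
  proof -
    have "commutator G (commutator G a (t [^] M)) y \<in> lower_central G (Suc i)"
      using commutator_in_lower_central[OF step(1) M(2) y] .
    then have "?q (commutator G (commutator G a (t [^] M)) y) = \<one>\<^bsub>?P\<^esub>"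
      using L.Mod_eq_one_iff y by simp
    then have "commutator ?P (?q (commutator G a (t [^] M))) (?q y) = \<one>\<^bsub>?P\<^esub>"
      using q.hom_commutator[of "commutator G a (t [^] M)" y] y by (simp del: one_FactGroup)
    then show ?thesis
      using q.H.commutator_eq_one_iff[OF q.hom_closed[OF commutator_closed[OF a_closed
          nat_pow_closed[OF t_closed]]] q.hom_closed[OF y]] by blast
  qed
  have "?q a [^]\<^bsub>?P\<^esub> s = \<one>\<^bsub>?P\<^esub>"
    using s(2) L.Mod_eq_one_iff[of "a [^] s"] q.hom_nat_pow[of a s] by simp
  then have "commutator ?P (?q a) ((?q (t [^] M)) [^]\<^bsub>?P\<^esub> s) = \<one>\<^bsub>?P\<^esub>"
    using comm[of a] comm[of "t [^] M"] q.hom_commutator[of a "t [^] M"]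
    by (intro q.H.commutator_pow_eq_one) auto
  then have "commutator G a (t [^] (M * s)) \<in> lower_central G (Suc i)"
    using q.hom_commutator[of a "t [^] (M * s)"] q.hom_nat_pow[of "t [^] M" s]
      L.Mod_eq_one_iff[of "commutator G a (t [^] (M * s))"] by (simp add: nat_pow_pow)
  then show ?case
    using M(1) s(1) by (intro exI[of _ "M * s"]) simp
qed

lemma t_exponent_hom:
  obtains \<epsilon> where "\<epsilon> \<in> hom G integer_group" "\<epsilon> a = 0" "\<epsilon> t = 1"
  using universal[of integer_group 0 1] by auto

text \<open>For n = m the power a^d = a^m is central, so \<open>N\<close>, and with it
  \<open>R\<close>, lies in the cyclic group generated by a^m. The exponent sum of a is then a
  homomorphism to Z that is injective on this group and kills \<open>R\<close>.\<close>

lemma R_trivial: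
  assumes "n = m"
  shows "R \<subseteq> {\<one>}"
proof
  fix g assume g: "g \<in> R"
  have dm: "d = m"
    using assms m_pos by (simp add: d_def)
  have central: "a [^] m \<otimes> g = g \<otimes> a [^] m" if "g \<in> carrier G" for g
  proof (rule commutes_generate)
    show "g \<in> generate G {a, t}"
      using that carrier_eq by simp
    have "a [^] m \<otimes> a = a \<otimes> a [^] m"
      using int_pow_mult[of a m 1] int_pow_mult[of a 1 m] by (simp add: add.commute)
    then show "a [^] m \<otimes> s = s \<otimes> a [^] m" if "s \<in> {a, t}" for s
      using that relation assms by auto
  qed auto
  have "{y \<otimes> s \<otimes> inv y | y s. y \<in> carrier G \<and> s \<in> {a [^] d}} \<subseteq> {a [^] m}"
    by (auto simp: dm m_assoc simp flip: central)
  then have "N \<subseteq> generate G {a [^] m}"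
    unfolding N_def normal_closure_def by (rule mono_generate)
  then have "g \<in> generate G {a [^] m}"
    using g R_subset_N by blast
  then obtain j :: int where j: "g = a [^] (m * j)"
    using generate_pow[of "a [^] m"] by (auto simp: int_pow_pow)
  obtain h where h: "h \<in> hom G integer_group" "h a = 1"
    using universal[of integer_group 1 0] assms by auto
  interpret h: group_hom G integer_group h
    using h is_group by (simp add: group_hom_iff)
  have "h g = 0"
    using finite_residual_integer_hom[OF g h(1)] .
  then have "j = 0"
    using m_pos by (simp add: j h.hom_int_pow h(2))
  then show "g \<in> {\<one>}"
    by (simp add: j)
qed

text \<open>Modulo \<open>\<gamma>\<^sub>i\<close> some power of \<open>a\<close> and the commutator of \<open>a\<close> with some power \<open>t\<^sup>M\<close>
  vanish. Hence \<open>t\<^sup>M\<close> is central there and the nilpotent group \<open>G / \<gamma>\<^sub>i \<langle>t\<^sup>M\<rangle>\<close>, being generated by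
  two torsion elements, is finite.\<close>

lemma R_subset_lower_central:
  assumes "1 \<le> i"
  shows "R \<subseteq> lower_central G i"
proof (cases "n = m \<or> i = 1")
  case True
  then show ?thesis
    using R_trivial subgroup.one_closed[OF lower_central_subgroup] finite_residual_subset by auto
next
  case False
  then have i: "2 \<le> i" and nm: "n \<noteq> m"
    using assms by auto
  obtain s where s: "s > 0" "a [^] (s :: nat) \<in> lower_central G i"
    using ex_a_pow_in_lower_central[OF nm assms] by blast
  obtain M where M: "M > 0" "commutator G a (t [^] (M :: nat)) \<in> lower_central G i"
    using ex_t_pow_central[OF nm assms] by blast
  interpret L: normal "lower_central G i" G
    by (rule lower_central_normal)
  let ?P = "G Mod lower_central G i"
  let ?q = "\<lambda>y. lower_central G i #> y"
  interpret q: group_hom G ?P ?q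
    by (rule L.group_hom_Mod)
  have q_surj: "?q ` carrier G = carrier ?P"
    by (simp add: carrier_FactGroup)
  have gen_P: "carrier ?P = generate ?P {?q a, ?q t}"
    using q.carrier_generate_image[OF q_surj carrier_eq] by simp
  define T where "T = ?q (t [^] M)"
  have T: "T \<in> carrier ?P" "T = ?q t [^]\<^bsub>?P\<^esub> M"
    using q.hom_nat_pow[of t M] by (simp_all add: T_def)
  have "?q (commutator G a (t [^] M)) = \<one>\<^bsub>?P\<^esub>"
    using L.Mod_eq_one_iff M(2) by simp
  then have "commutator ?P (?q a) T = \<one>\<^bsub>?P\<^esub>"
    using q.hom_commutator[of a "t [^] M"] by (simp add: T_def del: one_FactGroup)
  then have Ta: "?q a \<otimes>\<^bsub>?P\<^esub> T = T \<otimes>\<^bsub>?P\<^esub> ?q a"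
    using q.H.commutator_eq_one_iff[OF q.hom_closed[OF a_closed] T(1)] by blast
  have Tt: "T \<otimes>\<^bsub>?P\<^esub> ?q t = ?q t \<otimes>\<^bsub>?P\<^esub> T"
    unfolding T(2) using q.H.nat_pow_comm_elem[of "?q t" "?q t" M] by simp
  have T_central: "T \<otimes>\<^bsub>?P\<^esub> y = y \<otimes>\<^bsub>?P\<^esub> T" if "y \<in> carrier ?P" for y
    using q.H.commutes_generate[OF T(1), of "{?q a, ?q t}" y] Ta Tt that gen_P by fastforce
  define Z where "Z = generate ?P {T}"
  have "Z \<lhd> ?P"
    unfolding Z_def
  proof (rule q.H.normal_generateI)
    show "g \<otimes>\<^bsub>?P\<^esub> h \<otimes>\<^bsub>?P\<^esub> inv\<^bsub>?P\<^esub> g \<in> {T}" if "h \<in> {T}" "g \<in> carrier ?P" for h g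
      using that T_central[of g] T(1) q.H.m_assoc[of T g "inv\<^bsub>?P\<^esub> g"] by (simp del: mult_FactGroup one_FactGroup)
  qed (use T in auto)
  then interpret Z: normal Z ?P .
  let ?Q = "?P Mod Z"
  let ?r = "\<lambda>y. Z #>\<^bsub>?P\<^esub> ?q y"
  interpret r': group_hom ?P ?Q "\<lambda>y. Z #>\<^bsub>?P\<^esub> y"
    by (rule Z.group_hom_Mod)
  have "?r \<in> hom G ?Q"
    using Group.hom_compose[OF q.homh r'.homh] by (simp add: comp_def)
  then interpret r: group_hom G ?Q ?r
    using is_group r'.H.is_group by (simp add: group_hom_iff)
  have r_surj: "?r ` carrier G = carrier ?Q"
    unfolding carrier_FactGroup[of ?P] q_surj[symmetric] image_image by (rule refl)
  have "lower_central ?Q i = {\<one>\<^bsub>?Q\<^esub>}"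
  proof -
    have "?r y = \<one>\<^bsub>?Q\<^esub>" if "y \<in> lower_central G i" for y
      using that L.Mod_eq_one_iff[of y] lower_central_subset[of i] r'.hom_one by auto
    then have "?r ` lower_central G i \<subseteq> {\<one>\<^bsub>?Q\<^esub>}"
      by blast
    then have "lower_central ?Q i \<subseteq> {\<one>\<^bsub>?Q\<^esub>}"
      using r.lower_central_image_surj[OF r_surj assms] by simp
    then show ?thesis
      using subgroup.one_closed[OF r'.H.lower_central_subgroup[of i]] by blast
  qed
  moreover have "finite (carrier (?Q Mod lower_central ?Q i))"
  proof (rule r'.H.finite_lower_central_quotient[of "?r a" "?r t" s M])
    show "carrier ?Q = generate ?Q {?r a, ?r t}"
      using r.carrier_generate_image[OF r_surj carrier_eq] by simp
    have "?q (a [^] s) = \<one>\<^bsub>?P\<^esub>"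
      using L.Mod_eq_one_iff[of "a [^] s"] s(2) by simp
    then have "?r (a [^] s) = \<one>\<^bsub>?Q\<^esub>"
      using r'.hom_one by simp
    then show "?r a [^]\<^bsub>?Q\<^esub> s = \<one>\<^bsub>?Q\<^esub>"
      using r.hom_nat_pow[of a s] by simp
    have "T \<in> Z"
      unfolding Z_def by (simp add: generate.incl)
    then have "?r (t [^] M) = \<one>\<^bsub>?Q\<^esub>"
      using Z.Mod_eq_one_iff[OF T(1)] by (simp add: T_def)
    then show "?r t [^]\<^bsub>?Q\<^esub> M = \<one>\<^bsub>?Q\<^esub>"
      using r.hom_nat_pow[of t M] by simp
  qed (use s M assms in auto)
  ultimately have "finite (rcosets\<^bsub>?Q\<^esub> {\<one>\<^bsub>?Q\<^esub>})"
    by (simp add: FactGroup_def)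
  then have finQ: "finite (carrier ?Q)"
    using r'.H.finite_of_finite_quotient[OF r'.H.triv_subgroup] by simp
  \<comment> \<open>Triviality in \<open>?Q\<close> leaves a power (t^M)^j undetermined modulo
    \<gamma>_i. The exponent sum \<epsilon> of t vanishes on \<open>R\<close> and on \<gamma>_2,
    which contains \<gamma>_i because i >= 2, and this forces j = 0.\<close>
  obtain \<epsilon> where \<epsilon>: "\<epsilon> \<in> hom G integer_group" "\<epsilon> t = 1"
    using t_exponent_hom by metis
  interpret \<epsilon>: group_hom G integer_group \<epsilon>
    using \<epsilon> is_group by (simp add: group_hom_iff)
  show ?thesis
  proof
    fix g assume g: "g \<in> R"
    then have gc: "g \<in> carrier G"
      using finite_residual_subset by blast
    have "?r g = \<one>\<^bsub>?Q\<^esub>"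
      using finite_residual_hom[OF g r'.H.is_group finQ r.homh] .
    then have "?q g \<in> Z"
      using Z.Mod_eq_one_iff[OF q.hom_closed[OF gc]] by simp
    then obtain j :: int where "?q g = T [^]\<^bsub>?P\<^esub> j"
      using q.H.generate_pow[OF T(1)] unfolding Z_def by blast
    then have "?q g = ?q ((t [^] M) [^] j)"
      using q.hom_int_pow[of "t [^] M" j] by (simp add: T_def)
    then obtain c where c: "c \<in> lower_central G i" "g = c \<otimes> (t [^] M) [^] j"
      by (rule L.Mod_eqD[OF gc int_pow_closed[OF nat_pow_closed[OF t_closed]]])
    have "c \<in> lower_central G 2"
      using c(1) lower_central_decreasing[of 2 i] i by auto
    then have "\<epsilon> c = 0"
      using \<epsilon>.lower_central_2_kernel[OF abelian_integer_group] by (auto simp: kernel_def)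
    moreover have "\<epsilon> g = 0"
      using finite_residual_integer_hom[OF g \<epsilon>(1)] .
    moreover have "\<epsilon> ((t [^] M) [^] j) = j * int M"
      by (simp add: \<epsilon>.hom_int_pow \<epsilon>.hom_nat_pow \<epsilon>(2))
    ultimately have "j = 0"
      using c M(1) L.subset \<epsilon>.hom_mult[of c "(t [^] M) [^] j"] by auto
    then show "g \<in> lower_central G i"
      using c L.subset by auto
  qed
qed

lemma R_subset_lower_central_omega: "R \<subseteq> lower_central_omega G"
  unfolding lower_central_omega_def using R_subset_lower_central by blast

end

section \<open>Abelian quotients\<close>

context baumslag_solitar
begin

abbreviation D :: "bs_letter word set set set" where
  "D \<equiv> lower_central G 2"

lemma D_normal: "D \<lhd> G"
  by (rule lower_central_normal)

sublocale Mod_D: group_hom G "G Mod D" "\<lambda>y. D #> y"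
  using normal.group_hom_Mod[OF D_normal] .

lemma Mod_D_comm:
  assumes "g \<in> carrier G" "y \<in> carrier G"
  shows "D #> (g \<otimes> y) = D #> (y \<otimes> g)"
proof -
  have "commutator G g y \<in> lower_central G (Suc 1)"
    using assms by (intro commutator_in_lower_central) auto
  then have "D #> commutator G g y = \<one>\<^bsub>G Mod D\<^esub>"
    using normal.Mod_eq_one_iff[OF D_normal, of "commutator G g y"] assms by (simp add: numeral_2_eq_2)
  moreover have "D #> (g \<otimes> y) = (D #> (y \<otimes> g)) \<otimes>\<^bsub>G Mod D\<^esub> (D #> commutator G g y)"
    using Mod_D.hom_mult[of "y \<otimes> g" "commutator G g y"] mult_commutator[OF assms] assms by simp
  ultimately show ?thesis
    using assms by (simp del: one_FactGroup mult_FactGroup)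
qed

lemma Mod_D_form:
  assumes "g \<in> carrier G"
  shows "\<exists>(k :: int) (l :: int). D #> g = D #> (t [^] k \<otimes> a [^] l)"
proof -
  have a_step: "D #> (a [^] j \<otimes> g) = D #> (t [^] k \<otimes> a [^] (l + j))"
    if "g \<in> carrier G" "D #> g = D #> (t [^] k \<otimes> a [^] l)" for g and j k l :: int
  proof -
    have "D #> (a [^] j \<otimes> g) = D #> (a [^] j \<otimes> (t [^] k \<otimes> a [^] l))"
      using that Mod_D.hom_mult[of "a [^] j" g] Mod_D.hom_mult[of "a [^] j" "t [^] k \<otimes> a [^] l"] by simp
    also have "\<dots> = D #> ((t [^] k \<otimes> a [^] l) \<otimes> a [^] j)"
      by (rule Mod_D_comm) auto
    finally show ?thesis
      by (simp add: m_assoc int_pow_mult)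
  qed
  have t_step: "D #> (t [^] j \<otimes> g) = D #> (t [^] (j + k) \<otimes> a [^] l)"
    if "g \<in> carrier G" "D #> g = D #> (t [^] k \<otimes> a [^] l)" for g and j k l :: int
  proof -
    have "D #> (t [^] j \<otimes> g) = D #> (t [^] j \<otimes> (t [^] k \<otimes> a [^] l))"
      using that Mod_D.hom_mult[of "t [^] j" g] Mod_D.hom_mult[of "t [^] j" "t [^] k \<otimes> a [^] l"] by simp
    then show ?thesis
      by (simp add: int_pow_mult m_assoc)
  qed
  have inv_eq: "inv a = a [^] (- 1 :: int)" "inv t = t [^] (- 1 :: int)"
    by (simp_all add: int_pow_neg)
  show ?thesis
    using assms
  proof (induction g rule: induct)
    case one
    show ?case
      by (intro exI[of _ 0]) simp
  next
    case (a g)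
    then show ?case
      using a_step[of g _ _ 1] int_pow_1[OF a_closed] by metis
  next
    case (inv_a g)
    then show ?case
      using a_step[of g _ _ "- 1"] unfolding inv_eq by metis
  next
    case (t g)
    then show ?case
      using t_step[of g _ _ 1] int_pow_1[OF t_closed] by metis
  next
    case (inv_t g)
    then show ?case
      using t_step[of g _ _ "- 1"] unfolding inv_eq by metis
  qed
qed

lemma ex_D_form:
  assumes "g \<in> carrier G"
  obtains c and k l :: int where "c \<in> D" "g = c \<otimes> (t [^] k \<otimes> a [^] l)"
proof -
  obtain k l :: int where "D #> g = D #> (t [^] k \<otimes> a [^] l)"
    using Mod_D_form[OF assms] by blast
  then show thesis
    using normal.Mod_eqD[OF D_normal assms] that by (metis a_closed int_pow_closed m_closed t_closed)
qed

section \<open>Homomorphisms onto Z x Z_e and their kernels\<close>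

lemma a_exponent_hom:
  assumes "0 < e" "e dvd n - m"
  obtains \<delta> where "\<delta> \<in> hom G (integer_mod_group (nat e))" "\<delta> a = 1 mod e" "\<delta> t = 0"
proof -
  have "(m * (1 mod e)) mod e = (n * (1 mod e)) mod e"
    using assms(2) by (metis mod_eq_dvd_iff mod_mult_right_eq mult.right_neutral)
  then show thesis
    using universal[of "integer_mod_group (nat e)" "1 mod e" 0] assms that
    by (auto simp: carrier_integer_mod_group int_pow_integer_mod_group)
qed

text \<open>A choice operator fixes one map, as the universal property only yields existence. It
  serves for e = n - m > 0, where the kernel is \<open>D\<close>, and for e = d, where it is the
  product of \<open>D\<close> and \<open>N\<close>. Writing \<open>1 mod e\<close> covers e = 1,
  where Z_e consists of 0 alone.\<close>

definition abelian_hom :: "int \<Rightarrow> bs_letter word set set \<Rightarrow> int \<times> int" where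
  "abelian_hom e = (SOME h. h \<in> hom G (integer_group \<times>\<times> integer_mod_group (nat e)) \<and>
     h a = (0, 1 mod e) \<and> h t = (1, 0))"

context
  fixes e :: int
  assumes e: "0 < e" "e dvd n - m"
begin

lemma abelian_hom:
  "abelian_hom e \<in> hom G (integer_group \<times>\<times> integer_mod_group (nat e))"
  "abelian_hom e a = (0, 1 mod e)" "abelian_hom e t = (1, 0)"
proof -
  obtain \<epsilon> where \<epsilon>: "\<epsilon> \<in> hom G integer_group" "\<epsilon> a = 0" "\<epsilon> t = 1"
    using t_exponent_hom by blast
  obtain \<delta> where \<delta>: "\<delta> \<in> hom G (integer_mod_group (nat e))" "\<delta> a = 1 mod e" "\<delta> t = 0"
    using a_exponent_hom[OF e] by blast
  have "\<exists>h. h \<in> hom G (integer_group \<times>\<times> integer_mod_group (nat e)) \<and>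
     h a = (0, 1 mod e) \<and> h t = (1, 0)"
    by (rule exI[of _ "\<lambda>x. (\<epsilon> x, \<delta> x)"]) (use \<epsilon> \<delta> in \<open>simp add: hom_paired\<close>)
  then have "abelian_hom e \<in> hom G (integer_group \<times>\<times> integer_mod_group (nat e)) \<and>
     abelian_hom e a = (0, 1 mod e) \<and> abelian_hom e t = (1, 0)"
    unfolding abelian_hom_def by (rule someI_ex)
  then show "abelian_hom e \<in> hom G (integer_group \<times>\<times> integer_mod_group (nat e))"
    "abelian_hom e a = (0, 1 mod e)" "abelian_hom e t = (1, 0)"
    by auto
qed

lemma group_hom_abelian_hom:
  "group_hom G (integer_group \<times>\<times> integer_mod_group (nat e)) (abelian_hom e)"
  using abelian_hom(1) is_group by (simp add: group_hom_iff DirProd_group)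

lemma fst_abelian_hom: "(\<lambda>x. fst (abelian_hom e x)) \<in> hom G integer_group"
  and snd_abelian_hom: "(\<lambda>x. snd (abelian_hom e x)) \<in> hom G (integer_mod_group (nat e))"
  using abelian_hom(1) by (auto simp: hom_def Pi_iff mult_DirProd' mem_Times_iff)

lemma abelian_hom_t_a: "abelian_hom e (t [^] (k :: int) \<otimes> a [^] (l :: int)) = (k, l mod e)"
proof -
  interpret f: group_hom G integer_group "\<lambda>x. fst (abelian_hom e x)"
    using fst_abelian_hom is_group by (simp add: group_hom_iff)
  interpret s: group_hom G "integer_mod_group (nat e)" "\<lambda>x. snd (abelian_hom e x)"
    using snd_abelian_hom is_group by (simp add: group_hom_iff)
  have "fst (abelian_hom e (t [^] k \<otimes> a [^] l)) = k"
    by (simp add: f.hom_int_pow abelian_hom(2,3))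
  moreover have "snd (abelian_hom e (t [^] k \<otimes> a [^] l)) = l mod e"
    using e by (simp add: s.hom_int_pow abelian_hom(2,3) int_pow_integer_mod_group mod_mult_right_eq)
  ultimately show ?thesis
    by (simp add: prod_eq_iff)
qed

lemma D_subset_kernel: "c \<in> D \<Longrightarrow> abelian_hom e c = (0, 0)"
proof -
  interpret ab: group_hom G "integer_group \<times>\<times> integer_mod_group (nat e)" "abelian_hom e"
    by (rule group_hom_abelian_hom)
  have "comm_group (integer_group \<times>\<times> integer_mod_group (nat e))"
    by (rule group.group_comm_groupI[OF ab.H.is_group]) (auto simp: add.commute)
  then show "c \<in> D \<Longrightarrow> abelian_hom e c = (0, 0)"
    using ab.lower_central_2_kernel by (auto simp: kernel_def)
qed

lemma abelian_hom_D_form: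
  assumes "c \<in> D"
  shows "abelian_hom e (c \<otimes> (t [^] (k :: int) \<otimes> a [^] (l :: int))) = (k, l mod e)"
proof -
  interpret ab: group_hom G "integer_group \<times>\<times> integer_mod_group (nat e)" "abelian_hom e"
    by (rule group_hom_abelian_hom)
  have "c \<in> carrier G"
    using assms lower_central_subset by blast
  then show ?thesis
    using D_subset_kernel[OF assms] abelian_hom_t_a[of k l] by simp
qed

lemma abelian_hom_surj:
  "abelian_hom e ` carrier G = carrier (integer_group \<times>\<times> integer_mod_group (nat e))"
proof
  show "abelian_hom e ` carrier G \<subseteq> carrier (integer_group \<times>\<times> integer_mod_group (nat e))"
    using abelian_hom(1) by (rule hom_carrier)
  show "carrier (integer_group \<times>\<times> integer_mod_group (nat e)) \<subseteq> abelian_hom e ` carrier G"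
  proof
    fix p assume "p \<in> carrier (integer_group \<times>\<times> integer_mod_group (nat e))"
    then have "p = abelian_hom e (t [^] fst p \<otimes> a [^] snd p)"
      using e by (auto simp: abelian_hom_t_a carrier_integer_mod_group)
    then show "p \<in> abelian_hom e ` carrier G"
      by (rule image_eqI) auto
  qed
qed

lemma kernel_abelian_hom:
  assumes S: "subgroup S G" "D \<subseteq> S" and a: "a [^] e \<in> S"
    and g: "g \<in> carrier G" "abelian_hom e g = (0, 0)"
  shows "g \<in> S"
proof -
  obtain c and k l :: int where ckl: "c \<in> D" "g = c \<otimes> (t [^] k \<otimes> a [^] l)"
    using ex_D_form[OF g(1)] by blast
  then have "k = 0" "e dvd l"
    using g(2) abelian_hom_D_form[of c k l] by auto
  then obtain j where "l = e * j"
    by (elim dvdE)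
  then have "a [^] l \<in> S"
    using subgroup_int_pow_closed[OF S(1) a, of j] by (simp add: int_pow_pow)
  then show ?thesis
    using ckl S \<open>k = 0\<close> subgroup.m_closed[OF S(1)] by auto
qed

end

lemma D_eq_kernel:
  assumes "n > m"
  shows "kernel G (integer_group \<times>\<times> integer_mod_group (nat (n - m))) (abelian_hom (n - m)) = D"
proof -
  have e: "0 < n - m" "n - m dvd n - m"
    using assms by auto
  have "a [^] (n - m) \<in> D"
    using a_pow_in_lower_central[of 1] by (simp add: numeral_2_eq_2)
  then have "g \<in> D" if "g \<in> carrier G" "abelian_hom (n - m) g = (0, 0)" for g
    using kernel_abelian_hom[OF e lower_central_subgroup subset_refl _ that] by blast
  then show ?thesis
    using D_subset_kernel[OF e] lower_central_subset by (auto simp: kernel_def)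
qed

lemma d_dvd_diff: "d dvd n - m"
  using d_dvd_m d_dvd_n by (rule dvd_diff[rotated])

lemma N_subset_kernel:
  assumes "g \<in> N"
  shows "abelian_hom d g = (0, 0)"
proof -
  interpret ab: group_hom G "integer_group \<times>\<times> integer_mod_group (nat d)" "abelian_hom d"
    by (rule group_hom_abelian_hom[OF d_pos d_dvd_diff])
  have "abelian_hom d (a [^] d) = (0, 0)"
    using abelian_hom_t_a[OF d_pos d_dvd_diff, of 0 d] by simp
  then show ?thesis
    using N_kernel[OF ab.H.is_group ab.homh _ assms] by (simp add: ab.hom_int_pow)
qed

text \<open>Every element is c t^k a^l with c in \<open>D\<close>. Lying in the kernel forces k = 0
  and d | l, so that a^l is in \<open>N\<close>. Being a kernel, the product of the two subgroups is
  a normal subgroup at once.\<close>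

lemma D_N_eq_kernel:
  "kernel G (integer_group \<times>\<times> integer_mod_group (nat d)) (abelian_hom d) = D <#> N"
proof
  interpret ab: group_hom G "integer_group \<times>\<times> integer_mod_group (nat d)" "abelian_hom d"
    by (rule group_hom_abelian_hom[OF d_pos d_dvd_diff])
  show "D <#> N \<subseteq> kernel G (integer_group \<times>\<times> integer_mod_group (nat d)) (abelian_hom d)"
    using D_subset_kernel[OF d_pos d_dvd_diff] N_subset_kernel
    by (auto simp: set_mult_def kernel_def subsetD[OF lower_central_subset] subsetD[OF N_subset])
  show "kernel G (integer_group \<times>\<times> integer_mod_group (nat d)) (abelian_hom d) \<subseteq> D <#> N"
  proof
    fix g assume "g \<in> kernel G (integer_group \<times>\<times> integer_mod_group (nat d)) (abelian_hom d)"
    then have g: "g \<in> carrier G" "abelian_hom d g = (0, 0)"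
      by (auto simp: kernel_def)
    obtain c and k l :: int where ckl: "c \<in> D" "g = c \<otimes> (t [^] k \<otimes> a [^] l)"
      using ex_D_form[OF g(1)] by blast
    then have "k = 0" "d dvd l"
      using g(2) abelian_hom_D_form[OF d_pos d_dvd_diff, of c k l] by auto
    then show "g \<in> D <#> N"
      using ckl a_pow_in_N by (auto simp: set_mult_def)
  qed
qed

lemma subgroup_D_N: "subgroup (D <#> N) G" and normal_D_N: "D <#> N \<lhd> G"
  using group_hom.normal_kernel[OF group_hom_abelian_hom[OF d_pos d_dvd_diff]] normal_imp_subgroup
  unfolding D_N_eq_kernel by blast+

lemma N_subset_D_N: "N \<subseteq> D <#> N"
  using subgroup.one_closed[OF lower_central_subgroup] N_subset unfolding set_mult_def by force

lemma Mod_D_N_iso: "G Mod (D <#> N) \<cong> integer_group \<times>\<times> integer_mod_group (nat d)"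
  using group_hom.FactGroup_iso[OF group_hom_abelian_hom[OF d_pos d_dvd_diff]
      abelian_hom_surj[OF d_pos d_dvd_diff]] by (simp add: D_N_eq_kernel)

lemma Mod_D_iso:
  assumes "n > m"
  shows "G Mod D \<cong> integer_group \<times>\<times> integer_mod_group (nat (n - m))"
  using group_hom.FactGroup_iso[OF group_hom_abelian_hom abelian_hom_surj, of "n - m"] assms
  by (simp add: D_eq_kernel)

text \<open>For d = 1 the class of a modulo \<open>N\<close> is trivial, so the projection to G / N
  and the map g -> (N t)^(\<epsilon> g) agree on a and t, hence everywhere. An element with
  \<epsilon> g = 0 is then trivial modulo \<open>N\<close>.\<close>

lemma N_eq_kernel:
  assumes "d = 1" and \<epsilon>: "\<epsilon> \<in> hom G integer_group" "\<epsilon> a = 0" "\<epsilon> t = 1"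
  shows "kernel G integer_group \<epsilon> = N"
proof
  interpret \<epsilon>: group_hom G integer_group \<epsilon>
    using \<epsilon> is_group by (simp add: group_hom_iff)
  show "N \<subseteq> kernel G integer_group \<epsilon>"
    using N_kernel[OF group_integer_group \<epsilon>(1)] \<epsilon>(2) N_subset by (auto simp: kernel_def)
  show "kernel G integer_group \<epsilon> \<subseteq> N"
  proof
    fix g assume "g \<in> kernel G integer_group \<epsilon>"
    then have g: "g \<in> carrier G" "\<epsilon> g = 0"
      by (auto simp: kernel_def)
    have "(\<lambda>y. (N #> t) [^]\<^bsub>G Mod N\<^esub> \<epsilon> y) \<in> hom G (G Mod N)"
      using Group.hom_compose[OF \<epsilon>(1) Mod_N.H.hom_integer_group_pow[of "N #> t"]] by (simp add: comp_def)
    moreover have "N #> a = N"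
      using Mod_N_eq_one_iff[OF a_closed] a_pow_d_in_N assms(1) by simp
    ultimately have "N #> g = (N #> t) [^]\<^bsub>G Mod N\<^esub> \<epsilon> g"
      using g(1) \<epsilon>(2,3) carrier_eq
      by (intro hom_eq_on_generate[OF is_group group_Mod_N hom_Mod_N, of _ "{a, t}" g]) auto
    then show "g \<in> N"
      using Mod_N_eq_one_iff[OF g(1)] g(2) by simp
  qed
qed

lemma D_subset_N:
  assumes "d = 1"
  shows "D \<subseteq> N"
proof -
  obtain \<epsilon> where \<epsilon>: "\<epsilon> \<in> hom G integer_group" "\<epsilon> a = 0" "\<epsilon> t = 1"
    using t_exponent_hom by blast
  interpret \<epsilon>: group_hom G integer_group \<epsilon>
    using \<epsilon> is_group by (simp add: group_hom_iff)
  show ?thesis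
    using \<epsilon>.lower_central_2_kernel[OF abelian_integer_group] N_eq_kernel[OF assms \<epsilon>] by simp
qed

lemma Mod_N_iso_integer:
  assumes "d = 1"
  shows "G Mod N \<cong> integer_group"
proof -
  obtain \<epsilon> where \<epsilon>: "\<epsilon> \<in> hom G integer_group" "\<epsilon> a = 0" "\<epsilon> t = 1"
    using t_exponent_hom by blast
  interpret \<epsilon>: group_hom G integer_group \<epsilon>
    using \<epsilon> is_group by (simp add: group_hom_iff)
  have "k \<in> \<epsilon> ` carrier G" for k
    by (rule image_eqI[of _ _ "t [^] k"]) (simp_all add: \<epsilon>.hom_int_pow \<epsilon>(3))
  then have "\<epsilon> ` carrier G = carrier integer_group"
    by auto
  then show ?thesis
    using \<epsilon>.FactGroup_iso N_eq_kernel[OF assms \<epsilon>] by simp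
qed

lemma a_notin_D:
  assumes "n - m > 1"
  shows "a \<notin> D"
proof
  have e: "0 < n - m" "n - m dvd n - m"
    using assms by auto
  assume "a \<in> D"
  then show False
    using D_subset_kernel[OF e] abelian_hom(2)[OF e] assms by simp
qed

text \<open>The Z-component of \<open>abelian_hom (n - m)\<close> vanishes on \<open>N\<close>, so
  there its second component alone has kernel \<open>D\<close>. It is onto because d = 1 puts all
  powers of a into \<open>N\<close>.\<close>

lemma N_Mod_D_iso:
  assumes "d = 1" "n > m"
  shows "G\<lparr>carrier := N\<rparr> Mod D \<cong> integer_mod_group (nat (n - m))"
proof -
  have e: "0 < n - m" "n - m dvd n - m"
    using assms by auto
  define \<delta> where "\<delta> x = snd (abelian_hom (n - m) x)" for x
  interpret \<delta>: group_hom G "integer_mod_group (nat (n - m))" \<delta>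
    using snd_abelian_hom[OF e] is_group by (simp add: group_hom_iff \<delta>_def[abs_def])
  have \<delta>N: "group_hom (G\<lparr>carrier := N\<rparr>) (integer_mod_group (nat (n - m))) \<delta>"
    using \<delta>.hom_mult[OF subsetD[OF N_subset] subsetD[OF N_subset]]
      \<delta>.hom_closed[OF subsetD[OF N_subset]] subgroup_imp_group[OF N_subgroup]
    by (auto simp: group_hom_iff intro!: homI)
  have a: "a [^] k \<in> N" for k :: int
    using a_pow_in_N assms(1) by simp
  have "\<delta> ` N = carrier (integer_mod_group (nat (n - m)))"
  proof
    show "\<delta> ` N \<subseteq> carrier (integer_mod_group (nat (n - m)))"
      using N_subset by auto
    show "carrier (integer_mod_group (nat (n - m))) \<subseteq> \<delta> ` N"
    proof
      fix k assume "k \<in> carrier (integer_mod_group (nat (n - m)))"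
      then have "k = \<delta> (a [^] k)"
        using abelian_hom_t_a[OF e, of 0 k] e by (simp add: \<delta>_def carrier_integer_mod_group)
      then show "k \<in> \<delta> ` N"
        using a by (rule image_eqI)
    qed
  qed
  moreover have "kernel (G\<lparr>carrier := N\<rparr>) (integer_mod_group (nat (n - m))) \<delta> = D"
  proof -
    have "fst (abelian_hom (n - m) g) = 0" if g: "g \<in> N" for g
      using N_kernel[OF group_integer_group fst_abelian_hom[OF e] _ g] abelian_hom(2)[OF e] by simp
    then have "kernel (G\<lparr>carrier := N\<rparr>) (integer_mod_group (nat (n - m))) \<delta>
        = N \<inter> kernel G (integer_group \<times>\<times> integer_mod_group (nat (n - m))) (abelian_hom (n - m))"
      using N_subset by (auto simp: kernel_def \<delta>_def prod_eq_iff)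
    then show ?thesis
      using D_eq_kernel[OF assms(2)] D_subset_N[OF assms(1)] by auto
  qed
  ultimately show ?thesis
    using group_hom.FactGroup_iso[OF \<delta>N] by simp
qed

section \<open>The case n = m + d\<close>

lemma N_subset_D:
  assumes "n = m + d"
  shows "N \<subseteq> D"
  unfolding N_def using a_pow_in_lower_central[of 1] assms
  by (intro normal_closure_minimal D_normal) (simp add: numeral_2_eq_2)

lemma N_eq_D:
  assumes "d = 1" "n = m + 1"
  shows "N = D"
  using N_subset_D D_subset_N assms by auto

text \<open>Here n - m = 1, so the powers (n - m)^k are all 1 and a itself lies in every term of the
  series.\<close>

lemma N_eq_lower_central_omega:
  assumes "d = 1" "n = m + 1"
  shows "N = lower_central_omega G"
proof
  show "lower_central_omega G \<subseteq> N"
    using lower_central_omega_subset[of 2] N_eq_D[OF assms] by simp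
  have "N \<subseteq> lower_central G (Suc k)" for k
    unfolding N_def using a_pow_in_lower_central[of k] assms
    by (intro normal_closure_minimal lower_central_normal) simp
  then have "N \<subseteq> lower_central G i" if "1 \<le> i" for i
    using that by (cases i) auto
  then show "N \<subseteq> lower_central_omega G"
    unfolding lower_central_omega_def by auto
qed

end

section \<open>The free product\<close>

lemma free_product_relators_closed:
  assumes "group K" "group L"
  shows "free_product_relators K L \<subseteq> carrier (free_group (carrier K <+> carrier L))"
proof -
  let ?X = "carrier K <+> carrier L"
  interpret K: group K by fact
  interpret L: group L by fact
  interpret F: group "free_group ?X" by (rule group_free_group)
  have "free_gen ?X (Inl y) \<in> carrier (free_group ?X)" if "y \<in> carrier K" for y
    using that by (intro free_gen_closed) auto
  moreover have "free_gen ?X (Inr y) \<in> carrier (free_group ?X)" if "y \<in> carrier L" for y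
    using that by (intro free_gen_closed) auto
  ultimately show ?thesis
    unfolding free_product_relators_def Let_def by auto
qed

definition free_product_gen ::
    "('a, 'c) monoid_scheme \<Rightarrow> ('b, 'd) monoid_scheme \<Rightarrow> 'a + 'b \<Rightarrow> ('a + 'b) word set set" where
  "free_product_gen K L = presented_gen (carrier K <+> carrier L) (free_product_relators K L)"

context
  fixes K :: "('a, 'c) monoid_scheme" and L :: "('b, 'd) monoid_scheme"
  assumes K: "group K" and L: "group L"
begin

lemma group_free_product: "group (free_product K L)"
  unfolding free_product_def by (rule group_presented_group[OF free_product_relators_closed[OF K L]])

lemma free_product_gen_closed:
  "y \<in> carrier K <+> carrier L \<Longrightarrow> free_product_gen K L y \<in> carrier (free_product K L)"
  unfolding free_product_def free_product_gen_def
  by (rule presented_gen_closed[OF free_product_relators_closed[OF K L]])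

lemma carrier_free_product:
  "carrier (free_product K L)
    = generate (free_product K L) (free_product_gen K L ` (carrier K <+> carrier L))"
  unfolding free_product_def free_product_gen_def
  by (rule carrier_presented_group[OF free_product_relators_closed[OF K L]])

lemma free_product_relation:
  assumes "x \<in> carrier K <+> carrier L" "y \<in> carrier K <+> carrier L" "z \<in> carrier K <+> carrier L"
    and rel: "free_gen (carrier K <+> carrier L) x \<otimes>\<^bsub>free_group (carrier K <+> carrier L)\<^esub>
      free_gen (carrier K <+> carrier L) y \<otimes>\<^bsub>free_group (carrier K <+> carrier L)\<^esub>
      inv\<^bsub>free_group (carrier K <+> carrier L)\<^esub> free_gen (carrier K <+> carrier L) z
      \<in> free_product_relators K L"
  shows "free_product_gen K L z
    = free_product_gen K L x \<otimes>\<^bsub>free_product K L\<^esub> free_product_gen K L y"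
proof -
  let ?X = "carrier K <+> carrier L"
  let ?S = "free_product_relators K L"
  let ?q = "\<lambda>x. normal_closure (free_group ?X) ?S #>\<^bsub>free_group ?X\<^esub> x"
  interpret q: group_hom "free_group ?X" "free_product K L" ?q
    using group_free_group group_free_product presented_hom[OF free_product_relators_closed[OF K L]]
    by (simp add: group_hom_iff free_product_def)
  have gen: "free_product_gen K L w = ?q (free_gen ?X w)" for w
    by (simp add: free_product_gen_def presented_gen_def)
  have closed: "free_gen ?X x \<in> carrier (free_group ?X)" "free_gen ?X y \<in> carrier (free_group ?X)"
    "free_gen ?X z \<in> carrier (free_group ?X)"
    by (rule free_gen_closed[OF assms(1)] free_gen_closed[OF assms(2)] free_gen_closed[OF assms(3)])+
  have "?q (free_gen ?X x \<otimes>\<^bsub>free_group ?X\<^esub> free_gen ?X y \<otimes>\<^bsub>free_group ?X\<^esub> inv\<^bsub>free_group ?X\<^esub> free_gen ?X z)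
      = \<one>\<^bsub>free_product K L\<^esub>"
    using presented_relator[OF free_product_relators_closed[OF K L] rel] by (simp add: free_product_def)
  then have "?q (free_gen ?X x) \<otimes>\<^bsub>free_product K L\<^esub> ?q (free_gen ?X y)
      \<otimes>\<^bsub>free_product K L\<^esub> inv\<^bsub>free_product K L\<^esub> ?q (free_gen ?X z) = \<one>\<^bsub>free_product K L\<^esub>"
    using closed by simp
  then show ?thesis
    unfolding gen using closed
      q.H.inv_equality[of "?q (free_gen ?X x) \<otimes>\<^bsub>free_product K L\<^esub> ?q (free_gen ?X y)"
        "inv\<^bsub>free_product K L\<^esub> ?q (free_gen ?X z)"] by simp
qed

lemma free_product_Inl_hom: "(\<lambda>x. free_product_gen K L (Inl x)) \<in> hom K (free_product K L)"
proof (rule homI)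
  fix x y assume "x \<in> carrier K" "y \<in> carrier K"
  moreover have "x \<otimes>\<^bsub>K\<^esub> y \<in> carrier K"
    using calculation K by (simp add: group.is_monoid monoid.m_closed)
  ultimately show "free_product_gen K L (Inl (x \<otimes>\<^bsub>K\<^esub> y))
      = free_product_gen K L (Inl x) \<otimes>\<^bsub>free_product K L\<^esub> free_product_gen K L (Inl y)"
    by (intro free_product_relation) (auto simp: free_product_relators_def Let_def)
qed (auto intro: free_product_gen_closed)

lemma free_product_Inr_hom: "(\<lambda>x. free_product_gen K L (Inr x)) \<in> hom L (free_product K L)"
proof (rule homI)
  fix x y assume "x \<in> carrier L" "y \<in> carrier L"
  moreover have "x \<otimes>\<^bsub>L\<^esub> y \<in> carrier L"
    using calculation L by (simp add: group.is_monoid monoid.m_closed)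
  ultimately show "free_product_gen K L (Inr (x \<otimes>\<^bsub>L\<^esub> y))
      = free_product_gen K L (Inr x) \<otimes>\<^bsub>free_product K L\<^esub> free_product_gen K L (Inr y)"
    by (intro free_product_relation) (auto simp: free_product_relators_def Let_def)
qed (auto intro: free_product_gen_closed)

lemma free_product_universal:
  assumes H: "group H" and f: "f \<in> hom K H" and g: "g \<in> hom L H"
  obtains h where "h \<in> hom (free_product K L) H"
    "\<And>x. x \<in> carrier K \<Longrightarrow> h (free_product_gen K L (Inl x)) = f x"
    "\<And>x. x \<in> carrier L \<Longrightarrow> h (free_product_gen K L (Inr x)) = g x"
proof -
  let ?X = "carrier K <+> carrier L"
  interpret H: group H by fact
  have fg: "case_sum f g \<in> ?X \<rightarrow> carrier H"
    using f g by (auto simp: hom_def)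
  have "h s = \<one>\<^bsub>H\<^esub>"
    if h: "h \<in> hom (free_group ?X) H" "\<And>x. x \<in> ?X \<Longrightarrow> h (free_gen ?X x) = case_sum f g x"
      and s: "s \<in> free_product_relators K L" for h s
  proof -
    interpret h: group_hom "free_group ?X" H h
      using h H group_free_group by (simp add: group_hom_iff)
    have key: "h (free_gen ?X x \<otimes>\<^bsub>free_group ?X\<^esub> free_gen ?X y \<otimes>\<^bsub>free_group ?X\<^esub> inv\<^bsub>free_group ?X\<^esub> free_gen ?X z)
        = \<one>\<^bsub>H\<^esub>"
      if "x \<in> ?X" "y \<in> ?X" "z \<in> ?X" "case_sum f g x \<otimes>\<^bsub>H\<^esub> case_sum f g y = case_sum f g z" for x y z
    proof -
      have "case_sum f g z \<in> carrier H"
        using fg that(3) by blast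
      then show ?thesis
        using that h(2) free_gen_closed[of _ ?X] by simp
    qed
    consider x y where "x \<in> carrier K" "y \<in> carrier K"
        "s = free_gen ?X (Inl x) \<otimes>\<^bsub>free_group ?X\<^esub> free_gen ?X (Inl y)
          \<otimes>\<^bsub>free_group ?X\<^esub> inv\<^bsub>free_group ?X\<^esub> free_gen ?X (Inl (x \<otimes>\<^bsub>K\<^esub> y))"
      | x y where "x \<in> carrier L" "y \<in> carrier L"
        "s = free_gen ?X (Inr x) \<otimes>\<^bsub>free_group ?X\<^esub> free_gen ?X (Inr y)
          \<otimes>\<^bsub>free_group ?X\<^esub> inv\<^bsub>free_group ?X\<^esub> free_gen ?X (Inr (x \<otimes>\<^bsub>L\<^esub> y))"
      using s unfolding free_product_relators_def Let_def by blast
    then show ?thesis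
    proof cases
      case (1 x y)
      then show ?thesis
        using key[of "Inl x" "Inl y" "Inl (x \<otimes>\<^bsub>K\<^esub> y)"] hom_mult[OF f] K
        by (simp add: InlI group.is_monoid monoid.m_closed)
    next
      case (2 x y)
      then show ?thesis
        using key[of "Inr x" "Inr y" "Inr (x \<otimes>\<^bsub>L\<^esub> y)"] hom_mult[OF g] L
        by (simp add: InrI group.is_monoid monoid.m_closed)
    qed
  qed
  then obtain h where "h \<in> hom (presented_group ?X (free_product_relators K L)) H"
      "\<And>x. x \<in> ?X \<Longrightarrow> h (presented_gen ?X (free_product_relators K L) x) = case_sum f g x"
    using H.presented_group_universal[OF free_product_relators_closed[OF K L] fg] by metis
  then show thesis
    using that unfolding free_product_def free_product_gen_def by (simp add: InlI InrI)
qed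

end

context baumslag_solitar
begin

text \<open>The universal property of G gives h into the free product, that of the free product
  gives k back to G / N. The composite of h and k agrees with the projection on a and t, so the
  kernel of h is no larger than \<open>N\<close>, and it contains \<open>N\<close> because the image
  of a has order dividing d.\<close>

lemma Mod_N_iso_free_product:
  "G Mod N \<cong> free_product integer_group (integer_mod_group (nat d))"
proof -
  define Zd where "Zd = integer_mod_group (nat d)"
  define P where "P = free_product integer_group Zd"
  have groups: "group integer_group" "group Zd"
    by (simp_all add: Zd_def)
  define i j where "i k = free_product_gen integer_group Zd (Inl k)"
    and "j l = free_product_gen integer_group Zd (Inr l)" for k l
  interpret i: group_hom integer_group P i
    using groups group_free_product[OF groups] free_product_Inl_hom[OF groups]
    by (simp add: group_hom_iff P_def i_def[abs_def])
  interpret j: group_hom Zd P j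
    using groups group_free_product[OF groups] free_product_Inr_hom[OF groups]
    by (simp add: group_hom_iff P_def j_def[abs_def])
  have one: "1 mod d \<in> carrier Zd"
    using d_pos by (simp add: Zd_def carrier_integer_mod_group)
  have i_pow: "i 1 [^]\<^bsub>P\<^esub> (k :: int) = i k" for k
    using i.hom_int_pow[of 1 k] by simp
  have j_pow: "j (1 mod d) [^]\<^bsub>P\<^esub> (l :: int) = j (l mod d)" for l
    using j.hom_int_pow[OF one, of l] d_pos
    by (simp add: Zd_def int_pow_integer_mod_group mod_mult_right_eq)
  have j_0: "j 0 = \<one>\<^bsub>P\<^esub>"
    using j.hom_one by (simp add: Zd_def)
  have "j (1 mod d) [^]\<^bsub>P\<^esub> m \<otimes>\<^bsub>P\<^esub> i 1 = i 1 \<otimes>\<^bsub>P\<^esub> j (1 mod d) [^]\<^bsub>P\<^esub> n"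
    using d_dvd_m d_dvd_n by (simp add: j_pow j_0)
  then obtain h where h: "h \<in> hom G P" "h a = j (1 mod d)" "h t = i 1"
    using universal[OF i.H.is_group j.hom_closed[OF one] i.hom_closed[of 1]] by auto
  interpret h: group_hom G P h
    using h is_group i.H.is_group by (simp add: group_hom_iff)
  have f: "(\<lambda>k. (N #> t) [^]\<^bsub>G Mod N\<^esub> k) \<in> hom integer_group (G Mod N)"
    by (rule Mod_N.H.hom_integer_group_pow) simp
  have g: "(\<lambda>l. (N #> a) [^]\<^bsub>G Mod N\<^esub> l) \<in> hom Zd (G Mod N)"
  proof (rule homI)
    fix x y assume "x \<in> carrier Zd" "y \<in> carrier Zd"
    show "(N #> a) [^]\<^bsub>G Mod N\<^esub> (x \<otimes>\<^bsub>Zd\<^esub> y)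
        = (N #> a) [^]\<^bsub>G Mod N\<^esub> x \<otimes>\<^bsub>G Mod N\<^esub> (N #> a) [^]\<^bsub>G Mod N\<^esub> y"
      using d_pos Mod_N.H.int_pow_mod[OF Mod_N.hom_closed[OF a_closed] Mod_N_a_pow_d]
        Mod_N.H.int_pow_mult[OF Mod_N.hom_closed[OF a_closed]] by (simp add: Zd_def)
  qed simp
  obtain k where k: "k \<in> hom P (G Mod N)" "\<And>z. k (i z) = (N #> t) [^]\<^bsub>G Mod N\<^esub> z"
      "\<And>l. l \<in> carrier Zd \<Longrightarrow> k (j l) = (N #> a) [^]\<^bsub>G Mod N\<^esub> l"
    using free_product_universal[OF groups Mod_N.H.is_group f g] unfolding P_def i_def j_def by auto
  have "h ` carrier G = carrier P"
  proof
    show "h ` carrier G \<subseteq> carrier P"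
      using h(1) by (rule hom_carrier)
    have "free_product_gen integer_group Zd y \<in> h ` carrier G" if "y \<in> carrier integer_group <+> carrier Zd" for y
      using that
    proof (rule PlusE)
      fix z assume y: "y = Inl z"
      have "i z = h (t [^] z)"
        by (simp add: h.hom_int_pow h(3) i_pow)
      then show ?thesis
        unfolding y i_def[symmetric] by (rule image_eqI) simp
    next
      fix l assume "l \<in> carrier Zd" and y: "y = Inr l"
      then have "j l = h (a [^] l)"
        using d_pos by (simp add: h.hom_int_pow h(2) j_pow Zd_def carrier_integer_mod_group)
      then show ?thesis
        unfolding y j_def[symmetric] by (rule image_eqI) simp
    qed
    moreover have "subgroup (h ` carrier G) P"
      using h.subgroup_img_is_subgroup[OF subgroup_self] .
    moreover have "carrier P
        = generate P (free_product_gen integer_group Zd ` (carrier integer_group <+> carrier Zd))"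
      unfolding P_def by (rule carrier_free_product[OF groups])
    ultimately show "carrier P \<subseteq> h ` carrier G"
      by (simp only:) (rule i.H.generate_subgroup_incl, blast)
  qed
  moreover have "kernel G P h = N"
  proof
    have "h a [^]\<^bsub>P\<^esub> d = \<one>\<^bsub>P\<^esub>"
      by (simp add: h(2) j_pow j_0)
    then show "N \<subseteq> kernel G P h"
      using N_kernel[OF i.H.is_group h(1)] N_subset by (auto simp: kernel_def)
    show "kernel G P h \<subseteq> N"
    proof
      fix g assume "g \<in> kernel G P h"
      then have g: "g \<in> carrier G" "h g = \<one>\<^bsub>P\<^esub>"
        by (auto simp: kernel_def)
      have hom: "k \<circ> h \<in> hom G (G Mod N)"
        using Group.hom_compose[OF h(1) k(1)] .
      have "(k \<circ> h) g = N #> g"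
      proof (rule hom_eq_on_generate[OF is_group group_Mod_N hom hom_Mod_N])
        show "(k \<circ> h) s = N #> s" if "s \<in> {a, t}" for s
          using that k(2)[of 1] k(3)[OF one] h(2,3) Mod_N.H.int_pow_mod[OF Mod_N.hom_closed[OF a_closed] Mod_N_a_pow_d, of 1]
          by auto
      qed (use g carrier_eq in auto)
      moreover have "k \<one>\<^bsub>P\<^esub> = \<one>\<^bsub>G Mod N\<^esub>"
        using hom_one[OF k(1) i.H.is_group group_Mod_N] .
      ultimately show "g \<in> N"
        using Mod_N_eq_one_iff[OF g(1)] g(2) by simp
    qed
  qed
  ultimately show ?thesis
    using h.FactGroup_iso unfolding P_def Zd_def by simp
qed

end

section \<open>The commutator subgroup of the free product\<close>

context baumslag_solitar
begin

text \<open>The Schreier generators for the transversal of the elements \<open>a\<^sup>l t\<^sup>k\<close>.\<close>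

definition schreier :: "int \<Rightarrow> int \<Rightarrow> bs_letter word set set" where
  "schreier k l = inv (a [^] l \<otimes> t [^] (k + 1)) \<otimes> (t \<otimes> (a [^] l \<otimes> t [^] k))"

lemma schreier_closed [simp]: "schreier k l \<in> carrier G"
  by (simp add: schreier_def)

lemma schreier_rewrite: "a [^] l \<otimes> (t [^] (k + 1) \<otimes> schreier k l) = t \<otimes> (a [^] l \<otimes> t [^] k)"
  by (simp add: schreier_def inv_mult_group m_assoc) (simp flip: m_assoc)

lemma schreier_0: "schreier k 0 = \<one>"
  using int_pow_mult[of t 1 k] by (simp add: schreier_def add.commute)

abbreviation F :: "nat word set monoid" where
  "F \<equiv> free_group UNIV"

text \<open>The free group on the natural numbers represents the one of countably infinite rank, so
  the pairs (k, l) with 0 < l < d are numbered. The pairs with l = 0 are left out because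
  \<open>schreier k 0\<close> is trivial; \<open>letter\<close> sends them to 1 accordingly.\<close>

definition index :: "nat \<Rightarrow> int \<times> int" where
  "index = from_nat_into (UNIV \<times> {1..<d})"

definition letter :: "int \<Rightarrow> int \<Rightarrow> nat word set" where
  "letter k l = (if l = 0 then \<one>\<^bsub>F\<^esub> else free_gen UNIV (to_nat_on (UNIV \<times> {1..<d}) (k, l)))"

sublocale F: group F
  by (rule group_free_group)

lemma letter_closed [simp]: "letter k l \<in> carrier F"
  by (simp add: letter_def free_gen_closed)

context
  assumes d_gt_1: "1 < d"
begin

lemma infinite_index: "infinite (UNIV \<times> {1..<d} :: (int \<times> int) set)"
  using d_gt_1 by (auto simp: finite_cartesian_product_iff)

lemma index_in: "snd (index i) \<in> {1..<d}"
  using from_nat_into[of "UNIV \<times> {1..<d} :: (int \<times> int) set" i] infinite_index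
  unfolding index_def by (metis finite.emptyI mem_Times_iff)

lemma letter_index: "letter (fst (index i)) (snd (index i)) = free_gen UNIV i"
  using index_in[of i] infinite_index unfolding letter_def index_def
  by (simp add: to_nat_on_from_nat_into_infinite)

lemma index_to_nat: "l \<in> {1..<d} \<Longrightarrow> index (to_nat_on (UNIV \<times> {1..<d}) (k, l)) = (k, l)"
  unfolding index_def by (simp add: from_nat_into_to_nat_on)

lemma free_hom:
  obtains \<psi> where "\<psi> \<in> hom F G" "\<And>k l. l \<in> {0..<d} \<Longrightarrow> \<psi> (letter k l) = schreier k l"
proof -
  obtain \<psi> where \<psi>: "\<psi> \<in> hom F G" "\<And>i. \<psi> (free_gen UNIV i) = schreier (fst (index i)) (snd (index i))"
    using free_group_universal[of "\<lambda>i. schreier (fst (index i)) (snd (index i))" UNIV] by auto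
  have "\<psi> (letter k l) = schreier k l" if "l \<in> {0..<d}" for k l
  proof (cases "l = 0")
    case True
    then show ?thesis
      using hom_one[OF \<psi>(1) F.is_group is_group] by (simp add: letter_def schreier_0)
  next
    case False
    then show ?thesis
      using that index_to_nat[of l k] by (simp add: letter_def \<psi>(2))
  qed
  then show thesis
    using that \<psi>(1) by blast
qed

text \<open>The group acts on triples \<open>(l, k, w)\<close> as it acts on the cosets \<open>a\<^sup>l t\<^sup>k w\<close> of the kernel, with
  the Schreier generators replaced by free ones.\<close>

lemma free_action:
  obtains \<rho> :: "bs_letter word set set \<Rightarrow> int \<times> int \<times> nat word set \<Rightarrow> int \<times> int \<times> nat word set"
    and \<Omega> where "\<rho> \<in> hom G (perm_group \<Omega>)"
    "\<And>k l w. l \<in> {0..<d} \<Longrightarrow> w \<in> carrier F \<Longrightarrow> \<rho> (schreier k l) (0, 0, w) = (0, 0, letter k l \<otimes>\<^bsub>F\<^esub> w)"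
    "\<And>g. g \<in> N \<Longrightarrow> \<rho> g = id"
proof -
  define \<Omega> :: "(int \<times> int \<times> nat word set) set" where "\<Omega> = {0..<d} \<times> UNIV \<times> carrier F"
  define \<alpha> where "\<alpha> p = (if p \<in> \<Omega> then (case p of (l, k, w) \<Rightarrow> ((l + 1) mod d, k, w)) else p)" for p
  define \<tau> where
    "\<tau> p = (if p \<in> \<Omega> then (case p of (l, k, w) \<Rightarrow> (l, k + 1, letter k l \<otimes>\<^bsub>F\<^esub> w)) else p)" for p
  have \<alpha>: "\<alpha> permutes \<Omega>"
    by (rule permutes_witness[where g = "\<lambda>(l, k, w). ((l - 1) mod d, k, w)"])
      (auto simp: \<alpha>_def \<Omega>_def mod_add_left_eq mod_diff_left_eq)
  have \<tau>: "\<tau> permutes \<Omega>"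
    by (rule permutes_witness[where g = "\<lambda>(l, k, w). (l, k - 1, inv\<^bsub>F\<^esub> letter (k - 1) l \<otimes>\<^bsub>F\<^esub> w)"])
      (auto simp: \<tau>_def \<Omega>_def simp flip: F.m_assoc)
  interpret P: group "perm_group \<Omega>"
    by simp
  have \<alpha>_pow: "(\<alpha> [^]\<^bsub>perm_group \<Omega>\<^esub> (j :: nat)) (l, k, w) = ((l + int j) mod d, k, w)"
    if "l \<in> {0..<d}" "w \<in> carrier F" for j l k w
  proof -
    have "(\<alpha> ^^ j) (l, k, w) = ((l + int j) mod d, k, w)"
    proof (induction j)
      case (Suc j)
      then show ?case
        using that d_gt_1 by (simp add: \<alpha>_def \<Omega>_def mod_add_left_eq add.assoc add.commute[of 1])
    qed (use that in simp)
    then show ?thesis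
      by (simp add: perm_group_nat_pow)
  qed
  have \<alpha>_d: "\<alpha> [^]\<^bsub>perm_group \<Omega>\<^esub> d = \<one>\<^bsub>perm_group \<Omega>\<^esub>"
  proof -
    have "(\<alpha> [^]\<^bsub>perm_group \<Omega>\<^esub> nat d) p = p" for p
    proof (cases "p \<in> \<Omega>")
      case True
      then show ?thesis
        using \<alpha>_pow[of "fst p" "snd (snd p)" "nat d" "fst (snd p)"] d_gt_1 by (auto simp: \<Omega>_def)
    next
      case False
      moreover have "(\<alpha> [^]\<^bsub>perm_group \<Omega>\<^esub> nat d) permutes \<Omega>"
        using P.nat_pow_closed[of \<alpha> "nat d"] \<alpha> by simp
      ultimately show ?thesis
        by (simp add: permutes_not_in)
    qed
    then have "\<alpha> [^]\<^bsub>perm_group \<Omega>\<^esub> nat d = id"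
      by (intro ext) simp
    moreover have "\<alpha> [^]\<^bsub>perm_group \<Omega>\<^esub> d = \<alpha> [^]\<^bsub>perm_group \<Omega>\<^esub> nat d"
      using d_gt_1 int_pow_int[of "perm_group \<Omega>" \<alpha> "nat d"] by (metis d_pos int_nat_eq less_imp_le)
    ultimately show ?thesis
      by simp
  qed
  have "\<alpha> [^]\<^bsub>perm_group \<Omega>\<^esub> k = \<one>\<^bsub>perm_group \<Omega>\<^esub>" if "d dvd k" for k
    using that \<alpha> \<alpha>_d P.int_pow_pow[of \<alpha> d] by (metis P.int_pow_one dvdE mem_Collect_eq perm_group_simps(1))
  then have rel: "\<alpha> [^]\<^bsub>perm_group \<Omega>\<^esub> m \<otimes>\<^bsub>perm_group \<Omega>\<^esub> \<tau>
      = \<tau> \<otimes>\<^bsub>perm_group \<Omega>\<^esub> \<alpha> [^]\<^bsub>perm_group \<Omega>\<^esub> n"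
    using d_dvd_m d_dvd_n by simp
  obtain \<rho> where \<rho>: "\<rho> \<in> hom G (perm_group \<Omega>)" "\<rho> a = \<alpha>" "\<rho> t = \<tau>"
    using universal[OF P.is_group _ _ rel] \<alpha> \<tau> by auto
  interpret \<rho>: group_hom G "perm_group \<Omega>" \<rho>
    using \<rho> is_group P.is_group by (simp add: group_hom_iff)
  have perm: "\<rho> g permutes \<Omega>" if "g \<in> carrier G" for g
    using \<rho>.hom_closed[OF that] by simp
  have comp: "\<rho> (g \<otimes> h) p = \<rho> g (\<rho> h p)" if "g \<in> carrier G" "h \<in> carrier G" for g h p
    using \<rho>.hom_mult[OF that] by simp
  have inv: "\<rho> (inv g) p = q \<longleftrightarrow> \<rho> g q = p" if "g \<in> carrier G" for g p q
    using permutes_inv_eq[OF perm[OF that]] perm_group_inv[OF perm[OF that]] \<rho>.hom_inv[OF that] by simp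
  \<comment> \<open>The letter for l = 0 is trivial, so powers of t act on these triples as pure
    translations of k.\<close>
  have \<tau>_step: "\<tau> (0, k, w) = (0, k + 1, w)" if "w \<in> carrier F" for k w
    using that d_gt_1 by (simp add: \<tau>_def \<Omega>_def letter_def)
  have t_pow: "\<rho> (t [^] k) (0, 0, w) = (0, k, w)" if w: "w \<in> carrier F" for k :: int and w
  proof (induction k rule: int_induct[of _ 0])
    case base
    then show ?case
      using \<rho>.hom_one by simp
  next
    case (step1 k)
    have "t [^] (k + 1) = t \<otimes> t [^] k"
      using int_pow_mult[of t 1 k] by (simp add: add.commute)
    then show ?case
      using step1 \<tau>_step[OF w] \<rho>(3) by (simp add: comp)
  next
    case (step2 k)
    have "t [^] (k - 1) = inv t \<otimes> t [^] k"
      using int_pow_mult[of t "- 1" k] by (simp add: int_pow_neg)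
    moreover have "\<rho> (inv t) (0, k, w) = (0, k - 1, w)"
      using \<tau>_step[OF w, of "k - 1"] \<rho>(3) by (subst inv) auto
    ultimately show ?case
      using step2 comp[of "inv t" "t [^] k"] by (simp del: \<rho>.hom_inv)
  qed
  have a_pow: "\<rho> (a [^] l) (0, k, w) = (l, k, w)" if "l \<in> {0..<d}" "w \<in> carrier F" for l k w
    using \<alpha>_pow[of 0 w "nat l" k] that \<rho>.hom_nat_pow[OF a_closed, of "nat l"] \<rho>(2)
      int_pow_int[of G a "nat l"] by simp
  show thesis
  proof (rule that[OF \<rho>(1)])
    show "\<rho> (schreier k l) (0, 0, w) = (0, 0, letter k l \<otimes>\<^bsub>F\<^esub> w)" if "l \<in> {0..<d}" "w \<in> carrier F" for k l w
    proof -
      have "\<rho> (t \<otimes> (a [^] l \<otimes> t [^] k)) (0, 0, w) = (l, k + 1, letter k l \<otimes>\<^bsub>F\<^esub> w)"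
        using that \<rho>(3) by (simp add: comp t_pow a_pow \<tau>_def \<Omega>_def)
      moreover have "\<rho> (a [^] l \<otimes> t [^] (k + 1)) (0, 0, letter k l \<otimes>\<^bsub>F\<^esub> w) = (l, k + 1, letter k l \<otimes>\<^bsub>F\<^esub> w)"
        using that by (simp add: comp t_pow a_pow)
      ultimately have "\<rho> (inv (a [^] l \<otimes> t [^] (k + 1))) (\<rho> (t \<otimes> (a [^] l \<otimes> t [^] k)) (0, 0, w))
          = (0, 0, letter k l \<otimes>\<^bsub>F\<^esub> w)"
        by (subst inv) auto
      then show ?thesis
        unfolding schreier_def by (subst comp) auto
    qed
    show "\<rho> g = id" if "g \<in> N" for g
      using N_kernel[OF P.is_group \<rho>(1) _ that] \<alpha>_d by (simp add: \<rho>(2))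
  qed
qed

lemma schreier_in_D_N: "abelian_hom d (schreier k l) = (0, 0)"
proof -
  interpret ab: group_hom G "integer_group \<times>\<times> integer_mod_group (nat d)" "abelian_hom d"
    by (rule group_hom_abelian_hom[OF d_pos d_dvd_diff])
  have comm: "abelian_hom d (g \<otimes> h) = abelian_hom d (h \<otimes> g)" if "g \<in> carrier G" "h \<in> carrier G" for g h
    using that by (simp add: mult_DirProd' add.commute)
  have "abelian_hom d (t \<otimes> (a [^] l \<otimes> t [^] k)) = abelian_hom d (t [^] (k + 1) \<otimes> a [^] l)"
    using ab.hom_mult[of t "a [^] l \<otimes> t [^] k"] ab.hom_mult[of t "t [^] k \<otimes> a [^] l"]
      comm[of "a [^] l" "t [^] k"] int_pow_mult[of t 1 k] by (simp add: m_assoc add.commute)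
  also have "\<dots> = abelian_hom d (a [^] l \<otimes> t [^] (k + 1))"
    by (rule comm) auto
  finally have "abelian_hom d (schreier k l) = inv\<^bsub>integer_group \<times>\<times> integer_mod_group (nat d)\<^esub>
      abelian_hom d (a [^] l \<otimes> t [^] (k + 1)) \<otimes>\<^bsub>integer_group \<times>\<times> integer_mod_group (nat d)\<^esub>
      abelian_hom d (a [^] l \<otimes> t [^] (k + 1))"
    unfolding schreier_def
    using ab.hom_mult[of "inv (a [^] l \<otimes> t [^] (k + 1))" "t \<otimes> (a [^] l \<otimes> t [^] k)"]
      ab.hom_inv[of "a [^] l \<otimes> t [^] (k + 1)"] by simp
  then show ?thesis
    using ab.H.l_inv[OF ab.hom_closed, of "a [^] l \<otimes> t [^] (k + 1)"] by simp
qed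

text \<open>Injectivity: \<psi> v moves (0, 0, 1) to (0, 0, v), whereas \<open>N\<close> acts
  trivially. Surjectivity: by Schreier rewriting every element is a^l t^k (\<psi> v) modulo
  \<open>N\<close> with 0 <= l < d, and for elements of the product of \<open>D\<close> and
  \<open>N\<close> the image in Z x Z_d forces k = l = 0.\<close>

lemma D_N_Mod_N_iso:
  "G\<lparr>carrier := D <#> N\<rparr> Mod N \<cong> F"
proof -
  let ?K = "G\<lparr>carrier := D <#> N\<rparr> Mod N"
  obtain \<psi> where \<psi>: "\<psi> \<in> hom F G" "\<And>k l. l \<in> {0..<d} \<Longrightarrow> \<psi> (letter k l) = schreier k l"
    using free_hom by blast
  interpret \<psi>: group_hom F G \<psi>
    using \<psi> is_group F.is_group by (simp add: group_hom_iff)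
  obtain \<rho> :: "bs_letter word set set \<Rightarrow> int \<times> int \<times> nat word set \<Rightarrow> int \<times> int \<times> nat word set"
    and \<Omega> where \<rho>: "\<rho> \<in> hom G (perm_group \<Omega>)"
      "\<And>k l w. l \<in> {0..<d} \<Longrightarrow> w \<in> carrier F \<Longrightarrow> \<rho> (schreier k l) (0, 0, w) = (0, 0, letter k l \<otimes>\<^bsub>F\<^esub> w)"
      "\<And>g. g \<in> N \<Longrightarrow> \<rho> g = id"
    using free_action by blast
  interpret \<rho>: group_hom G "perm_group \<Omega>" \<rho>
    using \<rho> is_group by (simp add: group_hom_iff)
  have gen_letter: "free_gen UNIV i = letter (fst (index i)) (snd (index i))" for i
    using letter_index by simp
  have index: "snd (index i) \<in> {0..<d}" for i
    using index_in[of i] by auto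
  have orbit: "\<forall>w\<in>carrier F. \<rho> (\<psi> v) (0, 0, w) = (0, 0, v \<otimes>\<^bsub>F\<^esub> w)" if v: "v \<in> carrier F" for v
  proof -
    have "v \<in> generate F (free_gen UNIV ` UNIV)"
      using v carrier_free_group[of "UNIV :: nat set"] by simp
    then show ?thesis
    proof (induction rule: F.generate_left_induct)
      case subset
      show ?case
        by (auto intro: free_gen_closed)
    next
      case one
      then show ?case
        using \<rho>.hom_one by simp
    next
      case (incl s v)
      then obtain i where s: "s = letter (fst (index i)) (snd (index i))"
        using gen_letter by auto
      show ?case
        using incl \<rho>(2)[OF index[of i]] \<psi>(2)[OF index[of i]] by (simp add: s F.m_assoc)
    next
      case (inv s v)
      then obtain i where s: "s = letter (fst (index i)) (snd (index i))"
        using gen_letter by auto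
      have "\<rho> (inv (\<psi> s)) (0, 0, w) = (0, 0, inv\<^bsub>F\<^esub> s \<otimes>\<^bsub>F\<^esub> w)" if "w \<in> carrier F" for w
      proof -
        have perm: "\<rho> (\<psi> s) permutes \<Omega>"
          using \<rho>.hom_closed[of "\<psi> s"] by (simp add: s)
        have "\<rho> (\<psi> s) (0, 0, inv\<^bsub>F\<^esub> s \<otimes>\<^bsub>F\<^esub> w) = (0, 0, w)"
          using \<rho>(2)[OF index[of i], of "inv\<^bsub>F\<^esub> s \<otimes>\<^bsub>F\<^esub> w"] \<psi>(2)[OF index[of i]] that
          by (simp add: s flip: F.m_assoc)
        then show ?thesis
          using permutes_inv_eq[OF perm] perm_group_inv[OF perm] \<rho>.hom_inv[of "\<psi> s"] by (simp add: s)
      qed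
      moreover have "s \<in> carrier F"
        by (simp add: s)
      ultimately show ?case
        using inv by (simp add: F.m_assoc)
    qed
  qed
  have \<psi>_D_N: "\<psi> v \<in> D <#> N" if "v \<in> carrier F" for v
  proof -
    have "\<psi> v \<in> generate G (\<psi> ` free_gen UNIV ` UNIV)"
    proof (subst \<psi>.generate_img)
      show "range (free_gen UNIV) \<subseteq> carrier F"
        by (auto intro: free_gen_closed)
      show "\<psi> v \<in> \<psi> ` generate F (range (free_gen UNIV))"
        using that by (simp flip: carrier_free_group)
    qed
    moreover have "\<psi> ` free_gen UNIV ` UNIV \<subseteq> D <#> N"
      using schreier_in_D_N \<psi>(2)[OF index] unfolding D_N_eq_kernel[symmetric] by (auto simp: kernel_def gen_letter)
    ultimately show ?thesis
      using generate_subgroup_incl[OF _ subgroup_D_N] by blast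
  qed
  have a_step: "N #> (a [^] j \<otimes> g) = N #> (a [^] ((j + l) mod d) \<otimes> z)"
    if "N #> g = N #> (a [^] l \<otimes> z)" "g \<in> carrier G" "z \<in> carrier G" for j l :: int and g z
  proof -
    have "N #> (a [^] j \<otimes> g) = N #> (a [^] j \<otimes> (a [^] l \<otimes> z))"
      using that Mod_N.hom_mult[of "a [^] j" g] Mod_N.hom_mult[of "a [^] j" "a [^] l \<otimes> z"] by simp
    also have "a [^] j \<otimes> (a [^] l \<otimes> z) = a [^] (j + l) \<otimes> z"
      using that(3) by (simp add: int_pow_mult m_assoc)
    also have "N #> (a [^] (j + l) \<otimes> z) = N #> (a [^] ((j + l) mod d) \<otimes> z)"
      using that Mod_N.hom_mult[of "a [^] (j + l)" z] Mod_N.hom_mult[of "a [^] ((j + l) mod d)" z]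
        Mod_N.hom_int_pow[OF a_closed] Mod_N.H.int_pow_mod[OF Mod_N.hom_closed[OF a_closed] Mod_N_a_pow_d]
      by (metis a_closed int_pow_closed)
    finally show ?thesis .
  qed
  have a_case: "\<exists>l\<in>{0..<d}. \<exists>k. \<exists>v\<in>carrier F. N #> (a [^] j \<otimes> g) = N #> (a [^] l \<otimes> (t [^] (k :: int) \<otimes> \<psi> v))"
    if g: "g \<in> carrier G"
      "\<exists>l\<in>{0..<d}. \<exists>k. \<exists>v\<in>carrier F. N #> g = N #> (a [^] l \<otimes> (t [^] (k :: int) \<otimes> \<psi> v))" for g and j :: int
  proof -
    obtain l k v where lkv: "v \<in> carrier F" "N #> g = N #> (a [^] (l :: int) \<otimes> (t [^] (k :: int) \<otimes> \<psi> v))"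
      using g(2) by blast
    have "N #> (a [^] j \<otimes> g) = N #> (a [^] ((j + l) mod d) \<otimes> (t [^] k \<otimes> \<psi> v))"
      using lkv g(1) by (intro a_step) auto
    moreover have "(j + l) mod d \<in> {0..<d}"
      using d_gt_1 by simp
    ultimately show ?thesis
      using lkv(1) by blast
  qed
  have push: "t \<otimes> (a [^] l \<otimes> (t [^] k \<otimes> \<psi> v)) = a [^] l \<otimes> (t [^] (k + 1) \<otimes> \<psi> (letter k l \<otimes>\<^bsub>F\<^esub> v))"
    if "l \<in> {0..<d}" "v \<in> carrier F" for k l :: int and v
    using that \<psi>(2)[OF that(1)] schreier_rewrite[of l k] by (simp flip: m_assoc)
  have form: "\<exists>l\<in>{0..<d}. \<exists>k. \<exists>v\<in>carrier F. N #> g = N #> (a [^] l \<otimes> (t [^] (k :: int) \<otimes> \<psi> v))"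
    if "g \<in> carrier G" for g
    using that
  proof (induction g rule: induct)
    case one
    have "N #> \<one> = N #> (a [^] (0 :: int) \<otimes> (t [^] (0 :: int) \<otimes> \<psi> \<one>\<^bsub>F\<^esub>))"
      by simp
    then show ?case
      using d_gt_1 by (intro bexI[of _ 0] exI[of _ 0] bexI[of _ "\<one>\<^bsub>F\<^esub>"]) auto
  next
    case (a g)
    then show ?case
      using a_case[of g 1] by simp
  next
    case (inv_a g)
    then show ?case
      using a_case[of g "- 1"] by (simp add: int_pow_neg)
  next
    case (t g)
    then obtain l k v where lkv: "l \<in> {0..<d}" "v \<in> carrier F" "N #> g = N #> (a [^] l \<otimes> (t [^] (k :: int) \<otimes> \<psi> v))"
      by blast
    have "N #> (t \<otimes> g) = N #> (t \<otimes> (a [^] l \<otimes> (t [^] k \<otimes> \<psi> v)))"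
      using lkv t Mod_N.hom_mult[of t g] Mod_N.hom_mult[of t "a [^] l \<otimes> (t [^] k \<otimes> \<psi> v)"] by simp
    also have "t \<otimes> (a [^] l \<otimes> (t [^] k \<otimes> \<psi> v)) = a [^] l \<otimes> (t [^] (k + 1) \<otimes> \<psi> (letter k l \<otimes>\<^bsub>F\<^esub> v))"
      using lkv by (intro push)
    finally show ?case
      using lkv by (metis F.m_closed letter_closed)
  next
    case (inv_t g)
    then obtain l k v where lkv: "l \<in> {0..<d}" "v \<in> carrier F" "N #> g = N #> (a [^] l \<otimes> (t [^] (k :: int) \<otimes> \<psi> v))"
      by blast
    let ?v = "inv\<^bsub>F\<^esub> letter (k - 1) l \<otimes>\<^bsub>F\<^esub> v"
    have "t \<otimes> (a [^] l \<otimes> (t [^] (k - 1) \<otimes> \<psi> ?v)) = a [^] l \<otimes> (t [^] k \<otimes> \<psi> (letter (k - 1) l \<otimes>\<^bsub>F\<^esub> ?v))"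
      using push[of l ?v "k - 1"] lkv by simp
    also have "letter (k - 1) l \<otimes>\<^bsub>F\<^esub> ?v = v"
      using lkv by (simp flip: F.m_assoc)
    finally have eq: "inv t \<otimes> (a [^] l \<otimes> (t [^] k \<otimes> \<psi> v)) = a [^] l \<otimes> (t [^] (k - 1) \<otimes> \<psi> ?v)"
      using lkv by (intro inv_solve_left'[THEN iffD2]) auto
    have "N #> (inv t \<otimes> g) = N #> (inv t \<otimes> (a [^] l \<otimes> (t [^] k \<otimes> \<psi> v)))"
      using lkv inv_t Mod_N.hom_mult[of "inv t" g] Mod_N.hom_mult[of "inv t" "a [^] l \<otimes> (t [^] k \<otimes> \<psi> v)"] by simp
    then show ?case
      unfolding eq using lkv by (metis F.m_closed F.inv_closed letter_closed)
  qed
  define \<Psi> where "\<Psi> v = N #> \<psi> v" for v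
  have K: "N \<lhd> G\<lparr>carrier := D <#> N\<rparr>"
    by (rule normal_restrict_supergroup[OF subgroup_D_N N_normal N_subset_D_N])
  have carrier_K: "carrier ?K = (\<lambda>g. N #> g) ` (D <#> N)"
    by (auto simp: carrier_FactGroup r_coset_def)
  have "\<Psi> \<in> hom F ?K"
  proof (rule homI)
    show "\<Psi> v \<in> carrier ?K" if "v \<in> carrier F" for v
      unfolding carrier_K \<Psi>_def using \<psi>_D_N[OF that] by blast
    show "\<Psi> (v \<otimes>\<^bsub>F\<^esub> w) = \<Psi> v \<otimes>\<^bsub>?K\<^esub> \<Psi> w" if "v \<in> carrier F" "w \<in> carrier F" for v w
      using that Mod_N.hom_mult[of "\<psi> v" "\<psi> w"] by (simp add: \<Psi>_def)
  qed
  then interpret \<Psi>: group_hom F ?K \<Psi>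
    using F.is_group normal.factorgroup_is_group[OF K] by (simp add: group_hom_iff)
  have "\<Psi> \<in> iso F ?K"
    unfolding \<Psi>.iso_iff
  proof (intro conjI ballI impI subsetI)
    fix v assume v: "v \<in> carrier F" "\<Psi> v = \<one>\<^bsub>?K\<^esub>"
    then have "\<psi> v \<in> N"
      using Mod_N_eq_one_iff[of "\<psi> v"] by (simp add: \<Psi>_def)
    then show "v = \<one>\<^bsub>F\<^esub>"
      using orbit[OF v(1)] \<rho>(3) v(1) by force
  next
    fix X assume "X \<in> carrier ?K"
    then obtain g where g: "g \<in> D <#> N" "X = N #> g"
      unfolding carrier_K by blast
    then have gc: "g \<in> carrier G"
      using subgroup.subset[OF subgroup_D_N] by blast
    obtain l k v where lkv: "l \<in> {0..<d}" "v \<in> carrier F" "N #> g = N #> (a [^] l \<otimes> (t [^] (k :: int) \<otimes> \<psi> v))"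
      using form[OF gc] by blast
    interpret ab: group_hom G "integer_group \<times>\<times> integer_mod_group (nat d)" "abelian_hom d"
      by (rule group_hom_abelian_hom[OF d_pos d_dvd_diff])
    obtain c where c: "c \<in> N" "g = c \<otimes> (a [^] l \<otimes> (t [^] k \<otimes> \<psi> v))"
      using normal.Mod_eqD[OF N_normal gc _ lkv(3)] lkv(2) by auto
    have ab0: "abelian_hom d g = (0, 0)" "abelian_hom d c = (0, 0)" "abelian_hom d (\<psi> v) = (0, 0)"
      using g(1) c(1) \<psi>_D_N[OF lkv(2)] N_subset_D_N unfolding D_N_eq_kernel[symmetric] by (auto simp: kernel_def)
    have "abelian_hom d (t [^] k \<otimes> a [^] l) = abelian_hom d g"
      using c N_subset lkv(2) ab0 ab.hom_mult[of "t [^] k" "a [^] l"]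
        d_pos by (simp add: subsetD mult_DirProd' add.commute mod_add_right_eq)
    then have "k = 0" "l = 0"
      using ab0 abelian_hom_t_a[OF d_pos d_dvd_diff, of k l] lkv(1) by auto
    then have "X = \<Psi> v"
      using lkv g by (simp add: \<Psi>_def)
    then show "X \<in> \<Psi> ` carrier F"
      using lkv(2) by blast
  qed
  then show ?thesis
    using F.iso_sym unfolding is_iso_def by blast
qed

end

end

section \<open>Unipotent representations modulo a prime\<close>

text \<open>Vectors over the field with p elements, of infinite length so that no dimension depends
  on the word; residues are represented by integers.\<close>

definition residue_seqs :: "int \<Rightarrow> (nat \<Rightarrow> int) set" where
  "residue_seqs p = {f. \<forall>s. f s \<in> {0..<p}}"

definition seq_add :: "int \<Rightarrow> (nat \<Rightarrow> int) \<Rightarrow> (nat \<Rightarrow> int) \<Rightarrow> nat \<Rightarrow> int" where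
  "seq_add p f g = (\<lambda>s. (f s + g s) mod p)"

text \<open>The operator X that sends the basis vector at s to the one at s + 1 if s is in
  \<open>C\<close>, and to 0 otherwise. Its powers see only runs of consecutive elements of
  \<open>C\<close>, so X is nilpotent when the runs are bounded.\<close>

definition shift :: "nat set \<Rightarrow> (nat \<Rightarrow> int) \<Rightarrow> nat \<Rightarrow> int" where
  "shift C f s = (if s = 0 \<or> s - 1 \<notin> C then 0 else f (s - 1))"

definition unipotent :: "int \<Rightarrow> nat set \<Rightarrow> (nat \<Rightarrow> int) \<Rightarrow> nat \<Rightarrow> int" where
  "unipotent p C f = (if f \<in> residue_seqs p then seq_add p f (shift C f) else f)"

lemma unipotent_closed: "0 < p \<Longrightarrow> f \<in> residue_seqs p \<Longrightarrow> unipotent p C f \<in> residue_seqs p"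
  by (simp add: unipotent_def residue_seqs_def seq_add_def)

lemma unipotent_funpow_closed:
  "0 < p \<Longrightarrow> f \<in> residue_seqs p \<Longrightarrow> (unipotent p C ^^ k) f \<in> residue_seqs p"
  by (induction k) (auto simp: unipotent_closed)

lemma sum_choose_Suc:
  fixes g :: "nat \<Rightarrow> int"
  shows "(\<Sum>i\<le>Suc k. int (Suc k choose i) * g i)
    = (\<Sum>i\<le>k. int (k choose i) * g i) + (\<Sum>i\<le>k. int (k choose i) * g (Suc i))"
proof -
  have "(\<Sum>i\<le>Suc k. int (Suc k choose i) * g i)
      = g 0 + (\<Sum>i\<le>k. int (k choose Suc i) * g (Suc i)) + (\<Sum>i\<le>k. int (k choose i) * g (Suc i))"
    by (subst sum.atMost_Suc_shift) (simp add: distrib_right sum.distrib)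
  also have "g 0 + (\<Sum>i\<le>k. int (k choose Suc i) * g (Suc i)) = (\<Sum>i\<le>Suc k. int (k choose i) * g i)"
    by (subst sum.atMost_Suc_shift) simp
  also have "\<dots> = (\<Sum>i\<le>k. int (k choose i) * g i)"
    by simp
  finally show ?thesis .
qed

lemma shift_funpow:
  "(shift C ^^ i) f s = (if i \<le> s \<and> {s - i..<s} \<subseteq> C then f (s - i) else 0)"
proof (induction i arbitrary: s)
  case (Suc i)
  show ?case
  proof (cases s)
    case (Suc s')
    have "{s - Suc i..<s} = insert s' {s' - i..<s'}"
      using Suc by auto
    then show ?thesis
      using Suc.IH[of s'] Suc by (auto simp: shift_def)
  qed (simp add: shift_def)
qed simp

lemma shift_sum_mod:
  "shift C (\<lambda>s. (\<Sum>i\<in>I. c i * h i s) mod p) s = (\<Sum>i\<in>I. c i * shift C (h i) s) mod p"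
  by (simp add: shift_def)

text \<open>The binomial expansion of (1 + X)^k. Reduction modulo p can wait until the end because X
  merely moves or erases entries.\<close>

lemma unipotent_funpow:
  assumes "0 < p" "f \<in> residue_seqs p"
  shows "(unipotent p C ^^ k) f s = (\<Sum>i\<le>k. int (k choose i) * (shift C ^^ i) f s) mod p"
proof (induction k arbitrary: s)
  case 0
  have "f s mod p = f s"
    using assms by (simp add: residue_seqs_def)
  then show ?case
    by simp
next
  case (Suc k)
  let ?u = "(unipotent p C ^^ k) f"
  have u: "?u = (\<lambda>s. (\<Sum>i\<le>k. int (k choose i) * (shift C ^^ i) f s) mod p)"
    using Suc by blast
  have "(unipotent p C ^^ Suc k) f s = (?u s + shift C ?u s) mod p"
    using unipotent_funpow_closed[OF assms] by (simp add: unipotent_def seq_add_def)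
  also have "shift C ?u s = (\<Sum>i\<le>k. int (k choose i) * (shift C ^^ Suc i) f s) mod p"
    unfolding u shift_sum_mod by simp
  also have "(?u s + \<dots>) mod p = (\<Sum>i\<le>Suc k. int (Suc k choose i) * (shift C ^^ i) f s) mod p"
    unfolding sum_choose_Suc Suc by (simp only: mod_add_eq)
  finally show ?case .
qed

text \<open>From i (p^u choose i) = p^u (p^u - 1 choose i - 1): were the coefficient prime to p,
  then p^u would divide i, which is positive and smaller.\<close>

lemma prime_power_dvd_choose:
  fixes p :: nat
  assumes "prime p" "0 < i" "i < p ^ u"
  shows "p dvd (p ^ u choose i)"
proof (rule ccontr)
  assume "\<not> p dvd (p ^ u choose i)"
  then have "coprime (p ^ u) (p ^ u choose i)"
    using assms(1) by (simp add: prime_imp_coprime)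
  moreover have "i * (p ^ u choose i) = p ^ u * ((p ^ u - 1) choose (i - 1))"
    using times_binomial_minus1_eq[OF assms(2), of "p ^ u"] .
  ultimately have "p ^ u dvd i"
    by (metis coprime_dvd_mult_left_iff dvd_triv_left)
  then show False
    using assms(2,3) dvd_imp_le by fastforce
qed

text \<open>In characteristic \<open>p\<close>, \<open>(1 + X)^(p\<^sup>u) = 1 + X^(p\<^sup>u)\<close>.\<close>

lemma unipotent_order:
  fixes p :: nat
  assumes p: "prime p" and runs: "\<And>s. \<not> {s..<s + p ^ u} \<subseteq> C" and f: "f \<in> residue_seqs (int p)"
  shows "(unipotent (int p) C ^^ (p ^ u)) f = f"
proof
  fix s
  have p0: "0 < int p"
    using p by (simp add: prime_gt_0_nat)
  have "(int (p ^ u choose i) * (shift C ^^ i) f s) mod int p = (if i = 0 then f s else 0)"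
    if i: "i \<le> p ^ u" for i
  proof -
    consider "i = 0" | "0 < i" "i < p ^ u" | "0 < i" "i = p ^ u"
      using i by fastforce
    then show ?thesis
    proof cases
      case 1
      have "f s mod int p = f s"
        using f by (simp add: residue_seqs_def)
      then show ?thesis
        using 1 by simp
    next
      case 2
      then show ?thesis
        using prime_power_dvd_choose[OF p 2] by (simp add: dvd_imp_mod_0 dvd_mult2)
    next
      case 3
      have "\<not> (i \<le> s \<and> {s - i..<s} \<subseteq> C)"
      proof
        assume "i \<le> s \<and> {s - i..<s} \<subseteq> C"
        then have "{s - i..<s - i + p ^ u} \<subseteq> C"
          unfolding 3(2)[symmetric] by simp
        then show False
          using runs by blast
      qed
      then have "(shift C ^^ i) f s = 0"
        unfolding shift_funpow by (rule if_not_P)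
      then show ?thesis
        using 3(1) by simp
    qed
  qed
  then have "(\<Sum>i\<le>p ^ u. (int (p ^ u choose i) * (shift C ^^ i) f s) mod int p)
      = (\<Sum>i\<le>p ^ u. if i = 0 then f s else 0)"
    by (intro sum.cong) auto
  also have "\<dots> = f s"
    by simp
  finally have "(\<Sum>i\<le>p ^ u. (int (p ^ u choose i) * (shift C ^^ i) f s)) mod int p = f s mod int p"
    by (metis mod_sum_eq)
  then show "(unipotent (int p) C ^^ (p ^ u)) f s = f s"
    using unipotent_funpow[OF p0 f] f by (simp add: residue_seqs_def)
qed

lemma unipotent_permutes:
  assumes "0 < q" "0 < p" "\<And>f. f \<in> residue_seqs p \<Longrightarrow> (unipotent p C ^^ q) f = f"
  shows "unipotent p C permutes residue_seqs p"
proof (rule permutes_witness[where g = "unipotent p C ^^ (q - 1)"])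
  obtain q' where q: "q = Suc q'"
    using assms(1) gr0_implies_Suc by blast
  show "unipotent p C ((unipotent p C ^^ (q - 1)) f) = f" if "f \<in> residue_seqs p" for f
    using assms(3)[OF that] by (simp add: q)
  show "(unipotent p C ^^ (q - 1)) (unipotent p C f) = f" if "f \<in> residue_seqs p" for f
    using assms(3)[OF that] by (simp add: q funpow_swap1)
qed (use assms unipotent_closed unipotent_funpow_closed in \<open>auto simp: unipotent_def\<close>)

text \<open>Additive permutations \<phi> for which \<phi> - 1 raises the order of vanishing by at
  least i. Quantifying over every r, and not only over the full space, makes degrees add under
  composition.\<close>

definition unipotent_filtration :: "int \<Rightarrow> nat \<Rightarrow> ((nat \<Rightarrow> int) \<Rightarrow> nat \<Rightarrow> int) set" where
  "unipotent_filtration p i = {\<phi>. \<phi> permutes residue_seqs p \<and>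
     (\<forall>f\<in>residue_seqs p. \<forall>g\<in>residue_seqs p. \<phi> (seq_add p f g) = seq_add p (\<phi> f) (\<phi> g)) \<and>
     (\<forall>f\<in>residue_seqs p. \<forall>r. (\<forall>s<r. f s = 0) \<longrightarrow> (\<forall>s<r + i. \<phi> f s = f s))}"

lemma unipotent_filtrationD:
  assumes "\<phi> \<in> unipotent_filtration p i"
  shows "\<phi> permutes residue_seqs p"
    "f \<in> residue_seqs p \<Longrightarrow> g \<in> residue_seqs p \<Longrightarrow> \<phi> (seq_add p f g) = seq_add p (\<phi> f) (\<phi> g)"
    "f \<in> residue_seqs p \<Longrightarrow> (\<And>s. s < r \<Longrightarrow> f s = 0) \<Longrightarrow> s < r + i \<Longrightarrow> \<phi> f s = f s"
    "f \<in> residue_seqs p \<Longrightarrow> \<phi> f \<in> residue_seqs p"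
proof -
  show perm: "\<phi> permutes residue_seqs p"
    using assms by (simp add: unipotent_filtration_def)
  show "\<phi> f \<in> residue_seqs p" if "f \<in> residue_seqs p"
    using permutes_in_image[OF perm] that by simp
  show "\<phi> f s = f s" if "f \<in> residue_seqs p" "\<And>s. s < r \<Longrightarrow> f s = 0" "s < r + i"
    using assms that unfolding unipotent_filtration_def by blast
qed (use assms in \<open>auto simp: unipotent_filtration_def\<close>)

section \<open>Unipotent maps graded by degree\<close>

context
  fixes p :: int
  assumes p: "0 < p"
begin

lemma seq_add_closed: "seq_add p f g \<in> residue_seqs p"
  using p by (simp add: seq_add_def residue_seqs_def)

lemma unipotent_in_filtration:
  assumes "unipotent p C permutes residue_seqs p"
  shows "unipotent p C \<in> unipotent_filtration p 1"
  unfolding unipotent_filtration_def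
proof (intro CollectI conjI ballI allI impI assms)
  fix f g assume fg: "f \<in> residue_seqs p" "g \<in> residue_seqs p"
  show "unipotent p C (seq_add p f g) = seq_add p (unipotent p C f) (unipotent p C g)"
  proof
    fix s
    have "unipotent p C (seq_add p f g) s = (f s + g s + (shift C f s + shift C g s)) mod p"
      using seq_add_closed by (simp add: unipotent_def seq_add_def shift_def mod_add_eq)
    also have "\<dots> = seq_add p (unipotent p C f) (unipotent p C g) s"
      using fg by (simp add: unipotent_def seq_add_def mod_add_eq algebra_simps)
    finally show "unipotent p C (seq_add p f g) s = seq_add p (unipotent p C f) (unipotent p C g) s" .
  qed
next
  fix f r s assume f: "f \<in> residue_seqs p" "\<forall>s<r. f s = 0" "s < r + 1"
  then have "shift C f s = 0"
    by (auto simp: shift_def)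
  moreover have "f s mod p = f s"
    using f(1) by (simp add: residue_seqs_def)
  ultimately show "unipotent p C f s = f s"
    using f(1) by (simp add: unipotent_def seq_add_def)
qed

text \<open>If f vanishes below s, then \<phi> leaves its entry at s unchanged; so \<phi> f and f
  have the same first non-zero entry.\<close>

lemma unipotent_filtration_vanish:
  assumes \<phi>: "\<phi> \<in> unipotent_filtration p i" "1 \<le> i" and f: "f \<in> residue_seqs p"
    and van: "\<And>s. s < r \<Longrightarrow> \<phi> f s = 0" and "s < r"
  shows "f s = 0"
  using \<open>s < r\<close>
proof (induction s rule: less_induct)
  case (less s)
  have "\<phi> f s = f s"
    using unipotent_filtrationD(3)[OF \<phi>(1) f, of s s] less \<phi>(2) by auto
  then show ?case
    using van less by simp
qed

text \<open>Additivity reduces the claim to the difference of f and g, whose image vanishes below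
  r.\<close>

lemma unipotent_filtration_agree:
  assumes \<phi>: "\<phi> \<in> unipotent_filtration p i" "1 \<le> i" and fg: "f \<in> residue_seqs p" "g \<in> residue_seqs p"
    and eq: "\<And>s. s < r \<Longrightarrow> \<phi> f s = \<phi> g s" and "s < r"
  shows "f s = g s"
proof -
  define u where "u s = (f s - g s) mod p" for s
  have u: "u \<in> residue_seqs p"
    using p by (simp add: residue_seqs_def u_def)
  have f: "f = seq_add p g u"
    using fg by (auto simp: seq_add_def u_def fun_eq_iff mod_add_right_eq residue_seqs_def)
  have "\<phi> u s = 0" if "s < r" for s
  proof -
    have "(\<phi> g s + \<phi> u s) mod p = \<phi> g s"
      using eq[OF that] unipotent_filtrationD(2)[OF \<phi>(1) fg(2) u] unfolding f by (simp add: seq_add_def)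
    then have "p dvd \<phi> u s"
      by (metis add_diff_cancel_left' mod_eq_dvd_iff mod_mod_trivial)
    moreover have "\<phi> u s \<in> {0..<p}"
      using unipotent_filtrationD(4)[OF \<phi>(1) u] by (simp add: residue_seqs_def)
    ultimately show ?thesis
      using zdvd_imp_le[of p "\<phi> u s"] by force
  qed
  then have "u s = 0"
    using unipotent_filtration_vanish[OF \<phi> u _ \<open>s < r\<close>] by blast
  then have "f s mod p = g s mod p"
    by (simp add: u_def mod_eq_dvd_iff dvd_eq_mod_eq_0)
  then show ?thesis
    using fg by (simp add: residue_seqs_def)
qed

lemma unipotent_filtration_subgroup:
  assumes "1 \<le> i"
  shows "subgroup (unipotent_filtration p i) (perm_group (residue_seqs p))"
proof (rule subgroup.intro)
  show "unipotent_filtration p i \<subseteq> carrier (perm_group (residue_seqs p))"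
    using unipotent_filtrationD(1) by auto
  show "\<one>\<^bsub>perm_group (residue_seqs p)\<^esub> \<in> unipotent_filtration p i"
    by (simp add: unipotent_filtration_def permutes_id)
  show "\<phi> \<otimes>\<^bsub>perm_group (residue_seqs p)\<^esub> \<psi> \<in> unipotent_filtration p i"
    if \<phi>: "\<phi> \<in> unipotent_filtration p i" and \<psi>: "\<psi> \<in> unipotent_filtration p i" for \<phi> \<psi>
  proof -
    have "\<phi> (\<psi> f) s = f s" if f: "f \<in> residue_seqs p" "\<forall>s<r. f s = 0" "s < r + i" for f r s
    proof -
      have \<psi>f: "\<psi> f s' = f s'" if "s' < r + i" for s'
        using unipotent_filtrationD(3)[OF \<psi> f(1)] f(2) that by blast
      have "\<phi> (\<psi> f) s = \<psi> f s"
      proof (rule unipotent_filtrationD(3)[OF \<phi> unipotent_filtrationD(4)[OF \<psi> f(1)] _ f(3)])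
        show "\<psi> f s' = 0" if "s' < r" for s'
          using \<psi>f[of s'] f(2) that by simp
      qed
      then show ?thesis
        using \<psi>f f(3) by simp
    qed
    then show ?thesis
      using unipotent_filtrationD(1,2,4)[OF \<phi>] unipotent_filtrationD(1,2,4)[OF \<psi>]
      by (auto simp: unipotent_filtration_def intro: permutes_compose)
  qed
  show "inv\<^bsub>perm_group (residue_seqs p)\<^esub> \<phi> \<in> unipotent_filtration p i"
    if \<phi>: "\<phi> \<in> unipotent_filtration p i" for \<phi>
  proof -
    note perm = unipotent_filtrationD(1)[OF \<phi>]
    define \<psi> where "\<psi> = inv_into UNIV \<phi>"
    have \<psi>: "\<psi> permutes residue_seqs p"
      unfolding \<psi>_def by (rule permutes_inv[OF perm])
    have \<psi>\<phi>: "\<phi> (\<psi> f) = f" "\<psi> (\<phi> f) = f" for f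
      using permutes_inverses[OF perm] by (simp_all add: \<psi>_def)
    have closed: "\<psi> f \<in> residue_seqs p" if "f \<in> residue_seqs p" for f
      using permutes_in_image[OF \<psi>] that by blast
    have "\<psi> (seq_add p f g) = seq_add p (\<psi> f) (\<psi> g)" if "f \<in> residue_seqs p" "g \<in> residue_seqs p" for f g
      using unipotent_filtrationD(2)[OF \<phi> closed[OF that(1)] closed[OF that(2)]] by (metis \<psi>\<phi>)
    moreover have "\<psi> f s = f s" if f: "f \<in> residue_seqs p" "\<forall>s<r. f s = 0" "s < r + i" for f r s
    proof -
      have "\<psi> f s' = 0" if "s' < r" for s'
        using unipotent_filtration_vanish[OF \<phi> assms closed[OF f(1)], of r s'] f(2) that by (simp add: \<psi>\<phi>)
      then show ?thesis
        using unipotent_filtrationD(3)[OF \<phi> closed[OF f(1)], of r s] f(3) by (simp add: \<psi>\<phi>)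
    qed
    ultimately show ?thesis
      using \<psi> perm_group_inv[OF perm] by (simp add: unipotent_filtration_def \<psi>_def)
  qed
qed

lemma unipotent_filtration_mono:
  "1 \<le> i \<Longrightarrow> unipotent_filtration p i \<subseteq> unipotent_filtration p 1"
  unfolding unipotent_filtration_def by fastforce

text \<open>With \<open>\<phi> = 1 + u\<close> and \<open>\<psi> = 1 + v\<close>, the difference \<open>\<phi> \<psi> - \<psi> \<phi> = u v - v u\<close> raises the
  degree by the sum of the degrees of \<open>u\<close> and \<open>v\<close>.\<close>

lemma unipotent_filtration_commutator:
  assumes i: "1 \<le> i" and \<phi>: "\<phi> \<in> unipotent_filtration p i" and \<psi>: "\<psi> \<in> unipotent_filtration p 1"
  shows "commutator (perm_group (residue_seqs p)) \<phi> \<psi> \<in> unipotent_filtration p (Suc i)"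
proof -
  let ?P = "perm_group (residue_seqs p)"
  interpret P: group ?P
    by simp
  define c where "c = commutator ?P \<phi> \<psi>"
  have sub: "subgroup (unipotent_filtration p 1) ?P"
    by (rule unipotent_filtration_subgroup) simp
  have \<phi>1: "\<phi> \<in> unipotent_filtration p 1"
    using \<phi> unipotent_filtration_mono[OF i] by blast
  have c1: "c \<in> unipotent_filtration p 1"
    unfolding c_def commutator_def
    by (intro subgroup.m_closed[OF sub] subgroup.m_inv_closed[OF sub] \<phi>1 \<psi>)
  have \<psi>\<phi>: "\<psi> \<circ> \<phi> \<in> unipotent_filtration p 1"
    using subgroup.m_closed[OF sub \<psi> \<phi>1] by simp
  have eq: "\<psi> (\<phi> (c f)) = \<phi> (\<psi> f)" for f
    using P.mult_commutator[of \<phi> \<psi>] unipotent_filtrationD(1)[OF \<phi>] unipotent_filtrationD(1)[OF \<psi>]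
    by (simp add: c_def fun_eq_iff)
  \<comment> \<open>The comparison is made after applying \<psi> \<circ> \<phi>, which reflects
    agreement of initial segments and turns the commutator into \<phi> \<circ> \<psi>, so that no
    inverse has to be computed.\<close>
  have "c f s = f s" if f: "f \<in> residue_seqs p" "\<forall>s<r. f s = 0" "s < r + Suc i" for f r s
  proof (rule unipotent_filtration_agree[OF \<psi>\<phi> order_refl _ f(1) _ f(3)])
    show "c f \<in> residue_seqs p"
      using unipotent_filtrationD(4)[OF c1 f(1)] .
    fix s assume s: "s < r + Suc i"
    \<comment> \<open>u = (\<psi> - 1) f vanishes below r + 1 and w = (\<phi> - 1) f below r + i.
      Hence \<phi> fixes u and \<psi> fixes w in the range below r + i + 1, and both \<phi> \<psi> f
      and \<psi> \<phi> f are f + u + w there.\<close>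
    define u where "u s = (\<psi> f s - f s) mod p" for s
    define w where "w s = (\<phi> f s - f s) mod p" for s
    have uw: "u \<in> residue_seqs p" "w \<in> residue_seqs p"
      using p by (simp_all add: residue_seqs_def u_def w_def)
    have \<phi>f: "\<phi> f \<in> residue_seqs p" and \<psi>f: "\<psi> f \<in> residue_seqs p"
      using unipotent_filtrationD(4)[OF \<phi> f(1)] unipotent_filtrationD(4)[OF \<psi> f(1)] .
    have "\<psi> f = seq_add p f u" "\<phi> f = seq_add p f w"
      using \<phi>f \<psi>f by (auto simp: seq_add_def u_def w_def fun_eq_iff mod_add_right_eq residue_seqs_def)
    then have "\<phi> (\<psi> f) = seq_add p (\<phi> f) (\<phi> u)" "\<psi> (\<phi> f) = seq_add p (\<psi> f) (\<psi> w)"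
      using unipotent_filtrationD(2)[OF \<phi> f(1) uw(1)] unipotent_filtrationD(2)[OF \<psi> f(1) uw(2)] by metis+
    moreover have "\<phi> u s = u s"
    proof (rule unipotent_filtrationD(3)[OF \<phi> uw(1), of "r + 1"])
      show "u s' = 0" if "s' < r + 1" for s'
        using unipotent_filtrationD(3)[OF \<psi> f(1), of r s'] f(2) that by (simp add: u_def)
    qed (use s in simp)
    moreover have "\<psi> w s = w s"
    proof (rule unipotent_filtrationD(3)[OF \<psi> uw(2), of "r + i"])
      show "w s' = 0" if "s' < r + i" for s'
        using unipotent_filtrationD(3)[OF \<phi> f(1), of r s'] f(2) that by (simp add: w_def)
    qed (use s in simp)
    ultimately have "\<phi> (\<psi> f) s = \<psi> (\<phi> f) s"
      by (simp add: seq_add_def u_def w_def mod_add_right_eq algebra_simps)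
    then show "(\<psi> \<circ> \<phi>) (c f) s = (\<psi> \<circ> \<phi>) f s"
      by (simp add: eq)
  qed
  then show ?thesis
    using unipotent_filtrationD(1,2)[OF c1] unfolding c_def[symmetric] unipotent_filtration_def by blast
qed

text \<open>The last non-zero entry, a 1, is copied one position further by each factor 1 + X as
  long as the run lasts. Beyond it everything is 0, so nothing is added to it; the entries below are
  irrelevant.\<close>

lemma unipotent_run:
  assumes "1 < p" and v: "v \<in> residue_seqs p" "\<And>s. s > P \<Longrightarrow> v s = 0" "v P = 1" and C: "{P..<P + k} \<subseteq> C"
  shows "(\<forall>s>P + k. (unipotent p C ^^ k) v s = 0) \<and> (unipotent p C ^^ k) v (P + k) = 1"
  using C
proof (induction k)
  case (Suc k)
  let ?v = "(unipotent p C ^^ k) v"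
  have IH: "\<forall>s>P + k. ?v s = 0" "?v (P + k) = 1"
  proof -
    have "{P..<P + k} \<subseteq> C"
      using Suc.prems by (auto simp: subset_iff)
    then show "\<forall>s>P + k. ?v s = 0" "?v (P + k) = 1"
      using Suc.IH by blast+
  qed
  have step: "(unipotent p C ^^ Suc k) v s = (?v s + shift C ?v s) mod p" for s
    using unipotent_funpow_closed[OF p v(1)] by (simp add: unipotent_def seq_add_def)
  have "shift C ?v s = 0" if "s > P + Suc k" for s
    using IH(1) that by (auto simp: shift_def)
  moreover have "shift C ?v (P + Suc k) = 1"
    using IH(2) Suc.prems by (auto simp: shift_def)
  ultimately show ?case
    unfolding step using IH(1) assms(1) by simp
qed (use v in simp)

end

section \<open>Residual nilpotence of the quotient by the normal closure of \<open>a\<^sup>d\<close>\<close>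

text \<open>Adjacent powers of t are merged: only the leading power of a may be trivial, hence the
  condition on \<open>tl ws\<close>.\<close>

definition syllable_reduced :: "int \<Rightarrow> (int \<times> int) list \<Rightarrow> bool" where
  "syllable_reduced d ws \<longleftrightarrow>
     (\<forall>(l, k)\<in>set ws. l \<in> {0..<d} \<and> k \<noteq> 0) \<and> (\<forall>(l, k)\<in>set (tl ws). l \<noteq> 0)"

lemma syllable_reduced_Nil [simp]: "syllable_reduced d []"
  by (simp add: syllable_reduced_def)

lemma syllable_reduced_Cons:
  "syllable_reduced d ((l, k) # ws) \<longleftrightarrow>
     l \<in> {0..<d} \<and> k \<noteq> 0 \<and> syllable_reduced d ws \<and> (ws \<noteq> [] \<longrightarrow> fst (hd ws) \<noteq> 0)"
  by (cases ws) (auto simp: syllable_reduced_def)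

lemma syllable_reduced_push:
  assumes "j \<in> {1, -1}" "syllable_reduced d ws" "0 < d"
  shows "syllable_reduced d ((0, j) # ws) \<or>
    (\<exists>k ws'. ws = (0, k) # ws' \<and> syllable_reduced d (if j + k = 0 then ws' else (0, j + k) # ws'))"
proof (cases ws)
  case (Cons w ws')
  obtain l k where "w = (l, k)" by force
  then show ?thesis
    using assms by (auto simp: Cons syllable_reduced_Cons)
qed (use assms in \<open>auto simp: syllable_reduced_Cons\<close>)

text \<open>The word is spelled out by runs of consecutive positions: a syllable \<open>t\<^sup>k\<close> takes
  \<open>k mod q\<close> positions and a syllable \<open>a\<^sup>l\<close> takes \<open>l\<close> positions.\<close>

fun run_length :: "nat \<Rightarrow> (int \<times> int) list \<Rightarrow> nat" where
  "run_length q [] = 0"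
| "run_length q ((l, k) # ws) = run_length q ws + nat (k mod int q) + nat l"

fun t_runs :: "nat \<Rightarrow> (int \<times> int) list \<Rightarrow> nat set" where
  "t_runs q [] = {}"
| "t_runs q ((l, k) # ws) =
     t_runs q ws \<union> {run_length q ws..<run_length q ws + nat (k mod int q)}"

fun a_runs :: "nat \<Rightarrow> (int \<times> int) list \<Rightarrow> nat set" where
  "a_runs q [] = {}"
| "a_runs q ((l, k) # ws) = a_runs q ws \<union>
     {run_length q ws + nat (k mod int q)..<run_length q ws + nat (k mod int q) + nat l}"

lemma t_runs_less: "s \<in> t_runs q ws \<Longrightarrow> s < run_length q ws"
  by (induction q ws rule: t_runs.induct) auto

lemma a_runs_less: "s \<in> a_runs q ws \<Longrightarrow> s < run_length q ws"
  by (induction q ws rule: t_runs.induct) auto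

context
  fixes q :: nat and d :: int
  assumes q: "0 < q"
begin

lemma nat_mod_less: "nat (k mod int q) < q"
  using q by (simp add: nat_less_iff)

lemma nat_mod_pos: "k \<noteq> 0 \<Longrightarrow> \<bar>k\<bar> < int q \<Longrightarrow> 0 < nat (k mod int q)"
  using q by (smt (verit) mod_pos_pos_trivial pos_mod_sign zero_less_nat_eq dvd_imp_le_int mod_0_imp_dvd)

text \<open>The run of t^k has k mod q < q positions. The position just before it ends the run of
  the preceding a^l, which is non-empty as l is not 0 inside a reduced word, so two t-runs never
  join.\<close>

lemma no_long_t_run:
  assumes "syllable_reduced d ws"
  shows "\<not> {s..<s + q} \<subseteq> t_runs q ws"
  using assms
proof (induction ws)
  case (Cons w ws)
  obtain l k where w: "w = (l, k)" by force
  have red: "syllable_reduced d ws" "ws \<noteq> [] \<longrightarrow> fst (hd ws) \<noteq> 0"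
    using Cons.prems unfolding w syllable_reduced_Cons by auto
  let ?P = "run_length q ws"
  show ?case
  proof
    assume sub: "{s..<s + q} \<subseteq> t_runs q (w # ws)"
    show False
    proof (cases "s < ?P")
      case True
      then obtain l' k' ws' where ws: "ws = (l', k') # ws'"
        by (cases ws) auto
      then have "0 < l'"
        using red by (auto simp: syllable_reduced_Cons)
      then have last: "?P - 1 \<notin> t_runs q ws"
        using t_runs_less[of "?P - 1" q ws'] by (auto simp: ws)
      show False
      proof (cases "s + q \<le> ?P")
        case True
        then have "{s..<s + q} \<subseteq> t_runs q ws"
          using sub by (auto simp: w)
        then show False
          using Cons.IH[OF red(1)] by blast
      next
        case False
        then have "?P - 1 \<in> {s..<s + q}"
          using True by auto
        then have "?P - 1 \<in> t_runs q (w # ws)"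
          using sub by blast
        then show False
          using last True by (auto simp: w)
      qed
    next
      case False
      have "s + q - 1 \<in> {s..<s + q}"
        using q by auto
      then have "s + q - 1 \<in> t_runs q (w # ws)"
        using sub by blast
      then have "s + q - 1 < ?P + nat (k mod int q)"
        using t_runs_less[of "s + q - 1" q ws] by (auto simp: w)
      then show False
        using False nat_mod_less[of k] by linarith
    qed
  qed
qed (use q in auto)

text \<open>The run of a^l has l < d positions and starts after the run of its own t^k. The latter
  is non-empty because 0 < |k| < q, so two a-runs never join.\<close>

lemma no_long_a_run:
  assumes "syllable_reduced d ws" "\<And>l k. (l, k) \<in> set ws \<Longrightarrow> \<bar>k\<bar> < int q" "0 < d"
  shows "\<not> {s..<s + nat d} \<subseteq> a_runs q ws"
  using assms(1,2)
proof (induction ws)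
  case (Cons w ws)
  obtain l k where w: "w = (l, k)" by force
  have red: "syllable_reduced d ws" "l \<in> {0..<d}"
    using Cons.prems unfolding w syllable_reduced_Cons by auto
  have K: "0 < nat (k mod int q)"
    using Cons.prems unfolding w syllable_reduced_Cons by (intro nat_mod_pos) auto
  let ?P = "run_length q ws"
  show ?case
  proof
    assume sub: "{s..<s + nat d} \<subseteq> a_runs q (w # ws)"
    show False
    proof (cases "s < ?P")
      case True
      show False
      proof (cases "s + nat d \<le> ?P")
        case True
        then have "{s..<s + nat d} \<subseteq> a_runs q ws"
          using sub by (auto simp: w)
        then show False
          using Cons.IH[OF red(1)] Cons.prems(2) by auto
      next
        case False
        then have "?P \<in> {s..<s + nat d}"
          using True by auto
        then have "?P \<in> a_runs q (w # ws)"
          using sub by blast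
        then show False
          using K a_runs_less[of ?P q ws] by (auto simp: w)
      qed
    next
      case False
      have "s + nat d - 1 \<in> {s..<s + nat d}" "s \<in> {s..<s + nat d}"
        using assms(3) by auto
      then have "s + nat d - 1 \<in> a_runs q (w # ws)" "s \<in> a_runs q (w # ws)"
        using sub by blast+
      then have "s + nat d - 1 < ?P + nat (k mod int q) + nat l" "?P + nat (k mod int q) \<le> s"
        using False assms(3) a_runs_less[of "s + nat d - 1" q ws] a_runs_less[of s q ws]
        unfolding w a_runs.simps Un_iff atLeastLessThan_iff by linarith+
      then show False
        using red(2) by auto
    qed
  qed
qed (use assms(3) in auto)

text \<open>In a non-empty word the lowest run belongs to a power of t. This is what lets the base
  factor a^l0 fix the first unit vector.\<close>

lemma zero_notin_a_runs:
  assumes "syllable_reduced d ws" "\<And>l k. (l, k) \<in> set ws \<Longrightarrow> \<bar>k\<bar> < int q"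
  shows "0 \<notin> a_runs q ws"
  using assms
proof (induction ws)
  case (Cons w ws)
  obtain l k where w: "w = (l, k)" by force
  have "0 < nat (k mod int q)"
    using Cons.prems unfolding w syllable_reduced_Cons by (intro nat_mod_pos) auto
  then show ?case
    using Cons by (auto simp: w syllable_reduced_Cons)
qed simp

text \<open>Each syllable carries the topmost entry, a 1, from the start of its two runs to their
  end by \<open>unipotent_run\<close>. Negative powers of t are avoided by passing to k mod q, as
  the q-th power of the image of t is trivial.\<close>

lemma unipotent_syllable_prod:
  assumes p: "1 < p" and \<alpha>: "unipotent p C permutes residue_seqs p" "0 \<notin> C" "a_runs q ws \<subseteq> C"
    and \<tau>: "unipotent p C' permutes residue_seqs p" "t_runs q ws \<subseteq> C'"
      "unipotent p C' [^]\<^bsub>perm_group (residue_seqs p)\<^esub> (int q) = id"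
    and l0: "0 \<le> l0" and "syllable_reduced d ws"
  defines "v \<equiv> syllable_prod (perm_group (residue_seqs p)) (unipotent p C) (unipotent p C') l0 ws
    (\<lambda>s. if s = 0 then 1 else 0)"
  shows "v \<in> residue_seqs p \<and> (\<forall>s>run_length q ws. v s = 0) \<and> v (run_length q ws) = 1"
  using \<alpha>(3) \<tau>(2) \<open>syllable_reduced d ws\<close> unfolding v_def
proof (induction ws)
  let ?P = "perm_group (residue_seqs p)"
  let ?e = "\<lambda>s :: nat. if s = 0 then 1 else 0 :: int"
  interpret P: group ?P
    by simp
  have pow: "(unipotent p C'' [^]\<^bsub>?P\<^esub> k) f = (unipotent p C'' ^^ nat k) f" if "0 \<le> k" for C'' f k
    using that int_pow_int[of ?P "unipotent p C''" "nat k"] by (simp add: perm_group_nat_pow)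
  {
    case Nil
    have e: "?e \<in> residue_seqs p"
      using p by (simp add: residue_seqs_def)
    have "unipotent p C ?e = ?e"
      using e \<alpha>(2) p by (auto simp: unipotent_def seq_add_def shift_def fun_eq_iff)
    then have "(unipotent p C ^^ k) ?e = ?e" for k
      by (induction k) auto
    then show ?case
      using pow[OF l0] e by simp
  next
    case (Cons w ws)
    obtain l k where w: "w = (l, k)" by force
    define u where "u = syllable_prod ?P (unipotent p C) (unipotent p C') l0 ws ?e"
    have red: "syllable_reduced d ws" "0 \<le> l"
      using Cons.prems(3) unfolding w syllable_reduced_Cons by auto
    have u: "u \<in> residue_seqs p" "\<And>s. s > run_length q ws \<Longrightarrow> u s = 0" "u (run_length q ws) = 1"
      using Cons.IH[OF _ _ red(1)] Cons.prems(1,2) unfolding u_def by (auto simp: w)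
    have "unipotent p C' [^]\<^bsub>?P\<^esub> k = unipotent p C' [^]\<^bsub>?P\<^esub> (k mod int q)"
      using P.int_pow_mod[of "unipotent p C'" "int q" k] \<tau>(1,3) by simp
    then have t: "(unipotent p C' [^]\<^bsub>?P\<^esub> k) u = (unipotent p C' ^^ nat (k mod int q)) u"
      using pow q by simp
    define u' where "u' = (unipotent p C' ^^ nat (k mod int q)) u"
    have p0: "0 < p"
      using p by simp
    have u': "u' \<in> residue_seqs p" "\<And>s. s > run_length q ws + nat (k mod int q) \<Longrightarrow> u' s = 0"
        "u' (run_length q ws + nat (k mod int q)) = 1"
      using unipotent_run[OF p0 p u, of "nat (k mod int q)" C'] Cons.prems(2)
        unipotent_funpow_closed[OF p0 u(1)] by (auto simp: w u'_def)
    have "syllable_prod ?P (unipotent p C) (unipotent p C') l0 (w # ws) ?e = (unipotent p C ^^ nat l) u'"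
      using t pow[OF red(2)] by (simp add: w u_def u'_def)
    then show ?case
      using unipotent_run[OF p0 p u', of "nat l" C] Cons.prems(1)
        unipotent_funpow_closed[OF p0 u'(1)] by (auto simp: w)
  }
qed

end

context baumslag_solitar
begin

text \<open>A reduced word of positive length is detected by the coefficient at the end of its runs.\<close>

lemma lower_central_omega_subset_N:
  fixes p :: nat
  assumes p: "prime p" and d_pow: "d = int (p ^ j)"
  shows "lower_central_omega G \<subseteq> N"
proof
  fix g assume g: "g \<in> lower_central_omega G"
  then have gL: "g \<in> lower_central G i" if "1 \<le> i" for i
    using lower_central_omega_subset[OF that] by blast
  then have gc: "g \<in> carrier G"
    using gL[of 1] by simp
  have "N #> g \<in> generate (G Mod N) {N #> a, N #> t}"
    using Mod_N.hom_closed[OF gc] carrier_Mod_N by blast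
  then have "\<exists>l0 ws. l0 \<in> {0..<d} \<and> syllable_reduced d ws \<and>
      N #> g = syllable_prod (G Mod N) (N #> a) (N #> t) l0 ws"
    by (rule Mod_N.H.ex_reduced_syllable_prod[OF Mod_N.hom_closed[OF a_closed]
          Mod_N.hom_closed[OF t_closed] Mod_N_a_pow_d d_pos])
      (simp, simp add: syllable_reduced_Cons, erule (1) syllable_reduced_push[OF _ _ d_pos])
  then obtain l0 ws where ws: "l0 \<in> {0..<d}" "syllable_reduced d ws"
      "N #> g = syllable_prod (G Mod N) (N #> a) (N #> t) l0 ws"
    by blast
  let ?w = "syllable_prod G a t l0 ws"
  have "N #> g = N #> ?w"
    using ws(3) hom_syllable_prod[OF is_group group_Mod_N hom_Mod_N] by simp
  then obtain c where c: "c \<in> N" "g = c \<otimes> ?w"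
    by (rule normal.Mod_eqD[OF N_normal gc syllable_prod_closed[OF a_closed t_closed]])
  have cc: "c \<in> carrier G"
    using c(1) N_subset by blast
  show "g \<in> N"
  proof (cases "ws = []")
    \<comment> \<open>A word without t is already seen in the abelian quotient Z x Z_d, where g
      vanishes as an element of \<gamma>_2.\<close>
    case True
    interpret ab: group_hom G "integer_group \<times>\<times> integer_mod_group (nat d)" "abelian_hom d"
      by (rule group_hom_abelian_hom[OF d_pos d_dvd_diff])
    have "abelian_hom d g = (0, 0)"
      using D_subset_kernel[OF d_pos d_dvd_diff gL[of 2]] by simp
    moreover have "abelian_hom d g = (0, l0)"
      using c cc True N_subset_kernel[OF c(1)] abelian_hom_t_a[OF d_pos d_dvd_diff, of 0 l0] ws(1) by simp
    ultimately show ?thesis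
      using c cc True by simp
  next
    case False
    \<comment> \<open>The number q = p^B has to be a power of p, for the order of 1 + X, and larger
      than every |k|, so that k mod q is non-zero. Both hold since |k| <= B < 2^B <= p^B.\<close>
    define B where "B = Max (insert 0 ((\<lambda>(l, k). nat \<bar>k\<bar>) ` set ws))"
    define q where "q = p ^ B"
    have q: "0 < q"
      using p by (simp add: q_def prime_gt_0_nat)
    have small: "\<bar>k\<bar> < int q" if "(l, k) \<in> set ws" for l k
    proof -
      have "nat \<bar>k\<bar> \<le> B"
        unfolding B_def using that by (intro Max_ge) force+
      also have "B < 2 ^ B"
        by (rule less_exp)
      also have "\<dots> \<le> q"
        unfolding q_def using p by (intro power_mono) (auto simp: prime_ge_2_nat)
      finally show ?thesis
        by linarith
    qed
    have p1: "1 < int p"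
      using p prime_gt_1_nat by auto
    then have p0: "0 < int p"
      by simp
    define C where "C = a_runs q ws"
    define C' where "C' = t_runs q ws"
    have \<alpha>_order: "(unipotent (int p) C ^^ (p ^ j)) f = f" if "f \<in> residue_seqs (int p)" for f
    proof (rule unipotent_order[OF p _ that])
      have "nat d = p ^ j"
        using d_pow by (simp only: nat_int)
      then show "\<not> {s..<s + p ^ j} \<subseteq> C" for s
        using no_long_a_run[OF q ws(2) _ d_pos, of s] small by (auto simp: C_def)
    qed
    have \<tau>_order: "(unipotent (int p) C' ^^ (p ^ B)) f = f" if "f \<in> residue_seqs (int p)" for f
      using unipotent_order[OF p _ that] no_long_t_run[OF q ws(2)] by (simp add: C'_def q_def)
    have pp: "0 < p ^ i" for i
      using p by (simp add: prime_gt_0_nat)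
    have \<alpha>: "unipotent (int p) C permutes residue_seqs (int p)"
      using unipotent_permutes[OF pp p0 \<alpha>_order] .
    have \<tau>: "unipotent (int p) C' permutes residue_seqs (int p)"
      using unipotent_permutes[OF pp p0 \<tau>_order] .
    let ?P = "perm_group (residue_seqs (int p))"
    interpret P: group ?P
      by simp
    have outside: "(unipotent (int p) E ^^ k) f = f" if "f \<notin> residue_seqs (int p)" for E k f
      using that by (induction k) (auto simp: unipotent_def)
    have \<alpha>_d: "unipotent (int p) C [^]\<^bsub>?P\<^esub> d = id"
      using \<alpha>_order outside[of _ "p ^ j" C] unfolding d_pow int_pow_int perm_group_nat_pow
      by (metis eq_id_iff)
    have \<tau>_q: "unipotent (int p) C' [^]\<^bsub>?P\<^esub> int q = id"
      using \<tau>_order outside[of _ "p ^ B" C'] unfolding q_def int_pow_int perm_group_nat_pow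
      by (metis eq_id_iff)
    have "unipotent (int p) C [^]\<^bsub>?P\<^esub> k = \<one>\<^bsub>?P\<^esub>" if "d dvd k" for k
      using that \<alpha>_d \<alpha> P.int_pow_one[unfolded perm_group_simps]
      by (auto elim!: dvdE simp flip: P.int_pow_pow)
    then have "unipotent (int p) C [^]\<^bsub>?P\<^esub> m \<otimes>\<^bsub>?P\<^esub> unipotent (int p) C'
        = unipotent (int p) C' \<otimes>\<^bsub>?P\<^esub> unipotent (int p) C [^]\<^bsub>?P\<^esub> n"
      using d_dvd_m d_dvd_n by simp
    then obtain \<rho> where \<rho>: "\<rho> \<in> hom G ?P" "\<rho> a = unipotent (int p) C" "\<rho> t = unipotent (int p) C'"
      using universal[OF P.is_group, of "unipotent (int p) C" "unipotent (int p) C'"] \<alpha> \<tau> by auto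
    interpret \<rho>: group_hom G ?P \<rho>
      using \<rho> is_group P.is_group by (simp add: group_hom_iff)
    define U where "U i = {x \<in> carrier G. \<rho> x \<in> unipotent_filtration (int p) i}" for i
    have U_subgroup: "subgroup (U i) G" if "1 \<le> i" for i
    proof -
      note sub = unipotent_filtration_subgroup[OF p0 that]
      show ?thesis
        using subgroup.m_closed[OF sub] subgroup.m_inv_closed[OF sub] subgroup.one_closed[OF sub]
        by (intro subgroup.intro) (auto simp: U_def simp del: perm_group_simps)
    qed
    have "{a, t} \<subseteq> U 1"
      using unipotent_in_filtration[OF p0] \<alpha> \<tau> by (simp add: U_def \<rho>(2,3))
    then have U_1: "carrier G \<subseteq> U 1"
      unfolding carrier_eq by (rule generate_subgroup_incl) (rule U_subgroup, simp)
    have "lower_central G i \<subseteq> U i" if "1 \<le> i" for i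
    proof (rule lower_central_subset_filtration[where D = U, OF U_subgroup U_1 _ that])
      fix i x y assume i: "1 \<le> i" and x: "x \<in> U i" and y: "y \<in> carrier G"
      have "\<rho> y \<in> unipotent_filtration (int p) 1"
        using U_1 y by (auto simp: U_def)
      then have "commutator ?P (\<rho> x) (\<rho> y) \<in> unipotent_filtration (int p) (Suc i)"
        using unipotent_filtration_commutator[OF p0 i] x by (auto simp: U_def)
      then show "commutator G x y \<in> U (Suc i)"
        using x y \<rho>.hom_commutator[of x y] by (auto simp: U_def)
    qed
    \<comment> \<open>One more than the run length: with r = 0 the filtration condition then still
      covers the position \<open>run_length q ws\<close>, where the unit vector has entry 0 and the
      word has produced 1.\<close>
    then have \<rho>g: "\<rho> g \<in> unipotent_filtration (int p) (Suc (run_length q ws))"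
      using gL[of "Suc (run_length q ws)"] by (auto simp: U_def)
    have "\<rho> c = id"
      using N_kernel[OF P.is_group \<rho>(1) _ c(1)] \<alpha>_d by (simp add: \<rho>(2))
    then have "\<rho> g = \<rho> ?w"
      using c cc by simp
    also have "\<rho> ?w = syllable_prod ?P (unipotent (int p) C) (unipotent (int p) C') l0 ws"
      using hom_syllable_prod[OF is_group P.is_group \<rho>(1)] by (simp add: \<rho>(2,3))
    finally have eq: "\<rho> g = syllable_prod ?P (unipotent (int p) C) (unipotent (int p) C') l0 ws" .
    let ?e = "\<lambda>s :: nat. if s = 0 then 1 else 0 :: int"
    have e: "?e \<in> residue_seqs (int p)"
      using p1 by (simp add: residue_seqs_def)
    have "\<rho> g ?e (run_length q ws) = 1"
      unfolding eq
      using unipotent_syllable_prod[OF q p1 \<alpha> _ _ \<tau> _ \<tau>_q _ ws(2), of l0]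
        zero_notin_a_runs[OF q ws(2) small] ws(1) by (auto simp: C_def C'_def)
    moreover have "\<rho> g ?e (run_length q ws) = ?e (run_length q ws)"
      by (rule unipotent_filtrationD(3)[OF \<rho>g e, of 0]) auto
    moreover have "0 < run_length q ws"
    proof -
      obtain l k ws' where ws': "ws = (l, k) # ws'"
        using False by (cases ws) auto
      then have "0 < nat (k mod int q)"
        using ws(2) small[of l k] by (intro nat_mod_pos[OF q]) (auto simp: syllable_reduced_Cons)
      then show ?thesis
        by (simp add: ws')
    qed
    ultimately show ?thesis
      by simp
  qed
qed

end

section \<open>The chains of subgroups and their quotients, read off from A = N\<close>

theorem proposition5:
  fixes m n d :: int
    and G :: "bs_letter word set set monoid"
    and a t :: "bs_letter word set set"
    and R A G' :: "bs_letter word set set set"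
    and Abar :: "bs_letter word set set set set"
  assumes "0 < m" and "m \<le> \<bar>n\<bar>"
    and "d = gcd m n"
    and "G = BS m n" and "a = bs_a m n" and "t = bs_t m n"
    and "\<not> residually_finite G"
    and "R = finite_residual G"
    and "Abar = generate (G Mod R)
           {R #>\<^bsub>G\<^esub> (t [^]\<^bsub>G\<^esub> k \<otimes>\<^bsub>G\<^esub> a [^]\<^bsub>G\<^esub> d \<otimes>\<^bsub>G\<^esub> t [^]\<^bsub>G\<^esub> (- k)) | k :: int. True}"
    and "subgroup A G" and "R \<subseteq> A" and "carrier (G\<lparr>carrier := A\<rparr> Mod R) = Abar"
    and "G' = lower_central G 2"
  shows "subgroup_chain G [carrier G, G' <#>\<^bsub>G\<^esub> A, A, R]
       \<and> subgroup_chain G [carrier G, G', lower_central_omega G, R]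
       \<and> R \<lhd> G\<lparr>carrier := A\<rparr> \<and> comm_group (G\<lparr>carrier := A\<rparr> Mod R)
       \<and> (n - m \<ge> d \<and> d > 1 \<longrightarrow>
            (G' <#>\<^bsub>G\<^esub> A \<lhd> G \<and> G Mod (G' <#>\<^bsub>G\<^esub> A) \<cong> integer_group \<times>\<times> integer_mod_group (nat d))
          \<and> (A \<lhd> G \<and> G Mod A \<cong> free_product integer_group (integer_mod_group (nat d)))
          \<and> (G' \<lhd> G \<and> G Mod G' \<cong> integer_group \<times>\<times> integer_mod_group (nat (n - m)))
          \<and> (A \<lhd> G\<lparr>carrier := G' <#>\<^bsub>G\<^esub> A\<rparr>
             \<and> G\<lparr>carrier := G' <#>\<^bsub>G\<^esub> A\<rparr> Mod A \<cong> free_group (UNIV :: nat set)))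
       \<and> (n - m > d \<and> d = 1 \<longrightarrow>
            G' \<subset> A
          \<and> (A \<lhd> G \<and> G Mod A \<cong> integer_group)
          \<and> (G' \<lhd> G\<lparr>carrier := A\<rparr>
             \<and> G\<lparr>carrier := A\<rparr> Mod G' \<cong> integer_mod_group (nat (n - m))))
       \<and> (n - m = d \<and> d = 1 \<longrightarrow> G' = A \<and> A = lower_central_omega G)
       \<and> ((\<exists>(p :: nat) j :: nat. prime p \<and> d = int (p ^ j)) \<longrightarrow>
            subgroup_chain G [carrier G, G' <#>\<^bsub>G\<^esub> A, A, lower_central_omega G, R])
       \<and> (n = m + d \<and> (\<exists>(p :: nat) j :: nat. prime p \<and> d = int (p ^ j)) \<longrightarrow>
            subgroup_chain G [carrier G, G', A, lower_central_omega G, R])"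
proof -
  interpret G: group G
    unfolding \<open>G = BS m n\<close> by (rule group_BS)
  have bs: "baumslag_solitar G m n d a t"
    by (intro baumslag_solitar.intro baumslag_solitar_axioms.intro G.is_group assms)
  have x: "baumslag_solitar.conj_a G d a t k = t [^]\<^bsub>G\<^esub> k \<otimes>\<^bsub>G\<^esub> a [^]\<^bsub>G\<^esub> d \<otimes>\<^bsub>G\<^esub> t [^]\<^bsub>G\<^esub> (- k)" for k
    by (rule baumslag_solitar.conj_a_def[OF bs])
  interpret bs: baumslag_solitar_quotient G m n d a t A
  proof (intro baumslag_solitar_quotient.intro baumslag_solitar_quotient_axioms.intro bs)
    show "carrier (G\<lparr>carrier := A\<rparr> Mod finite_residual G)
        = generate (G Mod finite_residual G)
            {finite_residual G #>\<^bsub>G\<^esub> baumslag_solitar.conj_a G d a t k | k. True}"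
      unfolding x assms(8)[symmetric] using assms(9,12) by simp
    show "subgroup A G" "finite_residual G \<subseteq> A"
      using assms(8,10,11) by simp_all
  qed
  have R: "R = bs.R" and G': "G' = bs.D"
    using assms(8,13) by simp_all
  \<comment> \<open>From here on every claim about \<open>A\<close> is a claim about the normal
    closure of a^d, and R enters only as the bottom of the chains and in the abelian quotient A /
    R.\<close>
  have A: "A = bs.N"
    by (rule bs.A_eq_N[OF bs.R_subset_N])
  have R_subgroup: "subgroup R G"
    unfolding R by (rule normal_imp_subgroup[OF G.finite_residual_normal])
  have chain1: "subgroup_chain G [carrier G, G' <#>\<^bsub>G\<^esub> A, A, R]"
    using bs.subgroup_D_N bs.N_subset_D_N bs.R_subset_N R_subgroup G.subgroup_self bs.N_subgroup
      subgroup.subset[OF bs.subgroup_D_N] bs.N_subset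
    unfolding subgroup_chain_def A G' R by auto
  have "bs.D \<subseteq> carrier G"
    by (rule G.lower_central_subset)
  moreover have "lower_central_omega G \<subseteq> bs.D"
    by (rule G.lower_central_omega_subset) simp
  ultimately have chain2: "subgroup_chain G [carrier G, G', lower_central_omega G, R]"
    using bs.R_subset_lower_central_omega R_subgroup G.subgroup_self
      G.subgroup_lower_central_omega G.lower_central_subgroup
    unfolding subgroup_chain_def G' R by auto
  have case1: "G' <#>\<^bsub>G\<^esub> A \<lhd> G \<and> G Mod (G' <#>\<^bsub>G\<^esub> A) \<cong> integer_group \<times>\<times> integer_mod_group (nat d)
      \<and> A \<lhd> G \<and> G Mod A \<cong> free_product integer_group (integer_mod_group (nat d))
      \<and> G' \<lhd> G \<and> G Mod G' \<cong> integer_group \<times>\<times> integer_mod_group (nat (n - m))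
      \<and> A \<lhd> G\<lparr>carrier := G' <#>\<^bsub>G\<^esub> A\<rparr>
      \<and> G\<lparr>carrier := G' <#>\<^bsub>G\<^esub> A\<rparr> Mod A \<cong> free_group (UNIV :: nat set)"
    if "n - m \<ge> d" "d > 1"
  proof -
    have "n > m"
      using that by simp
    then show ?thesis
      unfolding A G' using bs.normal_D_N bs.Mod_D_N_iso bs.N_normal bs.Mod_N_iso_free_product bs.D_normal
        bs.Mod_D_iso bs.D_N_Mod_N_iso[OF \<open>d > 1\<close>]
        G.normal_restrict_supergroup[OF bs.subgroup_D_N bs.N_normal bs.N_subset_D_N] by blast
  qed
  have case2: "G' \<subset> A \<and> A \<lhd> G \<and> G Mod A \<cong> integer_group
      \<and> G' \<lhd> G\<lparr>carrier := A\<rparr> \<and> G\<lparr>carrier := A\<rparr> Mod G' \<cong> integer_mod_group (nat (n - m))"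
    if "n - m > d" "d = 1"
  proof -
    have "n > m"
      using that by simp
    moreover have "a \<in> bs.N"
      using bs.a_pow_d_in_N \<open>d = 1\<close> by simp
    ultimately show ?thesis
      unfolding A G' using bs.D_subset_N[OF \<open>d = 1\<close>] bs.a_notin_D that bs.N_normal
        bs.Mod_N_iso_integer[OF \<open>d = 1\<close>] bs.N_Mod_D_iso[OF \<open>d = 1\<close>]
        G.normal_restrict_supergroup[OF bs.N_subgroup bs.D_normal bs.D_subset_N[OF \<open>d = 1\<close>]] by blast
  qed
  have case3: "G' = A \<and> A = lower_central_omega G" if "n - m = d" "d = 1"
  proof -
    have "n = m + 1"
      using that by simp
    then show ?thesis
      unfolding A G' using bs.N_eq_D[OF \<open>d = 1\<close>] bs.N_eq_lower_central_omega[OF \<open>d = 1\<close>] by simp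
  qed
  have omega: "lower_central_omega G \<subseteq> A" if "\<exists>(p :: nat) j :: nat. prime p \<and> d = int (p ^ j)"
    unfolding A using that bs.lower_central_omega_subset_N by blast
  have case4: "subgroup_chain G [carrier G, G' <#>\<^bsub>G\<^esub> A, A, lower_central_omega G, R]"
    if "\<exists>(p :: nat) j :: nat. prime p \<and> d = int (p ^ j)"
    using chain1 chain2 omega[OF that] unfolding subgroup_chain_def by auto
  have case5: "subgroup_chain G [carrier G, G', A, lower_central_omega G, R]"
    if "n = m + d" "\<exists>(p :: nat) j :: nat. prime p \<and> d = int (p ^ j)"
    using chain1 chain2 omega[OF that(2)] bs.N_subset_D[OF that(1)]
    unfolding subgroup_chain_def A G' by auto
  show ?thesis
    using chain1 chain2 bs.R_normal_A bs.A_Mod_R_comm case1 case2 case3 case4 case5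
    unfolding R by blast
qed

end
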